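(* Let $(M,h)$ be a pseudo-Riemannian manifold and $\nabla$ an affine connection on $M$. Let $\tilde h$ be the Patterson-Walker metric on $T^*M$ determined by $\nabla$, and let $\tilde J^\nabla_\mp=\Phi^\nabla\circ\hat J_\mp\circ(\Phi^\nabla)^{-1}$ be the $(1,1)$-tensor fields on $T^*M$ with $(\tilde J^\nabla_\mp)^2=\mp I$ obtained from $\hat J_\mp(X+\alpha)=\mp h^{-1}(\alpha)+h(X)$ on $TM\oplus T^*M$. Then $(T^*M,\tilde J^\nabla_-,\tilde h)$ is a Norden manifold and $(T^*M,\tilde J^\nabla_+,\tilde h)$ is an almost Para-Norden manifold. Moreover, if $(M,h,\nabla)$ is a flat quasi-statistical manifold, then $(T^*M,\tilde J^\nabla_-,\tilde h)$ is a complex Norden manifold and $(T^*M,\tilde J^\nabla_+,\tilde h)$ is a Para-Norden manifold.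
   Context: $\nabla$ may have torsion $T^\nabla(X,Y)=\nabla_XY-\nabla_YX-[X,Y]$. $h$ also denotes the isomorphism $TM\to T^*M$, $h(X)=h(X,\cdot)$, with inverse $h^{-1}$. $(M,h,\nabla)$ is a quasi-statistical manifold if $(\nabla_Xh)(Y,Z)-(\nabla_Yh)(X,Z)+h(T^\nabla(X,Y),Z)=0$ for all $X,Y,Z$; it is flat if the curvature of $\nabla$ vanishes. With coordinates $(\tilde x^i,y_i)$ on $T^*M$ induced by $(x^i)$ on $M$ and $\nabla_{\partial/\partial x^i}\partial/\partial x^j=\Gamma^k_{ij}\partial/\partial x^k$, the horizontal lift of $X=X^i\partial/\partial x^i$ is $X^H=X^i\big(\partial/\partial\tilde x^i+y_k\Gamma^k_{il}\,\partial/\partial y_l\big)$ and the vertical lift of $\alpha=\alpha_idx^i$ is $\alpha^V=\alpha_i\,\partial/\partial y_i$. At each $a\in T^*M$ over $p\in M$, $\Phi^\nabla:T_pM\oplus T^*_pM\to T_a(T^*M)$ is the isomorphism $X+\alpha\mapsto X^H_a+\alpha^V_a$; so $\tilde J^\nabla_\mp(X^H)=(h(X))^V$ and $\tilde J^\nabla_\mp(\alpha^V)=\mp(h^{-1}(\alpha))^H$. Patterson-Walker metric: $\tilde h(X^H,Y^H)=0$, $\tilde h(\alpha^V,\beta^V)=0$, $\tilde h(\alpha^V,X^H)=\tilde h(X^H,\alpha^V)=\alpha(X)$ (used also when $\nabla$ has torsion). A Norden manifold $(N,J,g)$ is an almost complex manifold $(N,J)$ with a pseudo-Riemannian metric $g$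 such that $J$ is $g$-symmetric ($g(JA,B)=g(A,JB)$); it is a complex Norden manifold if moreover $J$ is integrable. An almost Para-Norden manifold $(N,J,g)$ is an even-dimensional manifold $N$ with a pseudo-Riemannian metric $g$ and a $(1,1)$-tensor field $J$ with $J^2=I$, whose $+1$ and $-1$ eigenbundles have equal rank, and such that $J$ is $g$-symmetric; it is a Para-Norden manifold if moreover $J$ is integrable. Integrable means that the Nijenhuis tensor $N_J(A,B)=[JA,JB]-J[JA,B]-J[A,JB]+J^2[A,B]$ vanishes. *)

theory Defs
  imports "HOL-Analysis.Analysis" "HOL-Library.Function_Algebras"
begin

text \<open>
  Tangent vectors and covectors are functions, added and scaled pointwise; this makes every
  function space into a real vector space.
\<close>

instantiation "fun" :: (type, real_vector) real_vector
begin

definition scaleR_fun :: "real \<Rightarrow> ('a \<Rightarrow> 'b) \<Rightarrow> 'a \<Rightarrow> 'b"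
  where "scaleR_fun r f = (\<lambda>x. r *\<^sub>R f x)"

instance
  by standard (simp_all add: scaleR_fun_def plus_fun_def scaleR_add_right scaleR_add_left)

end

text \<open>Linearity on a linear subspace; nothing is required of the values outside.\<close>

definition linear_on :: "'v::real_vector set \<Rightarrow> ('v \<Rightarrow> 'w::real_vector) \<Rightarrow> bool"
  where "linear_on S f \<longleftrightarrow>
    (\<forall>x\<in>S. \<forall>y\<in>S. f (x + y) = f x + f y) \<and> (\<forall>r. \<forall>x\<in>S. f (r *\<^sub>R x) = r *\<^sub>R f x)"


section \<open>Smooth manifolds\<close>

text \<open>\<open>Ck_on k S f\<close> is the class $C^k$ on an open subset \<open>S\<close> of a Euclidean space (existence of
  derivatives at one order forces continuity at the order below).\<close>

primrec Ck_on :: "nat \<Rightarrow> 'e::euclidean_space set \<Rightarrow> ('e \<Rightarrow> 'b::real_normed_vector) \<Rightarrow> bool"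
  where
    "Ck_on 0 S f \<longleftrightarrow> continuous_on S f"
  | "Ck_on (Suc k) S f \<longleftrightarrow>
      (\<forall>x\<in>S. f differentiable at x) \<and>
      (\<forall>i\<in>Basis. Ck_on k S (\<lambda>x. frechet_derivative f (at x) i))"

definition smooth_on :: "'e::euclidean_space set \<Rightarrow> ('e \<Rightarrow> 'b::real_normed_vector) \<Rightarrow> bool"
  where "smooth_on S f \<longleftrightarrow> (\<forall>k. Ck_on k S f)"

text \<open>A chart is a pair of its domain and its coordinate map. The model space \<open>'e\<close> is an arbitrary
  Euclidean space, so the dimension of the manifold is \<open>DIM('e)\<close>, and the \<open>i\<close>-th coordinate of
  \<open>p\<close> is \<open>cmap c p \<bullet> i\<close> for \<open>i \<in> Basis\<close>.\<close>

type_synonym ('a, 'e) chart = "'a set \<times> ('a \<Rightarrow> 'e)"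

abbreviation cdom :: "('a, 'e) chart \<Rightarrow> 'a set"
  where "cdom c \<equiv> fst c"

abbreviation cmap :: "('a, 'e) chart \<Rightarrow> 'a \<Rightarrow> 'e"
  where "cmap c \<equiv> snd c"

definition cinv :: "('a, 'e) chart \<Rightarrow> 'e \<Rightarrow> 'a"
  where "cinv c = inv_into (cdom c) (cmap c)"

definition points :: "('a, 'e) chart set \<Rightarrow> 'a set"
  where "points A = (\<Union>c\<in>A. cdom c)"

text \<open>The topology for which all charts are homeomorphisms onto open sets.\<close>

definition manifold_topology :: "('a, 'e::euclidean_space) chart set \<Rightarrow> 'a topology"
  where "manifold_topology A =
    topology (\<lambda>W. W \<subseteq> points A \<and> (\<forall>c\<in>A. open (cmap c ` (cdom c \<inter> W))))"

text \<open>A smooth manifold is given by an atlas, which need not be maximal.\<close>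

definition smooth_manifold :: "('a, 'e::euclidean_space) chart set \<Rightarrow> bool"
  where "smooth_manifold A \<longleftrightarrow>
    (\<forall>c\<in>A. inj_on (cmap c) (cdom c) \<and> open (cmap c ` cdom c)) \<and>
    (\<forall>c\<in>A. \<forall>d\<in>A. open (cmap c ` (cdom c \<inter> cdom d)) \<and>
       smooth_on (cmap c ` (cdom c \<inter> cdom d)) (cmap d \<circ> cinv c)) \<and>
    Hausdorff_space (manifold_topology A) \<and>
    second_countable (manifold_topology A)"

definition smooth_fun :: "('a, 'e::euclidean_space) chart set \<Rightarrow> 'a set \<Rightarrow> ('a \<Rightarrow> real) \<Rightarrow> bool"
  where "smooth_fun A W f \<longleftrightarrow> openin (manifold_topology A) W \<and>
    (\<forall>c\<in>A. smooth_on (cmap c ` (cdom c \<inter> W)) (f \<circ> cinv c))"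

definition smooth_near :: "('a, 'e::euclidean_space) chart set \<Rightarrow> 'a \<Rightarrow> ('a \<Rightarrow> real) \<Rightarrow> bool"
  where "smooth_near A p f \<longleftrightarrow> (\<exists>W. p \<in> W \<and> smooth_fun A W f)"


section \<open>Tangent and cotangent spaces, vector fields\<close>

text \<open>A tangent vector at \<open>p\<close> is a directional derivative at \<open>p\<close>, acting on the functions that are
  smooth near \<open>p\<close>. It takes the value 0 on all other functions, by convention.\<close>

type_synonym 'a tvec = "('a \<Rightarrow> real) \<Rightarrow> real"

text \<open>\<open>coord_vec A c p u\<close> is $u^i\,\partial/\partial x^i$ at \<open>p\<close> in the chart \<open>c\<close>, where \<open>u\<close> has
  the components $u^i$. In particular \<open>coord_vec A c p i\<close>, for \<open>i \<in> Basis\<close>, is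
  $\partial/\partial x^i$.\<close>

definition coord_vec ::
    "('a, 'e::euclidean_space) chart set \<Rightarrow> ('a, 'e) chart \<Rightarrow> 'a \<Rightarrow> 'e \<Rightarrow> 'a tvec"
  where "coord_vec A c p u =
    (\<lambda>f. if smooth_near A p f then frechet_derivative (f \<circ> cinv c) (at (cmap c p)) u else 0)"

definition tangent_space :: "('a, 'e::euclidean_space) chart set \<Rightarrow> 'a \<Rightarrow> 'a tvec set"
  where "tangent_space A p = {v. \<exists>c\<in>A. p \<in> cdom c \<and> (\<exists>u. v = coord_vec A c p u)}"

text \<open>Covectors are normalised to be 0 outside of the tangent space, so that a linear functional
  on the tangent space is a unique object.\<close>

type_synonym 'a covec = "'a tvec \<Rightarrow> real"

definition cotangent_space :: "('a, 'e::euclidean_space) chart set \<Rightarrow> 'a \<Rightarrow> 'a covec set"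
  where "cotangent_space A p =
    {\<alpha>. linear_on (tangent_space A p) \<alpha> \<and> (\<forall>v. v \<notin> tangent_space A p \<longrightarrow> \<alpha> v = 0)}"

type_synonym 'a vfield = "'a \<Rightarrow> 'a tvec"

text \<open>Smooth vector fields on an open set \<open>W\<close>; the values outside of \<open>W\<close> are irrelevant.\<close>

definition smooth_vfield :: "('a, 'e::euclidean_space) chart set \<Rightarrow> 'a set \<Rightarrow> 'a vfield \<Rightarrow> bool"
  where "smooth_vfield A W X \<longleftrightarrow> openin (manifold_topology A) W \<and>
    (\<forall>p\<in>W. X p \<in> tangent_space A p) \<and>
    (\<forall>V f. V \<subseteq> W \<and> smooth_fun A V f \<longrightarrow> smooth_fun A V (\<lambda>p. X p f))"

definition lie_bracket ::
    "('a, 'e::euclidean_space) chart set \<Rightarrow> 'a vfield \<Rightarrow> 'a vfield \<Rightarrow> 'a vfield"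
  where "lie_bracket A X Y = (\<lambda>p f.
    if smooth_near A p f then X p (\<lambda>q. Y q f) - Y p (\<lambda>q. X q f) else 0)"


section \<open>Pseudo-Riemannian metrics and affine connections\<close>

type_synonym 'a metric_tensor = "'a \<Rightarrow> 'a tvec \<Rightarrow> 'a tvec \<Rightarrow> real"

definition pseudo_riemannian_metric ::
    "('a, 'e::euclidean_space) chart set \<Rightarrow> 'a metric_tensor \<Rightarrow> bool"
  where "pseudo_riemannian_metric A g \<longleftrightarrow>
    (\<forall>p\<in>points A. \<forall>v\<in>tangent_space A p. linear_on (tangent_space A p) (g p v)) \<and>
    (\<forall>p\<in>points A. \<forall>v\<in>tangent_space A p. \<forall>w\<in>tangent_space A p. g p v w = g p w v) \<and>
    (\<forall>p\<in>points A. \<forall>v\<in>tangent_space A p.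
       (\<forall>w\<in>tangent_space A p. g p v w = 0) \<longrightarrow> v = 0) \<and>
    (\<forall>W X Y. smooth_vfield A W X \<and> smooth_vfield A W Y \<longrightarrow>
       smooth_fun A W (\<lambda>p. g p (X p) (Y p)))"

definition pseudo_riemannian_manifold ::
    "('a, 'e::euclidean_space) chart set \<Rightarrow> 'a metric_tensor \<Rightarrow> bool"
  where "pseudo_riemannian_manifold A g \<longleftrightarrow> smooth_manifold A \<and> pseudo_riemannian_metric A g"

text \<open>The isomorphism $h : TM \to T^*M$, $h(X) = h(X,\cdot)$, and its inverse.\<close>

definition flat_map ::
    "('a, 'e::euclidean_space) chart set \<Rightarrow> 'a metric_tensor \<Rightarrow> 'a \<Rightarrow> 'a tvec \<Rightarrow> 'a covec"
  where "flat_map A h p v = (\<lambda>w. if w \<in> tangent_space A p then h p v w else 0)"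

definition sharp_map ::
    "('a, 'e::euclidean_space) chart set \<Rightarrow> 'a metric_tensor \<Rightarrow> 'a \<Rightarrow> 'a covec \<Rightarrow> 'a tvec"
  where "sharp_map A h p = inv_into (tangent_space A p) (flat_map A h p)"

text \<open>A connection acts on the vector fields over each open set, compatibly with restriction (the
  last condition), so that it applies directly to coordinate vector fields.\<close>

type_synonym 'a connection = "'a vfield \<Rightarrow> 'a vfield \<Rightarrow> 'a vfield"

definition affine_connection ::
    "('a, 'e::euclidean_space) chart set \<Rightarrow> 'a connection \<Rightarrow> bool"
  where "affine_connection A nabla \<longleftrightarrow>
    (\<forall>W X Y. smooth_vfield A W X \<and> smooth_vfield A W Y \<longrightarrow>
       smooth_vfield A W (nabla X Y)) \<and>
    (\<forall>W X X' Y. smooth_vfield A W X \<and> smooth_vfield A W X' \<and> smooth_vfield A W Y \<longrightarrow>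
       (\<forall>p\<in>W. nabla (\<lambda>q. X q + X' q) Y p = nabla X Y p + nabla X' Y p)) \<and>
    (\<forall>W f X Y. smooth_fun A W f \<and> smooth_vfield A W X \<and> smooth_vfield A W Y \<longrightarrow>
       (\<forall>p\<in>W. nabla (\<lambda>q. f q *\<^sub>R X q) Y p = f p *\<^sub>R nabla X Y p)) \<and>
    (\<forall>W X Y Y'. smooth_vfield A W X \<and> smooth_vfield A W Y \<and> smooth_vfield A W Y' \<longrightarrow>
       (\<forall>p\<in>W. nabla X (\<lambda>q. Y q + Y' q) p = nabla X Y p + nabla X Y' p)) \<and>
    (\<forall>W f X Y. smooth_fun A W f \<and> smooth_vfield A W X \<and> smooth_vfield A W Y \<longrightarrow>
       (\<forall>p\<in>W. nabla X (\<lambda>q. f q *\<^sub>R Y q) p = f p *\<^sub>R nabla X Y p + X p f *\<^sub>R Y p)) \<and>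
    (\<forall>W X X' Y Y'. smooth_vfield A W X \<and> smooth_vfield A W X' \<and>
       smooth_vfield A W Y \<and> smooth_vfield A W Y' \<and> (\<forall>p\<in>W. X p = X' p \<and> Y p = Y' p) \<longrightarrow>
       (\<forall>p\<in>W. nabla X Y p = nabla X' Y' p))"

definition torsion ::
    "('a, 'e::euclidean_space) chart set \<Rightarrow> 'a connection \<Rightarrow> 'a vfield \<Rightarrow> 'a vfield \<Rightarrow> 'a vfield"
  where "torsion A nabla X Y = (\<lambda>p. nabla X Y p - nabla Y X p - lie_bracket A X Y p)"

definition curvature ::
    "('a, 'e::euclidean_space) chart set \<Rightarrow> 'a connection \<Rightarrow>
      'a vfield \<Rightarrow> 'a vfield \<Rightarrow> 'a vfield \<Rightarrow> 'a vfield"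
  where "curvature A nabla X Y Z = (\<lambda>p.
    nabla X (nabla Y Z) p - nabla Y (nabla X Z) p - nabla (lie_bracket A X Y) Z p)"

text \<open>$(\nabla_X h)(Y,Z)$\<close>

definition cov_deriv_metric ::
    "'a connection \<Rightarrow> 'a metric_tensor \<Rightarrow> 'a vfield \<Rightarrow> 'a vfield \<Rightarrow> 'a vfield \<Rightarrow> 'a \<Rightarrow> real"
  where "cov_deriv_metric nabla h X Y Z = (\<lambda>p.
    X p (\<lambda>q. h q (Y q) (Z q)) - h p (nabla X Y p) (Z p) - h p (Y p) (nabla X Z p))"

definition quasi_statistical_manifold ::
    "('a, 'e::euclidean_space) chart set \<Rightarrow> 'a metric_tensor \<Rightarrow> 'a connection \<Rightarrow> bool"
  where "quasi_statistical_manifold A h nabla \<longleftrightarrow>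
    pseudo_riemannian_manifold A h \<and> affine_connection A nabla \<and>
    (\<forall>W X Y Z. smooth_vfield A W X \<and> smooth_vfield A W Y \<and> smooth_vfield A W Z \<longrightarrow>
       (\<forall>p\<in>W. cov_deriv_metric nabla h X Y Z p - cov_deriv_metric nabla h Y X Z p +
          h p (torsion A nabla X Y p) (Z p) = 0))"

definition flat_connection ::
    "('a, 'e::euclidean_space) chart set \<Rightarrow> 'a connection \<Rightarrow> bool"
  where "flat_connection A nabla \<longleftrightarrow>
    (\<forall>W X Y Z. smooth_vfield A W X \<and> smooth_vfield A W Y \<and> smooth_vfield A W Z \<longrightarrow>
       (\<forall>p\<in>W. curvature A nabla X Y Z p = 0))"

definition flat_quasi_statistical_manifold ::
    "('a, 'e::euclidean_space) chart set \<Rightarrow> 'a metric_tensor \<Rightarrow> 'a connection \<Rightarrow> bool"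
  where "flat_quasi_statistical_manifold A h nabla \<longleftrightarrow>
    quasi_statistical_manifold A h nabla \<and> flat_connection A nabla"


section \<open>Norden and Para-Norden manifolds\<close>

type_synonym 'a tensor11 = "'a \<Rightarrow> 'a tvec \<Rightarrow> 'a tvec"

definition tensor11_field ::
    "('a, 'e::euclidean_space) chart set \<Rightarrow> 'a tensor11 \<Rightarrow> bool"
  where "tensor11_field A J \<longleftrightarrow>
    (\<forall>p\<in>points A. J p ` tangent_space A p \<subseteq> tangent_space A p \<and>
       linear_on (tangent_space A p) (J p)) \<and>
    (\<forall>W X. smooth_vfield A W X \<longrightarrow> smooth_vfield A W (\<lambda>p. J p (X p)))"

definition metric_symmetric ::
    "('a, 'e::euclidean_space) chart set \<Rightarrow> 'a tensor11 \<Rightarrow> 'a metric_tensor \<Rightarrow> bool"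
  where "metric_symmetric A J g \<longleftrightarrow>
    (\<forall>p\<in>points A. \<forall>v\<in>tangent_space A p. \<forall>w\<in>tangent_space A p.
       g p (J p v) w = g p v (J p w))"

definition nijenhuis ::
    "('a, 'e::euclidean_space) chart set \<Rightarrow> 'a tensor11 \<Rightarrow> 'a vfield \<Rightarrow> 'a vfield \<Rightarrow> 'a vfield"
  where "nijenhuis A J X Y = (\<lambda>p.
    lie_bracket A (\<lambda>q. J q (X q)) (\<lambda>q. J q (Y q)) p
    - J p (lie_bracket A (\<lambda>q. J q (X q)) Y p)
    - J p (lie_bracket A X (\<lambda>q. J q (Y q)) p)
    + J p (J p (lie_bracket A X Y p)))"

definition integrable_tensor11 ::
    "('a, 'e::euclidean_space) chart set \<Rightarrow> 'a tensor11 \<Rightarrow> bool"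
  where "integrable_tensor11 A J \<longleftrightarrow>
    (\<forall>W X Y. smooth_vfield A W X \<and> smooth_vfield A W Y \<longrightarrow> (\<forall>p\<in>W. nijenhuis A J X Y p = 0))"

definition almost_complex_manifold ::
    "('a, 'e::euclidean_space) chart set \<Rightarrow> 'a tensor11 \<Rightarrow> bool"
  where "almost_complex_manifold A J \<longleftrightarrow> smooth_manifold A \<and> tensor11_field A J \<and>
    (\<forall>p\<in>points A. \<forall>v\<in>tangent_space A p. J p (J p v) = - v)"

definition norden_manifold ::
    "('a, 'e::euclidean_space) chart set \<Rightarrow> 'a tensor11 \<Rightarrow> 'a metric_tensor \<Rightarrow> bool"
  where "norden_manifold A J g \<longleftrightarrow> almost_complex_manifold A J \<and>
    pseudo_riemannian_metric A g \<and> metric_symmetric A J g"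

definition complex_norden_manifold ::
    "('a, 'e::euclidean_space) chart set \<Rightarrow> 'a tensor11 \<Rightarrow> 'a metric_tensor \<Rightarrow> bool"
  where "complex_norden_manifold A J g \<longleftrightarrow> norden_manifold A J g \<and> integrable_tensor11 A J"

definition almost_para_norden_manifold ::
    "('a, 'e::euclidean_space) chart set \<Rightarrow> 'a tensor11 \<Rightarrow> 'a metric_tensor \<Rightarrow> bool"
  where "almost_para_norden_manifold A J g \<longleftrightarrow> smooth_manifold A \<and> even DIM('e) \<and>
    pseudo_riemannian_metric A g \<and> tensor11_field A J \<and>
    (\<forall>p\<in>points A. \<forall>v\<in>tangent_space A p. J p (J p v) = v) \<and>
    (\<forall>p\<in>points A. dim {v \<in> tangent_space A p. J p v = v} =
       dim {v \<in> tangent_space A p. J p v = - v}) \<and>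
    metric_symmetric A J g"

definition para_norden_manifold ::
    "('a, 'e::euclidean_space) chart set \<Rightarrow> 'a tensor11 \<Rightarrow> 'a metric_tensor \<Rightarrow> bool"
  where "para_norden_manifold A J g \<longleftrightarrow>
    almost_para_norden_manifold A J g \<and> integrable_tensor11 A J"


section \<open>The cotangent bundle\<close>

text \<open>A point of $T^*M$ is a pair of a point \<open>p\<close> and a covector at \<open>p\<close>. A chart \<open>c\<close> of $M$ with
  coordinates $x^i$ induces the chart \<open>cotangent_chart A c\<close> with coordinates $(\tilde x^i, y_i)$,
  where $y_i(p,\alpha) = \alpha(\partial/\partial x^i)$. The model space is \<open>'e \<times> 'e\<close>, so that
  $\partial/\partial\tilde x^i$ is the coordinate vector for \<open>(i, 0)\<close> and
  $\partial/\partial y_i$ the one for \<open>(0, i)\<close>.\<close>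

type_synonym 'a cotangent = "'a \<times> 'a covec"

definition cotangent_chart ::
    "('a, 'e::euclidean_space) chart set \<Rightarrow> ('a, 'e) chart \<Rightarrow> ('a cotangent, 'e \<times> 'e) chart"
  where "cotangent_chart A c =
    ({(p, \<alpha>). p \<in> cdom c \<and> \<alpha> \<in> cotangent_space A p},
     \<lambda>(p, \<alpha>). (cmap c p, \<Sum>i\<in>Basis. \<alpha> (coord_vec A c p i) *\<^sub>R i))"

definition cotangent_atlas ::
    "('a, 'e::euclidean_space) chart set \<Rightarrow> ('a cotangent, 'e \<times> 'e) chart set"
  where "cotangent_atlas A = cotangent_chart A ` A"

definition d_dx ::
    "('a, 'e::euclidean_space) chart set \<Rightarrow> ('a, 'e) chart \<Rightarrow> 'a cotangent \<Rightarrow> 'e \<Rightarrow>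
      'a cotangent tvec"
  where "d_dx A c a i = coord_vec (cotangent_atlas A) (cotangent_chart A c) a (i, 0)"

definition d_dy ::
    "('a, 'e::euclidean_space) chart set \<Rightarrow> ('a, 'e) chart \<Rightarrow> 'a cotangent \<Rightarrow> 'e \<Rightarrow>
      'a cotangent tvec"
  where "d_dy A c a i = coord_vec (cotangent_atlas A) (cotangent_chart A c) a (0, i)"

text \<open>\<open>christoffel A nabla c p k i j\<close> is $\Gamma^k_{ij}$ at \<open>p\<close>; components of a vector are
  obtained by applying it to the coordinate functions.\<close>

definition christoffel ::
    "('a, 'e::euclidean_space) chart set \<Rightarrow> 'a connection \<Rightarrow> ('a, 'e) chart \<Rightarrow> 'a \<Rightarrow>
      'e \<Rightarrow> 'e \<Rightarrow> 'e \<Rightarrow> real"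
  where "christoffel A nabla c p k i j =
    nabla (\<lambda>q. coord_vec A c q i) (\<lambda>q. coord_vec A c q j) p (\<lambda>q. cmap c q \<bullet> k)"

text \<open>The lifts are the vectors that have the following coordinate expressions in every induced
  chart:
  $X^H = X^i(\partial/\partial\tilde x^i + y_k\Gamma^k_{il}\,\partial/\partial y_l)$ and
  $\alpha^V = \alpha_i\,\partial/\partial y_i$.\<close>

definition horizontal_lift ::
    "('a, 'e::euclidean_space) chart set \<Rightarrow> 'a connection \<Rightarrow> 'a cotangent \<Rightarrow> 'a tvec \<Rightarrow>
      'a cotangent tvec"
  where "horizontal_lift A nabla a v = (THE \<xi>. \<forall>c\<in>A. fst a \<in> cdom c \<longrightarrow>
    \<xi> = (\<Sum>i\<in>Basis. v (\<lambda>q. cmap c q \<bullet> i) *\<^sub>R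
      (d_dx A c a i + (\<Sum>l\<in>Basis. \<Sum>k\<in>Basis.
        (snd a (coord_vec A c (fst a) k) * christoffel A nabla c (fst a) k i l) *\<^sub>R d_dy A c a l))))"

definition vertical_lift ::
    "('a, 'e::euclidean_space) chart set \<Rightarrow> 'a cotangent \<Rightarrow> 'a covec \<Rightarrow> 'a cotangent tvec"
  where "vertical_lift A a \<alpha> = (THE \<xi>. \<forall>c\<in>A. fst a \<in> cdom c \<longrightarrow>
    \<xi> = (\<Sum>i\<in>Basis. \<alpha> (coord_vec A c (fst a) i) *\<^sub>R d_dy A c a i))"

text \<open>$\Phi^\nabla : T_pM \oplus T^*_pM \to T_a(T^*M)$ and its inverse\<close>

definition Phi ::
    "('a, 'e::euclidean_space) chart set \<Rightarrow> 'a connection \<Rightarrow> 'a cotangent \<Rightarrow>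
      'a tvec \<times> 'a covec \<Rightarrow> 'a cotangent tvec"
  where "Phi A nabla a = (\<lambda>(v, \<alpha>). horizontal_lift A nabla a v + vertical_lift A a \<alpha>)"

definition Phi_inv ::
    "('a, 'e::euclidean_space) chart set \<Rightarrow> 'a connection \<Rightarrow> 'a cotangent \<Rightarrow>
      'a cotangent tvec \<Rightarrow> 'a tvec \<times> 'a covec"
  where "Phi_inv A nabla a =
    inv_into (tangent_space A (fst a) \<times> cotangent_space A (fst a)) (Phi A nabla a)"

text \<open>\<open>J_hat A h s p\<close> is $\hat J_\mp$, with \<open>s = -1\<close> for $\hat J_-$ and \<open>s = 1\<close> for $\hat J_+$.\<close>

definition J_hat ::
    "('a, 'e::euclidean_space) chart set \<Rightarrow> 'a metric_tensor \<Rightarrow> real \<Rightarrow> 'a \<Rightarrow>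
      'a tvec \<times> 'a covec \<Rightarrow> 'a tvec \<times> 'a covec"
  where "J_hat A h s p = (\<lambda>(v, \<alpha>). (s *\<^sub>R sharp_map A h p \<alpha>, flat_map A h p v))"

definition J_tilde ::
    "('a, 'e::euclidean_space) chart set \<Rightarrow> 'a metric_tensor \<Rightarrow> 'a connection \<Rightarrow> real \<Rightarrow>
      'a cotangent tensor11"
  where "J_tilde A h nabla s a = Phi A nabla a \<circ> J_hat A h s (fst a) \<circ> Phi_inv A nabla a"

abbreviation J_minus ::
    "('a, 'e::euclidean_space) chart set \<Rightarrow> 'a metric_tensor \<Rightarrow> 'a connection \<Rightarrow>
      'a cotangent tensor11"
  where "J_minus A h nabla \<equiv> J_tilde A h nabla (-1)"

abbreviation J_plus ::
    "('a, 'e::euclidean_space) chart set \<Rightarrow> 'a metric_tensor \<Rightarrow> 'a connection \<Rightarrow>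
      'a cotangent tensor11"
  where "J_plus A h nabla \<equiv> J_tilde A h nabla 1"

text \<open>The bilinear extension of the values on lifts:
  $\tilde h(X^H + \alpha^V, Y^H + \beta^V) = \alpha(Y) + \beta(X)$.\<close>

definition patterson_walker ::
    "('a, 'e::euclidean_space) chart set \<Rightarrow> 'a connection \<Rightarrow> 'a cotangent metric_tensor"
  where "patterson_walker A nabla a \<xi> \<eta> =
    (case Phi_inv A nabla a \<xi> of (v, \<alpha>) \<Rightarrow> case Phi_inv A nabla a \<eta> of (w, \<beta>) \<Rightarrow> \<alpha> w + \<beta> v)"

end

theory Submission
  imports Defs
begin

text \<open>
  A tangent vector of $T^*M$ is determined by its values on the functions $f \circ \pi$ and on the
  fibrewise linear functions $\iota_Y(p,\alpha) = \alpha(Y_p)$. The lifts are characterised by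
  $X^H(f \circ \pi) = Xf$, $X^H(\iota_Y) = \iota_{\nabla_X Y}$, $\alpha^V(f \circ \pi) = 0$ and
  $\alpha^V(\iota_Y) = \alpha(Y)$, which shows that they do not depend on the chart and reduces
  every bracket to an identity on $M$. If $\nabla$ is flat then $[X^H,Y^H] = [X,Y]^H$; the
  quasi-statistical condition says precisely that
  $[X^H,h(Y)^V] + [h(X)^V,Y^H] = h([X,Y])^V$, and $[h(X)^V,h(Y)^V] = 0$ always. Hence the Nijenhuis
  tensor vanishes on horizontal lifts, and by $N_J(JA,B) = -J N_J(A,B)$ on the whole frame
  $\partial_i^H, J\partial_i^H$.
\<close>

section \<open>Smooth functions on open subsets of Euclidean spaces\<close>

text \<open>One computation serves both signs: J sends X^H to h(X)^V in either case, and the sign s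
  enters on vertical vectors only, so every statement about J is made for an arbitrary s or for J^2
  = s I. Two obstacles shape the analytic groundwork. Smoothness of J requires smoothness of h^{-1},
  whose components are known only as the solution of the system h_ij v^j = alpha_i; hence the study
  of linear systems with smooth coefficients. And a tangent vector is by definition a directional
  derivative, not an abstract derivation, so a Lie bracket is a tangent vector only once its
  second-order terms have cancelled; hence the symmetry of second derivatives, obtained from the
  mean value theorem. Brackets on T*M descend to M because, near each point, a lift maps functions
  of the two kinds again to functions of these kinds, so that a second lift is evaluated by the same
  rules. The equal rank of the eigenbundles of J for s = 1 comes from an involution that
  anticommutes with J.\<close>

lemma linear_basis_expansion:
  fixes f :: "'e::euclidean_space \<Rightarrow> 'b::real_vector"
  assumes "linear f"
  shows "f w = (\<Sum>j\<in>Basis. (w \<bullet> j) *\<^sub>R f j)"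
proof -
  have "f (\<Sum>j\<in>Basis. (w \<bullet> j) *\<^sub>R j) = (\<Sum>j\<in>Basis. (w \<bullet> j) *\<^sub>R f j)"
    by (simp add: linear_sum[OF assms] linear_scale[OF assms])
  then show ?thesis by (simp add: euclidean_representation)
qed

section \<open>Closure properties of the classes C^k\<close>

lemma Ck_on_subset: "Ck_on k S f \<Longrightarrow> T \<subseteq> S \<Longrightarrow> Ck_on k T f"
  by (induction k arbitrary: f) (auto intro: continuous_on_subset)

lemma Ck_on_cong:
  assumes "open S" "\<And>x. x \<in> S \<Longrightarrow> f x = g x" "Ck_on k S f"
  shows "Ck_on k S g"
  using assms(2,3)
proof (induction k arbitrary: f g)
  case 0
  then show ?case by (simp cong: continuous_on_cong)
next
  case (Suc k)
  have d: "g differentiable at x" if "x \<in> S" for x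
  proof -
    have "(f has_derivative frechet_derivative f (at x)) (at x)"
      using Suc.prems(2) that frechet_derivative_works by fastforce
    then have "(g has_derivative frechet_derivative f (at x)) (at x)"
      by (rule has_derivative_transform_within_open[OF _ \<open>open S\<close> that Suc.prems(1)])
    then show ?thesis using differentiable_def by blast
  qed
  have e: "frechet_derivative f (at x) = frechet_derivative g (at x)" if "x \<in> S" for x
  proof (rule frechet_derivative_transform_within_open[OF _ \<open>open S\<close> that])
    show "f differentiable at x" using Suc.prems(2) that by simp
    show "f y = g y" if "y \<in> S" for y using Suc.prems(1)[OF that] .
  qed
  have "Ck_on k S (\<lambda>x. frechet_derivative g (at x) i)" if "i \<in> Basis" for i
  proof (rule Suc.IH)
    show "Ck_on k S (\<lambda>x. frechet_derivative f (at x) i)" using Suc.prems(2) that by simp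
    show "frechet_derivative f (at x) i = frechet_derivative g (at x) i" if "x \<in> S" for x
      using e[OF that] by simp
  qed
  then show ?case using d by simp
qed

lemma Ck_on_SucD: "Ck_on (Suc k) S f \<Longrightarrow> Ck_on k S f"
proof (induction k arbitrary: f)
  case 0
  then show ?case
    by (auto intro!: continuous_at_imp_continuous_on differentiable_imp_continuous_within)
next
  case (Suc k)
  then show ?case by (metis Ck_on.simps(2))
qed

lemma Ck_on_has_derivative:
  "Ck_on (Suc k) S f \<Longrightarrow> x \<in> S \<Longrightarrow> (f has_derivative frechet_derivative f (at x)) (at x)"
  using frechet_derivative_works by auto

text \<open>Any derivative may be exhibited: by uniqueness it agrees on the open set with the one
  chosen by \<open>frechet_derivative\<close>. The closure properties thus reduce to the usual
  differentiation rules.\<close>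

lemma Ck_on_SucI:
  assumes "open S" "\<And>x. x \<in> S \<Longrightarrow> (f has_derivative f' x) (at x)"
    "\<And>i. i \<in> Basis \<Longrightarrow> Ck_on k S (\<lambda>x. f' x i)"
  shows "Ck_on (Suc k) S f"
proof -
  have "frechet_derivative f (at x) = f' x" if "x \<in> S" for x
    using assms(2)[OF that] frechet_derivative_at by metis
  then have "Ck_on k S (\<lambda>x. frechet_derivative f (at x) i)" if "i \<in> Basis" for i
    using that by (intro Ck_on_cong[OF assms(1) _ assms(3)]) auto
  then show ?thesis
    using assms(2) by (auto simp: differentiable_def)
qed

lemma Ck_on_const: "open S \<Longrightarrow> Ck_on k S (\<lambda>x. c)"
proof (induction k arbitrary: c)
  case (Suc k)
  then show ?case by (intro Ck_on_SucI[where f' = "\<lambda>x i. 0"]) auto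
qed auto

lemma Ck_on_bounded_linear:
  assumes "open S" "bounded_linear L" "Ck_on k S f"
  shows "Ck_on k S (\<lambda>x. L (f x))"
  using assms(3)
proof (induction k arbitrary: f)
  case 0
  then show ?case by (simp add: bounded_linear.continuous_on[OF assms(2)])
next
  case (Suc k)
  show ?case
    using Suc
    by (intro Ck_on_SucI[OF assms(1) bounded_linear.has_derivative[OF assms(2) Ck_on_has_derivative]]) auto
qed

lemma Ck_on_bounded_linear_id:
  assumes "open S" "bounded_linear L"
  shows "Ck_on k S L"
proof (cases k)
  case 0
  then show ?thesis by (simp add: assms(2) linear_continuous_on)
next
  case (Suc k)
  show ?thesis unfolding Suc
    by (rule Ck_on_SucI[OF assms(1) bounded_linear_imp_has_derivative[OF assms(2)]]) (auto intro: Ck_on_const assms)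
qed

lemma Ck_on_add:
  assumes "open S" "Ck_on k S f" "Ck_on k S g"
  shows "Ck_on k S (\<lambda>x. f x + g x)"
  using assms(2,3)
proof (induction k arbitrary: f g)
  case 0
  then show ?case by (simp add: continuous_on_add)
next
  case (Suc k)
  show ?case
    using Suc
    by (intro Ck_on_SucI[OF assms(1) has_derivative_add[OF Ck_on_has_derivative Ck_on_has_derivative]]) auto
qed

lemma Ck_on_sum:
  assumes "open S" "\<And>i. i \<in> I \<Longrightarrow> Ck_on k S (f i)"
  shows "Ck_on k S (\<lambda>x. \<Sum>i\<in>I. f i x)"
  using assms(2)
  by (induction I rule: infinite_finite_induct) (auto intro!: Ck_on_const Ck_on_add assms(1))

text \<open>The product rule pairs the derivative of one factor with the other factor itself, so the
  induction needs both factors at the lower order as well; \<open>Ck_on_SucD\<close> supplies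
  this.\<close>

lemma Ck_on_bilinear:
  assumes "open S" "bounded_bilinear p" "Ck_on k S f" "Ck_on k S g"
  shows "Ck_on k S (\<lambda>x. p (f x) (g x))"
  using assms(3,4)
proof (induction k arbitrary: f g)
  case 0
  then show ?case by (simp add: bounded_bilinear.continuous_on[OF assms(2)])
next
  case (Suc k)
  show ?case
    using Suc Ck_on_SucD[OF Suc.prems(1)] Ck_on_SucD[OF Suc.prems(2)]
    by (intro Ck_on_SucI[OF assms(1) bounded_bilinear.FDERIV[OF assms(2) Ck_on_has_derivative Ck_on_has_derivative]])
      (auto intro!: Ck_on_add assms(1))
qed

lemmas Ck_on_mult = Ck_on_bilinear[OF _ bounded_bilinear_mult]

text \<open>Induction with f fixed and g arbitrary. Expanded over the basis of the middle space, the
  chain rule writes each partial derivative of the composite as a sum of components of Df times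
  partial derivatives of g composed with f, and the induction hypothesis applies to the
  latter.\<close>

lemma Ck_on_compose:
  fixes f :: "'d::euclidean_space \<Rightarrow> 'e::euclidean_space" and g :: "'e \<Rightarrow> 'b::real_normed_vector"
  assumes "open S" "open T" "f ` S \<subseteq> T" "Ck_on k S f" "Ck_on k T g"
  shows "Ck_on k S (\<lambda>x. g (f x))"
  using assms(4,5)
proof (induction k arbitrary: g)
  case 0
  then show ?case using assms(3) by (auto intro: continuous_on_compose2)
next
  case (Suc k)
  have fx: "f x \<in> T" if "x \<in> S" for x using that assms(3) by auto
  have d: "((\<lambda>x. g (f x)) has_derivative
      (\<lambda>v. \<Sum>j\<in>Basis. (frechet_derivative f (at x) v \<bullet> j) *\<^sub>R frechet_derivative g (at (f x)) j)) (at x)"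
    if "x \<in> S" for x
  proof -
    have g': "(g has_derivative frechet_derivative g (at (f x))) (at (f x))"
      by (rule Ck_on_has_derivative[OF Suc.prems(2) fx[OF that]])
    have "linear (frechet_derivative g (at (f x)))"
      by (rule has_derivative_linear[OF g'])
    show ?thesis
      by (rule has_derivative_eq_rhs[OF has_derivative_compose[OF Ck_on_has_derivative[OF Suc.prems(1) that] g']])
        (rule ext, rule linear_basis_expansion, fact)
  qed
  have Dg: "Ck_on k S (\<lambda>x. frechet_derivative g (at (f x)) j)" if "j \<in> Basis" for j
    using Suc.IH[of "\<lambda>y. frechet_derivative g (at y) j"] Ck_on_SucD[OF Suc.prems(1)] Suc.prems(2) that by auto
  have Df: "Ck_on k S (\<lambda>x. frechet_derivative f (at x) i \<bullet> j)" if "i \<in> Basis" for i j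
    using Suc.prems(1) that by (auto intro: Ck_on_bounded_linear[OF assms(1) bounded_linear_inner_left])
  show ?case
    by (rule Ck_on_SucI[OF assms(1) d])
      (auto intro!: Ck_on_sum[OF assms(1)] Ck_on_bilinear[OF assms(1) bounded_bilinear_scaleR] Df Dg)
qed

lemma Ck_on_componentwise:
  fixes f :: "'d::euclidean_space \<Rightarrow> 'e::euclidean_space"
  assumes "open S" "\<And>i. i \<in> Basis \<Longrightarrow> Ck_on k S (\<lambda>x. f x \<bullet> i)"
  shows "Ck_on k S f"
proof -
  have "Ck_on k S (\<lambda>x. \<Sum>i\<in>Basis. (f x \<bullet> i) *\<^sub>R i)"
    by (intro Ck_on_sum Ck_on_bounded_linear[OF _ bounded_linear_scaleR_left] assms)
  then show ?thesis by (simp add: euclidean_representation)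
qed

lemma Ck_on_local:
  assumes "\<And>x. x \<in> S \<Longrightarrow> \<exists>U. open U \<and> x \<in> U \<and> Ck_on k U f"
  shows "Ck_on k S f"
  using assms
proof (induction k arbitrary: f)
  case 0
  then show ?case
    by (meson Ck_on.simps(1) continuous_at_imp_continuous_on continuous_on_eq_continuous_at)
next
  case (Suc k)
  show ?case unfolding Ck_on.simps
  proof (intro conjI ballI)
    show "f differentiable at x" if "x \<in> S" for x using Suc.prems[OF that] by auto
    show "Ck_on k S (\<lambda>x. frechet_derivative f (at x) i)" if "i \<in> Basis" for i
      using Suc.prems that by (intro Suc.IH) (metis Ck_on.simps(2))
  qed
qed

lemma smooth_on_subset: "smooth_on S f \<Longrightarrow> T \<subseteq> S \<Longrightarrow> smooth_on T f"
  by (auto simp: smooth_on_def intro: Ck_on_subset)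

lemma smooth_on_cong:
  "open S \<Longrightarrow> (\<And>x. x \<in> S \<Longrightarrow> f x = g x) \<Longrightarrow> smooth_on S f \<Longrightarrow> smooth_on S g"
  by (auto simp: smooth_on_def intro: Ck_on_cong)

lemma smooth_on_local:
  "(\<And>x. x \<in> S \<Longrightarrow> \<exists>U. open U \<and> x \<in> U \<and> smooth_on U f) \<Longrightarrow> smooth_on S f"
  by (metis smooth_on_def Ck_on_local)

lemma smooth_on_const: "open S \<Longrightarrow> smooth_on S (\<lambda>x. c)"
  by (simp add: smooth_on_def Ck_on_const)

lemma smooth_on_linear: "open S \<Longrightarrow> bounded_linear L \<Longrightarrow> smooth_on S L"
  by (simp add: smooth_on_def Ck_on_bounded_linear_id)

lemma smooth_on_bounded_linear:
  "open S \<Longrightarrow> bounded_linear L \<Longrightarrow> smooth_on S f \<Longrightarrow> smooth_on S (\<lambda>x. L (f x))"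
  by (simp add: smooth_on_def Ck_on_bounded_linear)

lemma smooth_on_add:
  "open S \<Longrightarrow> smooth_on S f \<Longrightarrow> smooth_on S g \<Longrightarrow> smooth_on S (\<lambda>x. f x + g x)"
  by (simp add: smooth_on_def Ck_on_add)

lemma smooth_on_mult:
  fixes f g :: "_ \<Rightarrow> real"
  shows "open S \<Longrightarrow> smooth_on S f \<Longrightarrow> smooth_on S g \<Longrightarrow> smooth_on S (\<lambda>x. f x * g x)"
  by (simp add: smooth_on_def Ck_on_mult)

lemma smooth_on_compose:
  fixes f :: "'d::euclidean_space \<Rightarrow> 'e::euclidean_space"
  shows "open S \<Longrightarrow> open T \<Longrightarrow> f ` S \<subseteq> T \<Longrightarrow> smooth_on S f \<Longrightarrow> smooth_on T g \<Longrightarrow>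
    smooth_on S (\<lambda>x. g (f x))"
  by (simp add: smooth_on_def Ck_on_compose)

lemma smooth_on_componentwise:
  fixes f :: "'d::euclidean_space \<Rightarrow> 'e::euclidean_space"
  shows "open S \<Longrightarrow> (\<And>i. i \<in> Basis \<Longrightarrow> smooth_on S (\<lambda>x. f x \<bullet> i)) \<Longrightarrow> smooth_on S f"
  by (simp add: smooth_on_def Ck_on_componentwise)

lemma smooth_on_has_derivative:
  "smooth_on S f \<Longrightarrow> x \<in> S \<Longrightarrow> (f has_derivative frechet_derivative f (at x)) (at x)"
  using Ck_on_has_derivative[of 0] unfolding smooth_on_def by blast

lemma smooth_on_imp_continuous_on: "smooth_on S f \<Longrightarrow> continuous_on S f"
  by (metis smooth_on_def Ck_on.simps(1))

text \<open>The definition of C^k controls basis directions only; linearity of the derivative at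
  each point of S gives an arbitrary direction u.\<close>

lemma smooth_on_frechet_derivative:
  fixes f :: "'e::euclidean_space \<Rightarrow> real"
  assumes "open S" "smooth_on S f"
  shows "smooth_on S (\<lambda>x. frechet_derivative f (at x) u)"
proof -
  have eq: "(\<Sum>i\<in>Basis. (u \<bullet> i) * frechet_derivative f (at x) i) = frechet_derivative f (at x) u" if "x \<in> S" for x
  proof -
    have "linear (frechet_derivative f (at x))"
      using smooth_on_has_derivative[OF assms(2) that] has_derivative_linear by blast
    from linear_basis_expansion[OF this, of u] show ?thesis by simp
  qed
  have *: "Ck_on k S (\<lambda>x. \<Sum>i\<in>Basis. (u \<bullet> i) * frechet_derivative f (at x) i)" for k
    using assms(2) unfolding smooth_on_def
    by (intro Ck_on_sum Ck_on_mult Ck_on_const assms(1)) (metis Ck_on.simps(2))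
  show ?thesis
    unfolding smooth_on_def by (intro allI Ck_on_cong[OF assms(1) _ *] eq)
qed

section \<open>Symmetry of second partial derivatives\<close>

text \<open>The mean value theorem is applied twice: to the difference of f along two parallel
  segments in direction i, then to the partial derivative in direction i along a segment in
  direction j.\<close>

lemma second_difference:
  fixes f :: "'e::euclidean_space \<Rightarrow> real"
  assumes f: "smooth_on (ball x (2 * r)) f" and i: "norm i = 1" and j: "norm j = 1"
    and t: "0 < t" "t < r"
  shows "\<exists>y \<in> ball x (2 * t). f (x + t *\<^sub>R i + t *\<^sub>R j) - f (x + t *\<^sub>R i) - f (x + t *\<^sub>R j) + f x
    = t\<^sup>2 * frechet_derivative (\<lambda>z. frechet_derivative f (at z) i) (at y) j"
proof -
  let ?B = "ball x (2 * r)"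
  \<comment> \<open>For unit vectors i and j the point is at distance at most s + s' from x, whence
    the factor 2 in all radii.\<close>
  have inb: "x + s *\<^sub>R i + s' *\<^sub>R j \<in> ball x (2 * e)" if "0 \<le> s" "s < e" "0 \<le> s'" "s' < e" for s s' e
  proof -
    have "norm (s *\<^sub>R i + s' *\<^sub>R j) \<le> s + s'"
      using norm_triangle_ineq[of "s *\<^sub>R i" "s' *\<^sub>R j"] i j that by simp
    moreover have "dist x (x + s *\<^sub>R i + s' *\<^sub>R j) = norm (s *\<^sub>R i + s' *\<^sub>R j)"
      by (metis add.assoc add_diff_cancel_left' dist_commute dist_norm)
    ultimately show ?thesis using that by simp
  qed
  have inb0: "x + s *\<^sub>R i \<in> ball x (2 * e)" if "0 \<le> s" "s < e" for s e
    using inb[of s e 0] that by simp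
  have fd: "(f has_derivative frechet_derivative f (at z)) (at z)" if "z \<in> ?B" for z
    using smooth_on_has_derivative[OF f that] .
  have line: "((\<lambda>s. g (a + s *\<^sub>R v)) has_real_derivative frechet_derivative g (at (a + s *\<^sub>R v)) v) (at s)"
    if "(g has_derivative frechet_derivative g (at (a + s *\<^sub>R v))) (at (a + s *\<^sub>R v))" for g :: "'e \<Rightarrow> real" and a v s
  proof -
    have 1: "((\<lambda>s. a + s *\<^sub>R v) has_derivative (\<lambda>h. h *\<^sub>R v)) (at s)"
      by (auto intro!: derivative_eq_intros)
    have "((\<lambda>s. g (a + s *\<^sub>R v)) has_derivative (\<lambda>h. frechet_derivative g (at (a + s *\<^sub>R v)) (h *\<^sub>R v))) (at s)"
      using has_derivative_compose[OF 1 that] .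
    moreover have "linear (frechet_derivative g (at (a + s *\<^sub>R v)))"
      using that has_derivative_linear by blast
    ultimately show ?thesis
      by (simp add: has_field_derivative_def linear_scale mult.commute[of _ "frechet_derivative g _ _"] linear_cmul)
  qed
  have "\<exists>s>0. s < t \<and> (f ((x + t *\<^sub>R j) + t *\<^sub>R i) - f (x + t *\<^sub>R i)) - (f ((x + t *\<^sub>R j) + 0 *\<^sub>R i) - f (x + 0 *\<^sub>R i))
    = (t - 0) * (frechet_derivative f (at ((x + t *\<^sub>R j) + s *\<^sub>R i)) i - frechet_derivative f (at (x + s *\<^sub>R i)) i)"
  proof (rule MVT2[OF t(1)])
    fix s assume s: "0 \<le> s" "s \<le> t"
    have "(x + t *\<^sub>R j) + s *\<^sub>R i \<in> ?B" using inb[of s r t] s t by (simp add: add.commute add.left_commute)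
    moreover have "x + s *\<^sub>R i \<in> ?B" using inb0[of s r] s t by simp
    ultimately show "((\<lambda>s. f ((x + t *\<^sub>R j) + s *\<^sub>R i) - f (x + s *\<^sub>R i)) has_real_derivative
       frechet_derivative f (at ((x + t *\<^sub>R j) + s *\<^sub>R i)) i - frechet_derivative f (at (x + s *\<^sub>R i)) i) (at s)"
      by (intro DERIV_diff line fd)
  qed
  then obtain s where s: "0 < s" "s < t" and e1:
    "f (x + t *\<^sub>R i + t *\<^sub>R j) - f (x + t *\<^sub>R i) - f (x + t *\<^sub>R j) + f x
    = t * (frechet_derivative f (at (x + s *\<^sub>R i + t *\<^sub>R j)) i - frechet_derivative f (at (x + s *\<^sub>R i)) i)"
    by (auto simp: algebra_simps)
  let ?g = "\<lambda>z. frechet_derivative f (at z) i"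
  have gd: "(?g has_derivative frechet_derivative ?g (at z)) (at z)" if "z \<in> ?B" for z
    using smooth_on_has_derivative[OF smooth_on_frechet_derivative[OF _ f] that] by simp
  have "\<exists>s'>0. s' < t \<and> ?g ((x + s *\<^sub>R i) + t *\<^sub>R j) - ?g ((x + s *\<^sub>R i) + 0 *\<^sub>R j)
    = (t - 0) * frechet_derivative ?g (at ((x + s *\<^sub>R i) + s' *\<^sub>R j)) j"
  proof (rule MVT2[OF t(1)])
    fix s' assume s': "0 \<le> s'" "s' \<le> t"
    have "(x + s *\<^sub>R i) + s' *\<^sub>R j \<in> ?B" using inb[of s r s'] s s' t by simp
    then show "((\<lambda>s'. ?g ((x + s *\<^sub>R i) + s' *\<^sub>R j)) has_real_derivative
       frechet_derivative ?g (at ((x + s *\<^sub>R i) + s' *\<^sub>R j)) j) (at s')"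
      by (intro line gd)
  qed
  then obtain s' where s': "0 < s'" "s' < t"
    "?g ((x + s *\<^sub>R i) + t *\<^sub>R j) - ?g (x + s *\<^sub>R i) = t * frechet_derivative ?g (at ((x + s *\<^sub>R i) + s' *\<^sub>R j)) j"
    by auto
  show ?thesis
  proof
    show "x + s *\<^sub>R i + s' *\<^sub>R j \<in> ball x (2 * t)" using inb[of s t s'] s s' by simp
  qed (use e1 s' in \<open>simp add: power2_eq_square\<close>)
qed

text \<open>Exchanging i and j does not change the second difference, so the two mixed derivatives
  take a common value at points y and z arbitrarily close to x; continuity of both forces agreement
  at x.\<close>

lemma frechet_derivative_symmetric:
  fixes f :: "'e::euclidean_space \<Rightarrow> real"
  assumes S: "open S" "x \<in> S" and f: "smooth_on S f" and i: "i \<in> Basis" and j: "j \<in> Basis"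
  shows "frechet_derivative (\<lambda>z. frechet_derivative f (at z) i) (at x) j =
    frechet_derivative (\<lambda>z. frechet_derivative f (at z) j) (at x) i"
proof (rule ccontr)
  let ?F = "\<lambda>z. frechet_derivative (\<lambda>z. frechet_derivative f (at z) i) (at z) j"
  let ?G = "\<lambda>z. frechet_derivative (\<lambda>z. frechet_derivative f (at z) j) (at z) i"
  assume "?F x \<noteq> ?G x"
  \<comment> \<open>Half of the gap: a common value \<open>?F y = ?G z\<close> cannot lie within e
    of both \<open>?F x\<close> and \<open>?G x\<close>.\<close>
  define e where "e = \<bar>?F x - ?G x\<bar> / 2"
  have e: "e > 0" using \<open>?F x \<noteq> ?G x\<close> by (simp add: e_def)
  have "isCont ?F x" "isCont ?G x"
    using S f by (auto intro!: continuous_on_interior[of S] smooth_on_imp_continuous_on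
        smooth_on_frechet_derivative simp: interior_open)
  then obtain d1 d2 where d: "d1 > 0" "\<And>y. dist y x < d1 \<Longrightarrow> dist (?F y) (?F x) < e"
    "d2 > 0" "\<And>y. dist y x < d2 \<Longrightarrow> dist (?G y) (?G x) < e"
    unfolding continuous_at_eps_delta using e by metis
  obtain r where r: "r > 0" "ball x r \<subseteq> S" using S open_contains_ball by blast
  \<comment> \<open>\<open>second_difference\<close> is used with radius r/2, which has to exceed t,
    and the points it yields lie in \<open>ball x (2 * t)\<close>, which has to fit into both
    continuity radii.\<close>
  define t where "t = min (r/2) (min d1 d2) / 2"
  have t: "0 < t" "t < r / 2" "2 * t \<le> d1" "2 * t \<le> d2" using r d by (auto simp: t_def)
  have fb: "smooth_on (ball x (2 * (r/2))) f" using smooth_on_subset[OF f r(2)] by simp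
  obtain y where y: "y \<in> ball x (2 * t)" "f (x + t *\<^sub>R i + t *\<^sub>R j) - f (x + t *\<^sub>R i) - f (x + t *\<^sub>R j) + f x = t\<^sup>2 * ?F y"
    using second_difference[OF fb _ _ t(1,2), of i j] i j by auto
  obtain z where z: "z \<in> ball x (2 * t)" "f (x + t *\<^sub>R j + t *\<^sub>R i) - f (x + t *\<^sub>R j) - f (x + t *\<^sub>R i) + f x = t\<^sup>2 * ?G z"
    using second_difference[OF fb _ _ t(1,2), of j i] i j by auto
  have "f (x + t *\<^sub>R i + t *\<^sub>R j) - f (x + t *\<^sub>R i) - f (x + t *\<^sub>R j) + f x =
    f (x + t *\<^sub>R j + t *\<^sub>R i) - f (x + t *\<^sub>R j) - f (x + t *\<^sub>R i) + f x"
    by (simp add: add.assoc add.commute[of "t *\<^sub>R i"])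
  then have "t\<^sup>2 * ?F y = t\<^sup>2 * ?G z" unfolding y(2) z(2) .
  then have "?F y = ?G z" using t by simp
  moreover have "dist y x < d1" "dist z x < d2"
    using y(1) z(1) t(3,4) by (simp_all add: dist_commute)
  then have "dist (?F y) (?F x) < e" "dist (?G z) (?G x) < e"
    using d(2)[of y] d(4)[of z] by simp_all
  moreover have "\<bar>c - d\<bar> \<le> \<bar>a - c\<bar> + \<bar>b - d\<bar>" if "a = b" for a b c d :: real
    using that by arith
  ultimately show False unfolding e_def dist_real_def by (smt (verit) field_sum_of_halves)
qed

section \<open>Linear systems with smooth coefficients\<close>

text \<open>Because f vanishes at x, continuity of g is enough for the product rule: the increment
  is f'(y - x) g(x) up to the error of f times g(y) and f'(y - x) times the increment of g. It will
  be applied with g a solution of a linear system that is so far only known to be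
  continuous.\<close>

lemma has_derivative_mult_at_zero:
  fixes f g :: "'e::real_normed_vector \<Rightarrow> real"
  assumes f: "(f has_derivative f') (at x)" "f x = 0" and g: "isCont g x"
  shows "((\<lambda>y. f y * g y) has_derivative (\<lambda>v. f' v * g x)) (at x)"
proof -
  have bl: "bounded_linear f'" using f(1) has_derivative_bounded_linear by blast
  obtain K where K: "\<And>v. norm (f' v) \<le> norm v * K" using bounded_linear.bounded[OF bl] by blast
  have lim: "((\<lambda>y. norm (f y - f x - f' (y - x)) / norm (y - x)) \<longlongrightarrow> 0) (at x)"
    using f(1) unfolding has_derivative_iff_norm by blast
  have gx: "(g \<longlongrightarrow> g x) (at x)" using g by (simp add: isCont_def)
  have gd: "((\<lambda>y. \<bar>g y - g x\<bar>) \<longlongrightarrow> 0) (at x)"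
    using gx by (metis LIM_zero tendsto_rabs_zero)
  have "((\<lambda>y. norm (f y - f x - f' (y - x)) / norm (y - x) * \<bar>g y\<bar> + \<bar>K\<bar> * \<bar>g y - g x\<bar>) \<longlongrightarrow> 0 * \<bar>g x\<bar> + \<bar>K\<bar> * 0) (at x)"
    by (intro tendsto_intros lim gx gd)
  then have *: "((\<lambda>y. norm (f y - f x - f' (y - x)) / norm (y - x) * \<bar>g y\<bar> + \<bar>K\<bar> * \<bar>g y - g x\<bar>) \<longlongrightarrow> 0) (at x)"
    by simp
  have bound: "norm (f y * g y - f x * g x - f' (y - x) * g x) / norm (y - x)
      \<le> norm (f y - f x - f' (y - x)) / norm (y - x) * \<bar>g y\<bar> + \<bar>K\<bar> * \<bar>g y - g x\<bar>" if "y \<noteq> x" for y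
  proof -
    have n: "norm (y - x) > 0" using that by simp
    have "f y * g y - f x * g x - f' (y - x) * g x = (f y - f x - f' (y - x)) * g y + f' (y - x) * (g y - g x)"
      using f(2) by (simp add: algebra_simps)
    then have "norm (f y * g y - f x * g x - f' (y - x) * g x) \<le> \<bar>f y - f x - f' (y - x)\<bar> * \<bar>g y\<bar> + \<bar>f' (y - x)\<bar> * \<bar>g y - g x\<bar>"
      by (metis abs_mult abs_triangle_ineq real_norm_def)
    also have "\<bar>f' (y - x)\<bar> \<le> norm (y - x) * \<bar>K\<bar>"
      using K[of "y - x"] by (smt (verit) real_norm_def mult_left_mono norm_ge_zero)
    finally have "norm (f y * g y - f x * g x - f' (y - x) * g x)
        \<le> \<bar>f y - f x - f' (y - x)\<bar> * \<bar>g y\<bar> + norm (y - x) * \<bar>K\<bar> * \<bar>g y - g x\<bar>"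
      by (simp add: mult_right_mono)
    then have "norm (f y * g y - f x * g x - f' (y - x) * g x) / norm (y - x)
        \<le> (\<bar>f y - f x - f' (y - x)\<bar> * \<bar>g y\<bar> + norm (y - x) * \<bar>K\<bar> * \<bar>g y - g x\<bar>) / norm (y - x)"
      using n by (simp add: divide_right_mono)
    then show ?thesis using n by (simp add: add_divide_distrib)
  qed
  show ?thesis unfolding has_derivative_iff_norm
  proof
    show "bounded_linear (\<lambda>v. f' v * g x)" by (rule bounded_linear_mult_const[OF bl])
    show "((\<lambda>y. norm (f y * g y - f x * g x - f' (y - x) * g x) / norm (y - x)) \<longlongrightarrow> 0) (at x)"
      using bound by (intro tendsto_sandwich[OF _ _ tendsto_const *]) (auto simp: eventually_at_filter)
  qed
qed

text \<open>The derivatives of the solution of a linear system solve a system with the same matrix, which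
  makes the induction on the order of differentiability work without inverting the matrix.\<close>

context
  fixes S :: "'e::euclidean_space set" and H :: "'f::euclidean_space \<Rightarrow> 'f \<Rightarrow> 'e \<Rightarrow> real"
  assumes S: "open S"
    and H: "\<And>i j. i \<in> Basis \<Longrightarrow> j \<in> Basis \<Longrightarrow> smooth_on S (H i j)"
    and nd: "\<And>x v. x \<in> S \<Longrightarrow> (\<And>i. i \<in> Basis \<Longrightarrow> (\<Sum>j\<in>Basis. H i j x * (v \<bullet> j)) = 0) \<Longrightarrow> v = 0"
begin

text \<open>G is an inverse at the single point x, taken from the injectivity of the matrix there;
  nothing is claimed about its dependence on x.\<close>

lemma linear_system_left_inverse:
  assumes "x \<in> S"
  obtains G where "\<forall>v. \<forall>j\<in>Basis. v \<bullet> j = (\<Sum>i\<in>Basis. G j i * (\<Sum>l\<in>Basis. H i l x * (v \<bullet> l)))"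
proof -
  define M where "M = (\<lambda>v::'f. \<Sum>i\<in>Basis. (\<Sum>l\<in>Basis. H i l x * (v \<bullet> l)) *\<^sub>R i)"
  have lin: "linear M"
    by (rule linearI) (simp_all add: M_def inner_add_left algebra_simps sum.distrib sum_distrib_left scaleR_sum_right)
  have M: "M v \<bullet> i = (\<Sum>l\<in>Basis. H i l x * (v \<bullet> l))" if "i \<in> Basis" for v i
    unfolding M_def using that by simp
  have "v = 0" if "M v = 0" for v
    using nd[OF assms, of v] M[of _ v] that by simp
  then have "inj M" using linear_injective_0[OF lin] by blast
  then obtain g where g: "linear g" "g \<circ> M = id" using linear_injective_left_inverse[OF lin] by blast
  show thesis
  proof (rule that, intro allI ballI)
    fix v :: 'f and j :: 'f assume j: "j \<in> Basis"
    have "v = g (M v)" using g(2) by (metis comp_apply id_apply)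
    also have "\<dots> = (\<Sum>i\<in>Basis. (M v \<bullet> i) *\<^sub>R g i)" by (rule linear_basis_expansion[OF g(1)])
    finally have "v \<bullet> j = (\<Sum>i\<in>Basis. (M v \<bullet> i) *\<^sub>R g i) \<bullet> j" by simp
    then show "v \<bullet> j = (\<Sum>i\<in>Basis. (g i \<bullet> j) * (\<Sum>l\<in>Basis. H i l x * (v \<bullet> l)))"
      by (simp add: inner_sum_left M mult.commute)
  qed
qed

text \<open>Apply the inverse G of the matrix at x to H(x)(u(y) - u(x)) = (b(y) - H(y)u(x)) - (H(y)
  - H(x))(u(y) - u(x)). With d for the increment of u, e for that of H and r for the residual of
  u(x) at y, this gives d \<le> C (r + e d), where e and r tend to 0.\<close>

lemma linear_system_continuous:
  assumes b: "\<And>i. i \<in> Basis \<Longrightarrow> continuous_on S (b i)"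
    and u: "\<And>x i. x \<in> S \<Longrightarrow> i \<in> Basis \<Longrightarrow> (\<Sum>j\<in>Basis. H i j x * u j x) = b i x"
    and x: "x \<in> S" and j: "j \<in> Basis"
  shows "isCont (u j) x"
proof -
  obtain G where G': "\<forall>v. \<forall>j\<in>Basis. v \<bullet> j = (\<Sum>i\<in>Basis. G j i * (\<Sum>l\<in>Basis. H i l x * (v \<bullet> l)))"
    by (rule linear_system_left_inverse[OF x])
  have G: "\<And>v j. j \<in> Basis \<Longrightarrow> v \<bullet> j = (\<Sum>i\<in>Basis. G j i * (\<Sum>l\<in>Basis. H i l x * (v \<bullet> l)))"
    using G' by blast
  define d where "d y = (\<Sum>j\<in>Basis. \<bar>u j y - u j x\<bar>)" for y
  define C where "C = (\<Sum>j\<in>Basis. \<Sum>i\<in>Basis. \<bar>G j i\<bar>)"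
  define e where "e y = (\<Sum>i\<in>Basis. \<Sum>l\<in>Basis. \<bar>H i l y - H i l x\<bar>)" for y
  define r where "r y = (\<Sum>i\<in>Basis. \<bar>b i y - (\<Sum>l\<in>Basis. H i l y * u l x)\<bar>)" for y
  have C0: "C \<ge> 0" unfolding C_def by (intro sum_nonneg) auto
  have d0: "d y \<ge> 0" for y unfolding d_def by (intro sum_nonneg) auto
  have est: "d y \<le> C * (r y + e y * d y)" if "y \<in> S" for y
  proof -
    define w where "w = (\<Sum>l\<in>Basis. (u l y - u l x) *\<^sub>R (l::'f))"
    have w: "w \<bullet> l = u l y - u l x" if "l \<in> Basis" for l using that by (simp add: w_def)
    have m: "\<bar>\<Sum>l\<in>Basis. H i l x * (w \<bullet> l)\<bar> \<le> r y + e y * d y" if i: "i \<in> Basis" for i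
    proof -
      have "(\<Sum>l\<in>Basis. H i l x * (w \<bullet> l)) = (\<Sum>l\<in>Basis. H i l y * u l y - H i l y * u l x - (H i l y - H i l x) * (u l y - u l x))"
        by (intro sum.cong refl) (simp add: w algebra_simps)
      also have "\<dots> = (b i y - (\<Sum>l\<in>Basis. H i l y * u l x)) - (\<Sum>l\<in>Basis. (H i l y - H i l x) * (u l y - u l x))"
        using u[OF \<open>y \<in> S\<close> i] by (simp add: sum_subtractf)
      finally have "\<bar>\<Sum>l\<in>Basis. H i l x * (w \<bullet> l)\<bar> \<le> \<bar>b i y - (\<Sum>l\<in>Basis. H i l y * u l x)\<bar> + \<bar>\<Sum>l\<in>Basis. (H i l y - H i l x) * (u l y - u l x)\<bar>"
        by simp
      also have "\<bar>b i y - (\<Sum>l\<in>Basis. H i l y * u l x)\<bar> \<le> r y"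
        unfolding r_def using i by (intro member_le_sum) auto
      also have "\<bar>\<Sum>l\<in>Basis. (H i l y - H i l x) * (u l y - u l x)\<bar> \<le> (\<Sum>l\<in>Basis. \<bar>H i l y - H i l x\<bar> * \<bar>u l y - u l x\<bar>)"
        by (rule order_trans[OF sum_abs]) (simp add: abs_mult)
      also have "\<dots> \<le> (\<Sum>l\<in>Basis. e y * \<bar>u l y - u l x\<bar>)"
      proof (intro sum_mono mult_right_mono)
        fix l :: 'f assume l: "l \<in> Basis"
        have "\<bar>H i l y - H i l x\<bar> \<le> (\<Sum>l\<in>Basis. \<bar>H i l y - H i l x\<bar>)"
          using l by (intro member_le_sum) auto
        also have "\<dots> \<le> e y" unfolding e_def using i by (intro member_le_sum) (auto intro: sum_nonneg)
        finally show "\<bar>H i l y - H i l x\<bar> \<le> e y" .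
      qed auto
      also have "\<dots> = e y * d y" by (simp add: d_def sum_distrib_left)
      finally show ?thesis by simp
    qed
    have "d y = (\<Sum>j\<in>Basis. \<bar>w \<bullet> j\<bar>)" by (simp add: d_def w)
    also have "\<dots> \<le> (\<Sum>j\<in>Basis. \<Sum>i\<in>Basis. \<bar>G j i\<bar> * (r y + e y * d y))"
    proof (rule sum_mono)
      fix j :: 'f assume "j \<in> Basis"
      then have "\<bar>w \<bullet> j\<bar> \<le> (\<Sum>i\<in>Basis. \<bar>G j i * (\<Sum>l\<in>Basis. H i l x * (w \<bullet> l))\<bar>)"
        by (subst G) (auto intro: sum_abs)
      also have "\<dots> \<le> (\<Sum>i\<in>Basis. \<bar>G j i\<bar> * (r y + e y * d y))"
        using m by (auto intro!: sum_mono mult_left_mono simp: abs_mult)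
      finally show "\<bar>w \<bullet> j\<bar> \<le> (\<Sum>i\<in>Basis. \<bar>G j i\<bar> * (r y + e y * d y))" .
    qed
    also have "\<dots> = C * (r y + e y * d y)" by (simp add: C_def sum_distrib_right)
    finally show ?thesis .
  qed
  have cH: "(H i l \<longlongrightarrow> H i l x) (at x)" if "i \<in> Basis" "l \<in> Basis" for i l
    using smooth_on_imp_continuous_on[OF H[OF that]] x S continuous_on_eq_continuous_at isCont_def by blast
  have cb: "(b i \<longlongrightarrow> b i x) (at x)" if "i \<in> Basis" for i
    using b[OF that] x S continuous_on_eq_continuous_at isCont_def by blast
  have "(e \<longlongrightarrow> (\<Sum>i\<in>Basis. \<Sum>l\<in>Basis. \<bar>H i l x - H i l x\<bar>)) (at x)"
    unfolding e_def by (intro tendsto_intros cH)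
  then have e_lim: "(e \<longlongrightarrow> 0) (at x)" by simp
  have "(r \<longlongrightarrow> (\<Sum>i\<in>Basis. \<bar>b i x - (\<Sum>l\<in>Basis. H i l x * u l x)\<bar>)) (at x)"
    unfolding r_def by (intro tendsto_intros cH cb)
  then have r_lim: "(r \<longlongrightarrow> 0) (at x)" by (simp add: u[OF x])
  have "((\<lambda>y. C * e y) \<longlongrightarrow> C * 0) (at x)" by (intro tendsto_intros e_lim)
  then have "eventually (\<lambda>y. C * e y < 1/2) (at x)" by (intro order_tendstoD(2)) auto
  moreover have "eventually (\<lambda>y. y \<in> S) (at x)" using S x eventually_at_topological by blast
  ultimately have ev: "eventually (\<lambda>y. \<bar>u j y - u j x\<bar> \<le> 2 * C * r y) (at x)"
  proof eventually_elim
    case (elim y)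
    \<comment> \<open>Absorption: as soon as C e < 1/2, the unknown increment on the right is at
      most half of the left-hand side.\<close>
    have "C * e y * d y \<le> 1/2 * d y" using elim d0[of y] by (intro mult_right_mono) auto
    then have "d y \<le> 2 * C * r y" using est[OF elim(2)] by (simp add: algebra_simps)
    moreover have "\<bar>u j y - u j x\<bar> \<le> d y" unfolding d_def using j by (intro member_le_sum) auto
    ultimately show ?case by linarith
  qed
  have "((\<lambda>y. 2 * C * r y) \<longlongrightarrow> 2 * C * 0) (at x)" by (intro tendsto_intros r_lim)
  then have "((\<lambda>y. \<bar>u j y - u j x\<bar>) \<longlongrightarrow> 0) (at x)"
    using ev by (intro tendsto_sandwich[OF _ ev tendsto_const]) auto
  then show ?thesis unfolding isCont_def by (metis LIM_zero_cancel tendsto_rabs_zero_iff)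
qed

text \<open>Near x, u equals G (b - (H - H(x)) u). Each entry of H - H(x) vanishes at x and u is
  continuous there, which is exactly the situation of
  \<open>has_derivative_mult_at_zero\<close>.\<close>

lemma linear_system_differentiable:
  assumes b: "\<And>i. i \<in> Basis \<Longrightarrow> Ck_on (Suc k) S (b i)"
    and u: "\<And>x i. x \<in> S \<Longrightarrow> i \<in> Basis \<Longrightarrow> (\<Sum>j\<in>Basis. H i j x * u j x) = b i x"
    and x: "x \<in> S" and j: "j \<in> Basis"
  shows "u j differentiable at x"
proof -
  obtain G where G': "\<forall>v. \<forall>j\<in>Basis. v \<bullet> j = (\<Sum>i\<in>Basis. G j i * (\<Sum>l\<in>Basis. H i l x * (v \<bullet> l)))"
    by (rule linear_system_left_inverse[OF x])
  have G: "\<And>v j. j \<in> Basis \<Longrightarrow> v \<bullet> j = (\<Sum>i\<in>Basis. G j i * (\<Sum>l\<in>Basis. H i l x * (v \<bullet> l)))"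
    using G' by blast
  have b0: "continuous_on S (b i)" if "i \<in> Basis" for i
    using b[OF that] by (auto intro!: continuous_at_imp_continuous_on differentiable_imp_continuous_within)
  have cu: "isCont (u l) x" if "l \<in> Basis" for l
    by (rule linear_system_continuous[OF b0 u x that])
  have bd: "(b i has_derivative frechet_derivative (b i) (at x)) (at x)" if "i \<in> Basis" for i
    by (rule Ck_on_has_derivative[OF b[OF that] x])
  have Hd: "((\<lambda>y. H i l y - H i l x) has_derivative frechet_derivative (H i l) (at x)) (at x)"
    if "i \<in> Basis" "l \<in> Basis" for i l
    using has_derivative_diff[OF smooth_on_has_derivative[OF H[OF that] x] has_derivative_const, of "H i l x"]
    by simp
  have "((\<lambda>y. \<Sum>i\<in>Basis. G j i * (b i y - (\<Sum>l\<in>Basis. (H i l y - H i l x) * u l y))) has_derivative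
     (\<lambda>v. \<Sum>i\<in>Basis. G j i * (frechet_derivative (b i) (at x) v - (\<Sum>l\<in>Basis. frechet_derivative (H i l) (at x) v * u l x)))) (at x)"
    by (intro has_derivative_sum has_derivative_mult_right has_derivative_diff bd has_derivative_mult_at_zero Hd cu) auto
  moreover have "(\<Sum>i\<in>Basis. G j i * (b i y - (\<Sum>l\<in>Basis. (H i l y - H i l x) * u l y))) = u j y" if "y \<in> S" for y
  proof -
    define w where "w = (\<Sum>l\<in>Basis. u l y *\<^sub>R (l::'f))"
    have w: "w \<bullet> l = u l y" if "l \<in> Basis" for l using that by (simp add: w_def)
    have "b i y - (\<Sum>l\<in>Basis. (H i l y - H i l x) * u l y) = (\<Sum>l\<in>Basis. H i l x * (w \<bullet> l))" if i: "i \<in> Basis" for i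
      using u[OF \<open>y \<in> S\<close> i] by (simp add: w algebra_simps sum_subtractf)
    then show ?thesis using G[OF j, of w] by (simp add: w j)
  qed
  ultimately have "(u j has_derivative (\<lambda>v. \<Sum>i\<in>Basis. G j i * (frechet_derivative (b i) (at x) v - (\<Sum>l\<in>Basis. frechet_derivative (H i l) (at x) v * u l x)))) (at x)"
    by (rule has_derivative_transform_within_open[OF _ S x])
  then show ?thesis using differentiable_def by blast
qed

lemma linear_system_Ck_on:
  assumes "\<And>i. i \<in> Basis \<Longrightarrow> Ck_on k S (b i)"
    and "\<And>x i. x \<in> S \<Longrightarrow> i \<in> Basis \<Longrightarrow> (\<Sum>j\<in>Basis. H i j x * u j x) = b i x"
    and "j \<in> Basis"
  shows "Ck_on k S (u j)"
  using assms
proof (induction k arbitrary: u b j)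
  case 0
  then show ?case
    using linear_system_continuous[of b u] by (auto intro: continuous_at_imp_continuous_on)
next
  case (Suc k)
  have d: "u l differentiable at x" if "x \<in> S" "l \<in> Basis" for x l
    using linear_system_differentiable[of k b u, OF Suc.prems(1,2) that] .
  have ud: "(u l has_derivative frechet_derivative (u l) (at x)) (at x)" if "x \<in> S" "l \<in> Basis" for x l
    using d[OF that] frechet_derivative_works by blast
  have Hd: "(H i l has_derivative frechet_derivative (H i l) (at x)) (at x)"
    if "x \<in> S" "i \<in> Basis" "l \<in> Basis" for i l x
    using smooth_on_has_derivative[OF H[OF that(2,3)] that(1)] .
  \<comment> \<open>The induction hypothesis is used twice: here for the original system at the
    lower order, so that the right-hand side Db - (DH) u is of class C^k, and then for the
    differentiated system.\<close>
  have uk: "Ck_on k S (u l)" if "l \<in> Basis" for l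
    using Suc.IH[of b u l, OF Ck_on_SucD[OF Suc.prems(1)] Suc.prems(2) that] .
  have "Ck_on k S (\<lambda>x. frechet_derivative (u j) (at x) v)" if v: "v \<in> Basis" for v
  proof (rule Suc.IH[of "\<lambda>i x. frechet_derivative (b i) (at x) v + - 1 * (\<Sum>l\<in>Basis. frechet_derivative (H i l) (at x) v * u l x)"
        "\<lambda>j x. frechet_derivative (u j) (at x) v"])
    fix i :: 'f assume i: "i \<in> Basis"
    have "Ck_on k S (\<lambda>x. frechet_derivative (H i l) (at x) v)" if "l \<in> Basis" for l
      using smooth_on_frechet_derivative[OF S H[OF i that]] by (simp add: smooth_on_def)
    then show "Ck_on k S (\<lambda>x. frechet_derivative (b i) (at x) v + - 1 * (\<Sum>l\<in>Basis. frechet_derivative (H i l) (at x) v * u l x))"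
      using Suc.prems(1)[OF i] v
      by (intro Ck_on_add Ck_on_mult Ck_on_sum Ck_on_const S uk) auto
    fix x assume x: "x \<in> S"
    have "((\<lambda>y. \<Sum>l\<in>Basis. H i l y * u l y) has_derivative
      (\<lambda>v. \<Sum>l\<in>Basis. H i l x * frechet_derivative (u l) (at x) v + frechet_derivative (H i l) (at x) v * u l x)) (at x)"
      by (intro has_derivative_sum has_derivative_mult ud Hd x i)
    then have "(b i has_derivative
      (\<lambda>v. \<Sum>l\<in>Basis. H i l x * frechet_derivative (u l) (at x) v + frechet_derivative (H i l) (at x) v * u l x)) (at x)"
      by (rule has_derivative_transform_within_open[OF _ S x]) (use Suc.prems(2) i in auto)
    then have "frechet_derivative (b i) (at x) =
      (\<lambda>v. \<Sum>l\<in>Basis. H i l x * frechet_derivative (u l) (at x) v + frechet_derivative (H i l) (at x) v * u l x)"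
      by (rule frechet_derivative_at[symmetric])
    then show "(\<Sum>l\<in>Basis. H i l x * frechet_derivative (u l) (at x) v) =
       frechet_derivative (b i) (at x) v + - 1 * (\<Sum>l\<in>Basis. frechet_derivative (H i l) (at x) v * u l x)"
      by (simp add: sum.distrib)
  qed (rule Suc.prems)
  then show ?case using d Suc.prems(3) by simp
qed

lemma linear_system_smooth_on:
  assumes "\<And>i. i \<in> Basis \<Longrightarrow> smooth_on S (b i)"
    and "\<And>x i. x \<in> S \<Longrightarrow> i \<in> Basis \<Longrightarrow> (\<Sum>j\<in>Basis. H i j x * u j x) = b i x"
    and "j \<in> Basis"
  shows "smooth_on S (u j)"
  unfolding smooth_on_def
  using assms(1) by (intro allI linear_system_Ck_on[OF _ assms(2,3)]) (auto simp: smooth_on_def)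

end

section \<open>Germs, tangent vectors and vector fields\<close>

lemma scaleR_fun_apply [simp]: "(r *\<^sub>R f) x = r *\<^sub>R f x"
  by (simp add: scaleR_fun_def)

lemma sum_fun_apply: "(\<Sum>i\<in>I. f i) x = (\<Sum>i\<in>I. f i x)" for f :: "'i \<Rightarrow> 'x \<Rightarrow> 'b::comm_monoid_add"
  by (induction I rule: infinite_finite_induct) (auto simp: zero_fun_def)

section \<open>Germs of smooth functions on a manifold given by an atlas\<close>

text \<open>Separating the chart conditions from the two topological axioms lets T*M be an instance
  of the same theory before its topology is examined.\<close>

locale smooth_atlas =
  fixes A :: "('a, 'e::euclidean_space) chart set"
  assumes chart_inj: "c \<in> A \<Longrightarrow> inj_on (cmap c) (cdom c)"
    and chart_image_open: "c \<in> A \<Longrightarrow> open (cmap c ` cdom c)"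
    and chart_overlap_open: "c \<in> A \<Longrightarrow> d \<in> A \<Longrightarrow> open (cmap c ` (cdom c \<inter> cdom d))"
    and transition_smooth:
      "c \<in> A \<Longrightarrow> d \<in> A \<Longrightarrow> smooth_on (cmap c ` (cdom c \<inter> cdom d)) (cmap d \<circ> cinv c)"

lemma smooth_manifold_iff:
  "smooth_manifold A \<longleftrightarrow> smooth_atlas A \<and> Hausdorff_space (manifold_topology A) \<and>
    second_countable (manifold_topology A)"
  unfolding smooth_manifold_def smooth_atlas_def by blast

context smooth_atlas
begin

abbreviation openM :: "'a set \<Rightarrow> bool"
  where "openM \<equiv> openin (manifold_topology A)"

abbreviation coord :: "('a, 'e) chart \<Rightarrow> 'e \<Rightarrow> 'a \<Rightarrow> real"
  where "coord c i \<equiv> \<lambda>q. cmap c q \<bullet> i"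

lemma cinv_cmap [simp]: "c \<in> A \<Longrightarrow> p \<in> cdom c \<Longrightarrow> cinv c (cmap c p) = p"
  by (simp add: cinv_def chart_inj)

lemma openM_iff: "openM W \<longleftrightarrow> W \<subseteq> points A \<and> (\<forall>c\<in>A. open (cmap c ` (cdom c \<inter> W)))"
proof -
  have "istopology (\<lambda>W. W \<subseteq> points A \<and> (\<forall>c\<in>A. open (cmap c ` (cdom c \<inter> W))))"
    unfolding istopology_def
  proof (intro conjI allI impI ballI)
    fix S T c
    assume S: "S \<subseteq> points A \<and> (\<forall>c\<in>A. open (cmap c ` (cdom c \<inter> S)))"
      and T: "T \<subseteq> points A \<and> (\<forall>c\<in>A. open (cmap c ` (cdom c \<inter> T)))" and c: "c \<in> A"
    have "cmap c ` (cdom c \<inter> (S \<inter> T)) = cmap c ` (cdom c \<inter> S) \<inter> cmap c ` (cdom c \<inter> T)"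
      using chart_inj[OF c] by (auto simp: inj_on_def)
    then show "open (cmap c ` (cdom c \<inter> (S \<inter> T)))" using S T c by auto
  next
    fix K c assume K: "\<forall>W\<in>K. W \<subseteq> points A \<and> (\<forall>c\<in>A. open (cmap c ` (cdom c \<inter> W)))" and c: "c \<in> A"
    have "cmap c ` (cdom c \<inter> \<Union> K) = (\<Union>W\<in>K. cmap c ` (cdom c \<inter> W))" by blast
    then show "open (cmap c ` (cdom c \<inter> \<Union> K))" using K c by auto
  qed auto
  then show ?thesis unfolding manifold_topology_def by (simp add: topology_inverse')
qed

lemma openM_subset: "openM W \<Longrightarrow> W \<subseteq> points A"
  by (simp add: openM_iff)

lemma openM_image: "openM W \<Longrightarrow> c \<in> A \<Longrightarrow> open (cmap c ` (cdom c \<inter> W))"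
  by (simp add: openM_iff)

lemma openM_cdom: "c \<in> A \<Longrightarrow> openM (cdom c)"
  using chart_overlap_open by (auto simp: openM_iff points_def)

lemma openM_points: "openM (points A)"
  unfolding points_def by (intro openin_Union) (auto intro: openM_cdom)

lemma topspace_manifold: "topspace (manifold_topology A) = points A"
  by (metis openM_points openM_subset openin_topspace openin_subset subset_antisym)

lemma pointsE: "p \<in> points A \<Longrightarrow> (\<And>c. c \<in> A \<Longrightarrow> p \<in> cdom c \<Longrightarrow> thesis) \<Longrightarrow> thesis"
  by (auto simp: points_def)

lemma pointsI: "c \<in> A \<Longrightarrow> p \<in> cdom c \<Longrightarrow> p \<in> points A"
  by (auto simp: points_def)

text \<open>This is continuity of a chart for the manifold topology: seen in another chart d, the
  set is a preimage under the continuous transition map.\<close>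

lemma openM_chart_preimage:
  assumes c: "c \<in> A" and U: "open U"
  shows "openM {q \<in> cdom c. cmap c q \<in> U}"
  unfolding openM_iff
proof (intro conjI ballI)
  show "{q \<in> cdom c. cmap c q \<in> U} \<subseteq> points A" using c by (auto simp: points_def)
  fix d assume d: "d \<in> A"
  have "cmap d ` (cdom d \<inter> {q \<in> cdom c. cmap c q \<in> U}) =
      cmap d ` (cdom d \<inter> cdom c) \<inter> (cmap c \<circ> cinv d) -` U"
    using d by auto
  also have "open \<dots>"
    using smooth_on_imp_continuous_on[OF transition_smooth[OF d c]] chart_overlap_open[OF d c] U
    by (rule continuous_open_preimage)
  finally show "open (cmap d ` (cdom d \<inter> {q \<in> cdom c. cmap c q \<in> U}))" .
qed

lemma smooth_funD: "smooth_fun A W f \<Longrightarrow> openM W"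
  by (simp add: smooth_fun_def)

lemma smooth_nearI: "smooth_fun A W f \<Longrightarrow> p \<in> W \<Longrightarrow> smooth_near A p f"
  unfolding smooth_near_def by (intro exI conjI)

lemma smooth_nearE:
  assumes "smooth_near A p f"
  obtains W where "smooth_fun A W f" "p \<in> W"
  using assms unfolding smooth_near_def by (elim exE conjE)

lemma smooth_fun_subset:
  "smooth_fun A W f \<Longrightarrow> openM V \<Longrightarrow> V \<subseteq> W \<Longrightarrow> smooth_fun A V f"
  unfolding smooth_fun_def by (meson Int_mono image_mono order_refl smooth_on_subset)

text \<open>Smoothness on an open set is a condition on germs, so that closure properties have to be
  proved for \<open>smooth_near\<close> only.\<close>

lemma smooth_fun_iff: "smooth_fun A W f \<longleftrightarrow> openM W \<and> (\<forall>p\<in>W. smooth_near A p f)"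
proof
  assume "smooth_fun A W f"
  then show "openM W \<and> (\<forall>p\<in>W. smooth_near A p f)"
    by (auto intro: smooth_nearI smooth_funD)
next
  assume *: "openM W \<and> (\<forall>p\<in>W. smooth_near A p f)"
  show "smooth_fun A W f" unfolding smooth_fun_def
  proof (intro conjI ballI smooth_on_local)
    fix c y assume c: "c \<in> A" and "y \<in> cmap c ` (cdom c \<inter> W)"
    then obtain p where p: "p \<in> cdom c" "p \<in> W" "y = cmap c p" by blast
    have "smooth_near A p f" using * p(2) by simp
    then obtain V where "smooth_fun A V f" "p \<in> V" by (rule smooth_nearE)
    then show "\<exists>U. open U \<and> y \<in> U \<and> smooth_on U (f \<circ> cinv c)"
      using p c by (intro exI[of _ "cmap c ` (cdom c \<inter> V)"]) (auto simp: smooth_fun_def openM_image)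
  qed (use * in auto)
qed

lemma smooth_near_points: "smooth_near A p f \<Longrightarrow> p \<in> points A"
  by (elim smooth_nearE) (use smooth_funD openM_subset in blast)

lemma smooth_near_open:
  assumes "smooth_near A p f"
  obtains W where "openM W" "p \<in> W" "\<forall>q\<in>W. smooth_near A q f"
  using assms by (elim smooth_nearE) (auto simp: smooth_fun_iff intro: that)

text \<open>A single chart suffices: the expression in a chart d is the expression in c composed
  with a smooth transition map.\<close>

lemma smooth_near_chartI:
  assumes c: "c \<in> A" "p \<in> cdom c" and U: "open U" "cmap c p \<in> U" "smooth_on U (f \<circ> cinv c)"
  shows "smooth_near A p f"
proof -
  let ?W = "{q \<in> cdom c. cmap c q \<in> U}"
  have p: "p \<in> ?W" using c(2) U(2) by blast
  have o: "openM ?W" by (rule openM_chart_preimage[OF c(1) U(1)])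
  have "smooth_on (cmap d ` (cdom d \<inter> ?W)) (f \<circ> cinv d)" if d: "d \<in> A" for d
  proof -
    let ?S = "cmap d ` (cdom d \<inter> ?W)"
    have oS: "open ?S" using openM_image[OF o d] .
    have "smooth_on ?S (\<lambda>y. (f \<circ> cinv c) ((cmap c \<circ> cinv d) y))"
    proof (rule smooth_on_compose[OF oS U(1) _ _ U(3)])
      show "smooth_on ?S (cmap c \<circ> cinv d)"
        by (rule smooth_on_subset[OF transition_smooth[OF d c(1)]]) auto
      show "(cmap c \<circ> cinv d) ` ?S \<subseteq> U" using d by auto
    qed
    then show ?thesis
      by (rule smooth_on_cong[OF oS, rotated]) (use c d in auto)
  qed
  with o have "smooth_fun A ?W f" by (simp add: smooth_fun_def)
  then show ?thesis using p by (rule smooth_nearI)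
qed

lemma smooth_near_chartD:
  assumes "smooth_near A p f" "c \<in> A" "p \<in> cdom c"
  obtains U where "open U" "cmap c p \<in> U" "U \<subseteq> cmap c ` cdom c" "smooth_on U (f \<circ> cinv c)"
proof -
  obtain W where W: "smooth_fun A W f" "p \<in> W" using assms(1) by (rule smooth_nearE)
  have "openM W" "smooth_on (cmap c ` (cdom c \<inter> W)) (f \<circ> cinv c)"
    using W(1) assms(2) by (auto simp: smooth_fun_def)
  then show thesis
    using W(2) assms(2,3) openM_image[of W c] by (intro that[of "cmap c ` (cdom c \<inter> W)"]) auto
qed

lemma smooth_near_cong:
  assumes "openM W" "p \<in> W" "\<And>q. q \<in> W \<Longrightarrow> f q = g q" "smooth_near A p f"
  shows "smooth_near A p g"
proof -
  obtain c where c: "c \<in> A" "p \<in> cdom c" using assms(1,2) openM_subset pointsE by blast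
  obtain U where U: "open U" "cmap c p \<in> U" "U \<subseteq> cmap c ` cdom c" "smooth_on U (f \<circ> cinv c)"
    using smooth_near_chartD[OF assms(4) c] .
  let ?V = "U \<inter> cmap c ` (cdom c \<inter> W)"
  have V: "open ?V" "cmap c p \<in> ?V" using U c assms by (auto simp: openM_image)
  have "smooth_on ?V (f \<circ> cinv c)" using U(4) smooth_on_subset by blast
  then have "smooth_on ?V (g \<circ> cinv c)"
    by (rule smooth_on_cong[OF V(1), rotated]) (use assms c in auto)
  then show ?thesis by (rule smooth_near_chartI[OF c V])
qed

lemma smooth_near_const: "p \<in> points A \<Longrightarrow> smooth_near A p (\<lambda>q. r)"
  by (erule pointsE, rule smooth_near_chartI[of _ _ UNIV]) (auto simp: o_def intro: smooth_on_const)

lemma smooth_near_coord: "c \<in> A \<Longrightarrow> p \<in> cdom c \<Longrightarrow> smooth_near A p (coord c u)"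
proof -
  assume c: "c \<in> A" "p \<in> cdom c"
  have "smooth_on (cmap c ` cdom c) (\<lambda>y. y \<bullet> u)"
    by (intro smooth_on_linear chart_image_open c bounded_linear_inner_left)
  then have "smooth_on (cmap c ` cdom c) (coord c u \<circ> cinv c)"
    by (rule smooth_on_cong[OF chart_image_open[OF c(1)], rotated]) (use c in auto)
  then show ?thesis using smooth_near_chartI[OF c chart_image_open[OF c(1)]] c by blast
qed

lemma smooth_near_add:
  assumes "smooth_near A p f" "smooth_near A p g"
  shows "smooth_near A p (\<lambda>q. f q + g q)"
proof -
  obtain c where c: "c \<in> A" "p \<in> cdom c" using assms(1) smooth_near_points pointsE by blast
  obtain U where U: "open U" "cmap c p \<in> U" "U \<subseteq> cmap c ` cdom c" "smooth_on U (f \<circ> cinv c)"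
    using smooth_near_chartD[OF assms(1) c] .
  obtain V where V: "open V" "cmap c p \<in> V" "V \<subseteq> cmap c ` cdom c" "smooth_on V (g \<circ> cinv c)"
    using smooth_near_chartD[OF assms(2) c] .
  have "smooth_on (U \<inter> V) (f \<circ> cinv c)" "smooth_on (U \<inter> V) (g \<circ> cinv c)"
    using U V smooth_on_subset by blast+
  then have "smooth_on (U \<inter> V) (\<lambda>y. (f \<circ> cinv c) y + (g \<circ> cinv c) y)"
    using smooth_on_add open_Int[OF U(1) V(1)] by blast
  then show ?thesis
    using U V by (intro smooth_near_chartI[OF c, of "U \<inter> V"]) (auto simp: o_def)
qed

lemma smooth_near_mult:
  assumes "smooth_near A p f" "smooth_near A p g"
  shows "smooth_near A p (\<lambda>q. f q * g q)"
proof -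
  obtain c where c: "c \<in> A" "p \<in> cdom c" using assms(1) smooth_near_points pointsE by blast
  obtain U where U: "open U" "cmap c p \<in> U" "U \<subseteq> cmap c ` cdom c" "smooth_on U (f \<circ> cinv c)"
    using smooth_near_chartD[OF assms(1) c] .
  obtain V where V: "open V" "cmap c p \<in> V" "V \<subseteq> cmap c ` cdom c" "smooth_on V (g \<circ> cinv c)"
    using smooth_near_chartD[OF assms(2) c] .
  have "smooth_on (U \<inter> V) (f \<circ> cinv c)" "smooth_on (U \<inter> V) (g \<circ> cinv c)"
    using U V smooth_on_subset by blast+
  then have "smooth_on (U \<inter> V) (\<lambda>y. (f \<circ> cinv c) y * (g \<circ> cinv c) y)"
    using smooth_on_mult open_Int[OF U(1) V(1)] by blast
  then show ?thesis
    using U V by (intro smooth_near_chartI[OF c, of "U \<inter> V"]) (auto simp: o_def)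
qed

lemma smooth_near_minus: "smooth_near A p f \<Longrightarrow> smooth_near A p (\<lambda>q. - f q)"
  using smooth_near_mult[OF smooth_near_const[of p "-1"], of f] smooth_near_points by simp

lemma smooth_near_diff:
  "smooth_near A p f \<Longrightarrow> smooth_near A p g \<Longrightarrow> smooth_near A p (\<lambda>q. f q - g q)"
  using smooth_near_add[OF _ smooth_near_minus, of p f g] by simp

lemma smooth_near_sum:
  "p \<in> points A \<Longrightarrow> (\<And>i. i \<in> I \<Longrightarrow> smooth_near A p (f i)) \<Longrightarrow> smooth_near A p (\<lambda>q. \<Sum>i\<in>I. f i q)"
  by (induction I rule: infinite_finite_induct) (auto intro: smooth_near_const smooth_near_add)

text \<open>The index space \<open>'f\<close> is independent of the model space. On T*M, whose model
  has dimension 2 DIM('e), the system that inverts the metric of M has size DIM('e).\<close>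

lemma smooth_fun_linear_system:
  fixes H :: "'f::euclidean_space \<Rightarrow> 'f \<Rightarrow> 'a \<Rightarrow> real"
  assumes W: "openM W"
    and H: "\<And>i j. i \<in> Basis \<Longrightarrow> j \<in> Basis \<Longrightarrow> smooth_fun A W (H i j)"
    and nd: "\<And>p v. p \<in> W \<Longrightarrow> (\<And>i. i \<in> Basis \<Longrightarrow> (\<Sum>j\<in>Basis. H i j p * (v \<bullet> j)) = 0) \<Longrightarrow> v = 0"
    and b: "\<And>i. i \<in> Basis \<Longrightarrow> smooth_fun A W (b i)"
    and u: "\<And>p i. p \<in> W \<Longrightarrow> i \<in> Basis \<Longrightarrow> (\<Sum>j\<in>Basis. H i j p * u j p) = b i p"
    and j: "j \<in> Basis"
  shows "smooth_fun A W (u j)"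
  unfolding smooth_fun_def
proof (intro conjI ballI W)
  fix c assume c: "c \<in> A"
  show "smooth_on (cmap c ` (cdom c \<inter> W)) (u j \<circ> cinv c)"
  proof (rule linear_system_smooth_on[of _ "\<lambda>i j. H i j \<circ> cinv c" "\<lambda>i. b i \<circ> cinv c" "\<lambda>j. u j \<circ> cinv c"])
    show "open (cmap c ` (cdom c \<inter> W))" by (rule openM_image[OF W c])
    show "smooth_on (cmap c ` (cdom c \<inter> W)) (H i j \<circ> cinv c)" if "i \<in> Basis" "j \<in> Basis" for i j
      using H[OF that] c by (simp add: smooth_fun_def)
    show "smooth_on (cmap c ` (cdom c \<inter> W)) (b i \<circ> cinv c)" if "i \<in> Basis" for i
      using b[OF that] c by (simp add: smooth_fun_def)
    show "v = 0" if x: "x \<in> cmap c ` (cdom c \<inter> W)"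
      and z: "\<And>i. i \<in> Basis \<Longrightarrow> (\<Sum>j\<in>Basis. (H i j \<circ> cinv c) x * (v \<bullet> j)) = 0" for x v
      by (rule nd[of "cinv c x"]) (use x z c in auto)
    show "(\<Sum>j\<in>Basis. (H i j \<circ> cinv c) x * (u j \<circ> cinv c) x) = (b i \<circ> cinv c) x"
      if "x \<in> cmap c ` (cdom c \<inter> W)" "i \<in> Basis" for x i
      using u[of "cinv c x" i] that c by auto
  qed (rule j)
qed

section \<open>Tangent vectors as directional derivatives\<close>

lemma chart_has_derivative:
  assumes "smooth_near A p f" "c \<in> A" "p \<in> cdom c"
  shows "((f \<circ> cinv c) has_derivative frechet_derivative (f \<circ> cinv c) (at (cmap c p))) (at (cmap c p))"
  by (rule smooth_near_chartD[OF assms]) (rule smooth_on_has_derivative)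

lemma coord_vec_eq:
  "smooth_near A p f \<Longrightarrow> coord_vec A c p u f = frechet_derivative (f \<circ> cinv c) (at (cmap c p)) u"
  by (simp add: coord_vec_def)

lemma smooth_near_coord_vec:
  assumes f: "smooth_near A p f" and c: "c \<in> A" "p \<in> cdom c"
  shows "smooth_near A p (\<lambda>q. coord_vec A c q u f)"
proof -
  obtain U where U: "open U" "cmap c p \<in> U" "U \<subseteq> cmap c ` cdom c" "smooth_on U (f \<circ> cinv c)"
    using smooth_near_chartD[OF assms] .
  have "smooth_on U (\<lambda>y. frechet_derivative (f \<circ> cinv c) (at y) u)"
    by (rule smooth_on_frechet_derivative[OF U(1,4)])
  then have "smooth_on U ((\<lambda>q. frechet_derivative (f \<circ> cinv c) (at (cmap c q)) u) \<circ> cinv c)"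
    by (rule smooth_on_cong[OF U(1), rotated]) (use U(3) c in auto)
  then have *: "smooth_near A p (\<lambda>q. frechet_derivative (f \<circ> cinv c) (at (cmap c q)) u)"
    by (rule smooth_near_chartI[OF c U(1,2)])
  obtain W where W: "openM W" "p \<in> W" "\<forall>q\<in>W. smooth_near A q f"
    by (rule smooth_near_open[OF f])
  show ?thesis by (rule smooth_near_cong[OF W(1,2) _ *]) (simp add: coord_vec_eq W(3))
qed

lemma linear_coord_vec:
  assumes "c \<in> A" "p \<in> cdom c"
  shows "linear (coord_vec A c p)"
proof -
  have "linear (frechet_derivative (f \<circ> cinv c) (at (cmap c p)))" if "smooth_near A p f" for f
    using chart_has_derivative[OF that assms] has_derivative_linear by blast
  note l = linear_add[OF this] linear_scale[OF this]
  show ?thesis by (rule linearI) (auto simp: coord_vec_def fun_eq_iff l)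
qed

text \<open>Chain rule for f in the chart c as f in the chart d after the transition map. It makes
  the tangent space the image of one linear map for any chart around p.\<close>

lemma coord_vec_transition:
  assumes c: "c \<in> A" "p \<in> cdom c" and d: "d \<in> A" "p \<in> cdom d"
  shows "coord_vec A c p u = coord_vec A d p (frechet_derivative (cmap d \<circ> cinv c) (at (cmap c p)) u)"
proof
  fix f
  show "coord_vec A c p u f = coord_vec A d p (frechet_derivative (cmap d \<circ> cinv c) (at (cmap c p)) u) f"
  proof (cases "smooth_near A p f")
    case True
    let ?\<phi> = "cmap d \<circ> cinv c"
    have \<phi>: "(?\<phi> has_derivative frechet_derivative ?\<phi> (at (cmap c p))) (at (cmap c p))"
      by (rule smooth_on_has_derivative[OF transition_smooth[OF c(1) d(1)]]) (use c d in auto)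
    have "((f \<circ> cinv d) has_derivative frechet_derivative (f \<circ> cinv d) (at (cmap d p))) (at (?\<phi> (cmap c p)))"
      using chart_has_derivative[OF True d] c by simp
    then have "((\<lambda>x. (f \<circ> cinv d) (?\<phi> x)) has_derivative
       (\<lambda>v. frechet_derivative (f \<circ> cinv d) (at (cmap d p)) (frechet_derivative ?\<phi> (at (cmap c p)) v))) (at (cmap c p))"
      by (rule has_derivative_compose[OF \<phi>])
    then have "((f \<circ> cinv c) has_derivative
       (\<lambda>v. frechet_derivative (f \<circ> cinv d) (at (cmap d p)) (frechet_derivative ?\<phi> (at (cmap c p)) v))) (at (cmap c p))"
      by (rule has_derivative_transform_within_open[OF _ chart_overlap_open[OF c(1) d(1)]]) (use c d in auto)
    then have "frechet_derivative (f \<circ> cinv c) (at (cmap c p)) =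
      (\<lambda>v. frechet_derivative (f \<circ> cinv d) (at (cmap d p)) (frechet_derivative ?\<phi> (at (cmap c p)) v))"
      by (rule frechet_derivative_at[symmetric])
    then show ?thesis by (simp add: coord_vec_eq[OF True])
  qed (simp add: coord_vec_def)
qed

lemma tangent_space_chart:
  assumes "c \<in> A" "p \<in> cdom c"
  shows "tangent_space A p = range (coord_vec A c p)"
  unfolding tangent_space_def using assms coord_vec_transition[OF _ _ assms] by blast

lemma coord_vec_in_tangent_space [intro]: "c \<in> A \<Longrightarrow> p \<in> cdom c \<Longrightarrow> coord_vec A c p u \<in> tangent_space A p"
  by (simp add: tangent_space_chart)

lemma tangent_space_points: "v \<in> tangent_space A p \<Longrightarrow> p \<in> points A"
  by (auto simp: tangent_space_def points_def)

lemma coord_vec_coord: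
  assumes c: "c \<in> A" "p \<in> cdom c"
  shows "coord_vec A c p u (coord c k) = u \<bullet> k"
proof -
  have "((\<lambda>y. y \<bullet> k) has_derivative (\<lambda>v. v \<bullet> k)) (at (cmap c p))"
    by (rule bounded_linear_imp_has_derivative[OF bounded_linear_inner_left])
  then have "((coord c k \<circ> cinv c) has_derivative (\<lambda>v. v \<bullet> k)) (at (cmap c p))"
    by (rule has_derivative_transform_within_open[OF _ chart_image_open[OF c(1)]]) (use c in auto)
  then have "frechet_derivative (coord c k \<circ> cinv c) (at (cmap c p)) = (\<lambda>v. v \<bullet> k)"
    by (rule frechet_derivative_at[symmetric])
  then show ?thesis by (simp add: coord_vec_eq[OF smooth_near_coord[OF c]])
qed

lemma tangent_eq_coord_vec:
  assumes c: "c \<in> A" "p \<in> cdom c" and v: "v \<in> tangent_space A p"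
  shows "v = coord_vec A c p (\<Sum>i\<in>Basis. v (coord c i) *\<^sub>R i)"
proof -
  obtain u where u: "v = coord_vec A c p u" using v tangent_space_chart[OF c] by auto
  show ?thesis by (simp add: u coord_vec_coord[OF c] euclidean_representation)
qed

lemma tangent_expand:
  assumes c: "c \<in> A" "p \<in> cdom c" and v: "v \<in> tangent_space A p"
  shows "v = (\<Sum>i\<in>Basis. v (coord c i) *\<^sub>R coord_vec A c p i)"
proof -
  have "coord_vec A c p (\<Sum>i\<in>Basis. v (coord c i) *\<^sub>R i) = (\<Sum>i\<in>Basis. v (coord c i) *\<^sub>R coord_vec A c p i)"
    by (simp add: linear_sum[OF linear_coord_vec[OF c]] linear_scale[OF linear_coord_vec[OF c]])
  then show ?thesis using tangent_eq_coord_vec[OF assms] by simp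
qed

lemma tangent_expand_apply:
  assumes "c \<in> A" "p \<in> cdom c" "v \<in> tangent_space A p"
  shows "v f = (\<Sum>i\<in>Basis. v (coord c i) * coord_vec A c p i f)"
proof -
  have "(\<Sum>i\<in>Basis. v (coord c i) *\<^sub>R coord_vec A c p i) f = (\<Sum>i\<in>Basis. v (coord c i) * coord_vec A c p i f)"
    by (simp add: sum_fun_apply)
  then show ?thesis using tangent_expand[OF assms] by simp
qed

lemma tangent_eqI:
  assumes "c \<in> A" "p \<in> cdom c" "v \<in> tangent_space A p" "w \<in> tangent_space A p"
    "\<And>i. i \<in> Basis \<Longrightarrow> v (coord c i) = w (coord c i)"
  shows "v = w"
  using tangent_eq_coord_vec[OF assms(1,2,3)] tangent_eq_coord_vec[OF assms(1,2,4)] assms(5)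
  by (metis (no_types, lifting) sum.cong)

lemma subspace_tangent_space: "p \<in> points A \<Longrightarrow> subspace (tangent_space A p)"
  by (erule pointsE) (simp add: tangent_space_chart linear_subspace_image[OF linear_coord_vec])

lemma tangent_add: "v \<in> tangent_space A p \<Longrightarrow> w \<in> tangent_space A p \<Longrightarrow> v + w \<in> tangent_space A p"
  using subspace_add subspace_tangent_space tangent_space_points by blast

lemma tangent_scale: "v \<in> tangent_space A p \<Longrightarrow> r *\<^sub>R v \<in> tangent_space A p"
  using subspace_scale subspace_tangent_space tangent_space_points by blast

lemma tangent_minus: "v \<in> tangent_space A p \<Longrightarrow> - v \<in> tangent_space A p"
  using tangent_scale[of v p "-1"] by simp

lemma tangent_diff: "v \<in> tangent_space A p \<Longrightarrow> w \<in> tangent_space A p \<Longrightarrow> v - w \<in> tangent_space A p"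
  using subspace_diff subspace_tangent_space tangent_space_points by blast

lemma tangent_sum:
  "p \<in> points A \<Longrightarrow> (\<And>i. i \<in> I \<Longrightarrow> v i \<in> tangent_space A p) \<Longrightarrow> (\<Sum>i\<in>I. v i) \<in> tangent_space A p"
  using subspace_sum[OF subspace_tangent_space] by blast

lemma tangentE:
  assumes "v \<in> tangent_space A p"
  obtains c u where "c \<in> A" "p \<in> cdom c" "v = coord_vec A c p u"
  using assms by (auto simp: tangent_space_def)

lemma tangent_not_smooth: "v \<in> tangent_space A p \<Longrightarrow> \<not> smooth_near A p f \<Longrightarrow> v f = 0"
  by (elim tangentE) (simp add: coord_vec_def)

text \<open>Locality holds for arbitrary functions: being smooth near p is itself local, so the
  conventional value 0 is taken on both functions or on neither.\<close>

lemma tangent_cong: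
  assumes v: "v \<in> tangent_space A p" and W: "openM W" "p \<in> W" and eq: "\<And>q. q \<in> W \<Longrightarrow> f q = g q"
  shows "v f = v g"
proof (cases "smooth_near A p f")
  case True
  then have g: "smooth_near A p g" using smooth_near_cong[OF W, of f g] eq by blast
  obtain c u where c: "c \<in> A" "p \<in> cdom c" and u: "v = coord_vec A c p u" using v by (rule tangentE)
  have "((g \<circ> cinv c) has_derivative frechet_derivative (f \<circ> cinv c) (at (cmap c p))) (at (cmap c p))"
    by (rule has_derivative_transform_within_open[OF chart_has_derivative[OF True c] openM_image[OF W(1) c(1)]])
      (use W c eq in auto)
  then have "frechet_derivative (g \<circ> cinv c) (at (cmap c p)) = frechet_derivative (f \<circ> cinv c) (at (cmap c p))"
    by (rule frechet_derivative_at[symmetric])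
  then show ?thesis by (simp add: u coord_vec_eq True g)
next
  case False
  then have "\<not> smooth_near A p g" using smooth_near_cong[OF W, of g f] eq by metis
  then show ?thesis using False v by (simp add: tangent_not_smooth)
qed

lemma tangent_const: "v \<in> tangent_space A p \<Longrightarrow> v (\<lambda>q. r) = 0"
  by (elim tangentE) (simp add: coord_vec_def o_def)

lemma tangent_plus:
  assumes v: "v \<in> tangent_space A p" and f: "smooth_near A p f" and g: "smooth_near A p g"
  shows "v (\<lambda>q. f q + g q) = v f + v g"
proof -
  obtain c u where c: "c \<in> A" "p \<in> cdom c" and u: "v = coord_vec A c p u" using v by (rule tangentE)
  have "(((\<lambda>q. f q + g q) \<circ> cinv c) has_derivative (\<lambda>w. frechet_derivative (f \<circ> cinv c) (at (cmap c p)) w +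
      frechet_derivative (g \<circ> cinv c) (at (cmap c p)) w)) (at (cmap c p))"
    using has_derivative_add[OF chart_has_derivative[OF f c] chart_has_derivative[OF g c]] by (simp add: o_def)
  from fun_cong[OF frechet_derivative_at[OF this], of u] show ?thesis
    by (simp add: u coord_vec_eq f g smooth_near_add)
qed

lemma tangent_mult:
  assumes v: "v \<in> tangent_space A p" and f: "smooth_near A p f" and g: "smooth_near A p g"
  shows "v (\<lambda>q. f q * g q) = f p * v g + g p * v f"
proof -
  obtain c u where c: "c \<in> A" "p \<in> cdom c" and u: "v = coord_vec A c p u" using v by (rule tangentE)
  have "(((\<lambda>q. f q * g q) \<circ> cinv c) has_derivative (\<lambda>w. f p * frechet_derivative (g \<circ> cinv c) (at (cmap c p)) w +
      frechet_derivative (f \<circ> cinv c) (at (cmap c p)) w * g p)) (at (cmap c p))"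
    using has_derivative_mult[OF chart_has_derivative[OF f c] chart_has_derivative[OF g c]] c by (simp add: o_def)
  from fun_cong[OF frechet_derivative_at[OF this], of u] show ?thesis
    by (simp add: u coord_vec_eq f g smooth_near_mult mult.commute)
qed

lemma tangent_sum_fun:
  assumes v: "v \<in> tangent_space A p" and "\<And>i. i \<in> I \<Longrightarrow> smooth_near A p (f i)"
  shows "v (\<lambda>q. \<Sum>i\<in>I. f i q) = (\<Sum>i\<in>I. v (f i))"
  using assms(2)
proof (induction I rule: infinite_finite_induct)
  case (insert i I)
  then show ?case
    by (simp add: tangent_plus[OF v] smooth_near_sum tangent_space_points[OF v])
qed (simp_all add: tangent_const[OF v])

lemma coord_vec_commute:
  assumes f: "smooth_near A p f" and c: "c \<in> A" "p \<in> cdom c" and ij: "i \<in> Basis" "j \<in> Basis"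
  shows "coord_vec A c p j (\<lambda>q. coord_vec A c q i f) = coord_vec A c p i (\<lambda>q. coord_vec A c q j f)"
proof -
  obtain W where W: "openM W" "p \<in> W" "\<forall>q\<in>W. smooth_near A q f"
    by (rule smooth_near_open[OF f])
  obtain U' where U': "open U'" "cmap c p \<in> U'" "U' \<subseteq> cmap c ` cdom c" "smooth_on U' (f \<circ> cinv c)"
    using smooth_near_chartD[OF f c] .
  let ?U = "U' \<inter> cmap c ` (cdom c \<inter> W)"
  have U: "open ?U" "cmap c p \<in> ?U" "smooth_on ?U (f \<circ> cinv c)"
    using U' W c openM_image by (auto intro: smooth_on_subset)
  have *: "coord_vec A c p j (\<lambda>q. coord_vec A c q i f) =
      frechet_derivative (\<lambda>y. frechet_derivative (f \<circ> cinv c) (at y) i) (at (cmap c p)) j" for i j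
  proof -
    have "(((\<lambda>q. coord_vec A c q i f) \<circ> cinv c) has_derivative
      frechet_derivative (\<lambda>y. frechet_derivative (f \<circ> cinv c) (at y) i) (at (cmap c p))) (at (cmap c p))"
      by (rule has_derivative_transform_within_open[OF smooth_on_has_derivative[OF
              smooth_on_frechet_derivative[OF U(1,3)] U(2)] U(1,2)])
        (use c W(3) in \<open>auto simp: coord_vec_eq\<close>)
    from frechet_derivative_at[OF this] show ?thesis
      by (simp add: coord_vec_eq smooth_near_coord_vec[OF f c])
  qed
  show ?thesis unfolding * by (rule frechet_derivative_symmetric[OF U ij])
qed

section \<open>Vector fields and the Lie bracket\<close>

lemma vfield_open: "smooth_vfield A W X \<Longrightarrow> openM W"
  by (simp add: smooth_vfield_def)

lemma vfield_tangent: "smooth_vfield A W X \<Longrightarrow> p \<in> W \<Longrightarrow> X p \<in> tangent_space A p"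
  by (simp add: smooth_vfield_def)

lemma vfield_smooth_near:
  assumes X: "smooth_vfield A W X" and p: "p \<in> W" and f: "smooth_near A p f"
  shows "smooth_near A p (\<lambda>q. X q f)"
proof -
  obtain V where V: "smooth_fun A V f" "p \<in> V" using f by (rule smooth_nearE)
  have "smooth_fun A (V \<inter> W) f"
    by (rule smooth_fun_subset[OF V(1)]) (use V(1) smooth_funD vfield_open[OF X] in auto)
  then have "smooth_fun A (V \<inter> W) (\<lambda>q. X q f)" using X by (simp add: smooth_vfield_def)
  then show ?thesis by (rule smooth_nearI) (use V p in simp)
qed

text \<open>X f is a finite sum of components of X times partial derivatives of f, so the components
  in one chart around each point control X f for all smooth f.\<close>

lemma smooth_vfieldI:
  assumes W: "openM W" and t: "\<And>p. p \<in> W \<Longrightarrow> X p \<in> tangent_space A p"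
    and comp: "\<And>p. p \<in> W \<Longrightarrow> \<exists>c\<in>A. p \<in> cdom c \<and> (\<forall>i\<in>Basis. smooth_near A p (\<lambda>q. X q (coord c i)))"
  shows "smooth_vfield A W X"
  unfolding smooth_vfield_def
proof (intro conjI allI impI ballI W t)
  fix V f assume V: "V \<subseteq> W \<and> smooth_fun A V f"
  show "smooth_fun A V (\<lambda>p. X p f)" unfolding smooth_fun_iff
  proof (intro conjI ballI)
    show "openM V" using V smooth_funD by blast
    fix p assume p: "p \<in> V"
    obtain c where c: "c \<in> A" "p \<in> cdom c" "\<forall>i\<in>Basis. smooth_near A p (\<lambda>q. X q (coord c i))"
      using comp[of p] p V by blast
    have f: "smooth_near A p f" using V p by (auto intro: smooth_nearI)
    have o: "openM (V \<inter> cdom c)" using V smooth_funD openM_cdom[OF c(1)] by blast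
    have "smooth_near A p (\<lambda>q. \<Sum>i\<in>Basis. X q (coord c i) * coord_vec A c q i f)"
      using c by (intro smooth_near_sum smooth_near_mult smooth_near_coord_vec f pointsI[of c]) auto
    then show "smooth_near A p (\<lambda>q. X q f)"
      by (rule smooth_near_cong[OF o, rotated 2])
        (use p c V t in \<open>auto simp: tangent_expand_apply[OF c(1), of _ _ f]\<close>)
  qed
qed

lemma smooth_vfieldI':
  assumes W: "openM W" and t: "\<And>p. p \<in> W \<Longrightarrow> X p \<in> tangent_space A p"
    and "\<And>p f. p \<in> W \<Longrightarrow> smooth_near A p f \<Longrightarrow> smooth_near A p (\<lambda>q. X q f)"
  shows "smooth_vfield A W X"
proof (rule smooth_vfieldI[OF W t])
  fix p assume p: "p \<in> W"
  obtain c where c: "c \<in> A" "p \<in> cdom c" using p W openM_subset pointsE by blast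
  show "\<exists>c\<in>A. p \<in> cdom c \<and> (\<forall>i\<in>Basis. smooth_near A p (\<lambda>q. X q (coord c i)))"
    using c assms(3)[OF p] smooth_near_coord by blast
qed

lemma vfield_subset: "smooth_vfield A W X \<Longrightarrow> openM V \<Longrightarrow> V \<subseteq> W \<Longrightarrow> smooth_vfield A V X"
  unfolding smooth_vfield_def by (meson subset_eq subset_trans)

lemma vfield_cong:
  assumes X: "smooth_vfield A W X" and eq: "\<And>p. p \<in> W \<Longrightarrow> X p = Y p"
  shows "smooth_vfield A W Y"
proof (rule smooth_vfieldI'[OF vfield_open[OF X]])
  fix p f assume p: "p \<in> W" and f: "smooth_near A p f"
  show "smooth_near A p (\<lambda>q. Y q f)"
    by (rule smooth_near_cong[OF vfield_open[OF X] p _ vfield_smooth_near[OF X p f]]) (simp add: eq)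
qed (use vfield_tangent[OF X] eq in auto)

lemma vfield_add:
  assumes "smooth_vfield A W X" "smooth_vfield A W Y"
  shows "smooth_vfield A W (\<lambda>p. X p + Y p)"
  by (rule smooth_vfieldI'[OF vfield_open[OF assms(1)]])
    (auto intro: tangent_add smooth_near_add assms[THEN vfield_tangent] assms[THEN vfield_smooth_near])

lemma vfield_scale:
  assumes "smooth_fun A W f" "smooth_vfield A W X"
  shows "smooth_vfield A W (\<lambda>p. f p *\<^sub>R X p)"
  by (rule smooth_vfieldI'[OF vfield_open[OF assms(2)]])
    (auto intro: tangent_scale smooth_near_mult vfield_tangent[OF assms(2)]
      vfield_smooth_near[OF assms(2)] smooth_nearI[OF assms(1)])

lemma vfield_zero:
  assumes "openM W"
  shows "smooth_vfield A W (\<lambda>p. 0)"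
proof (rule smooth_vfieldI'[OF assms])
  fix p assume "p \<in> W"
  then have p: "p \<in> points A" using openM_subset[OF assms] by auto
  show "0 \<in> tangent_space A p" using subspace_tangent_space[OF p] by (rule subspace_0)
  show "smooth_near A p (\<lambda>q. 0 f)" for f using smooth_near_const[OF p, of 0] by simp
qed

lemma vfield_sum:
  assumes "openM W" "\<And>i. i \<in> I \<Longrightarrow> smooth_vfield A W (X i)"
  shows "smooth_vfield A W (\<lambda>p. \<Sum>i\<in>I. X i p)"
  using assms(2)
  by (induction I rule: infinite_finite_induct) (auto intro: vfield_add vfield_zero assms(1))

lemma vfield_coord_vec: "c \<in> A \<Longrightarrow> smooth_vfield A (cdom c) (\<lambda>p. coord_vec A c p u)"
  by (rule smooth_vfieldI'[OF openM_cdom]) (auto intro: smooth_near_coord_vec)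

lemma vfield_comp_smooth: "smooth_vfield A W X \<Longrightarrow> c \<in> A \<Longrightarrow> p \<in> W \<inter> cdom c \<Longrightarrow> smooth_near A p (\<lambda>q. X q (coord c i))"
  by (simp add: vfield_smooth_near smooth_near_coord)

lemma lie_bracket_apply:
  "smooth_near A p f \<Longrightarrow> lie_bracket A X Y p f = X p (\<lambda>q. Y q f) - Y p (\<lambda>q. X q f)"
  by (simp add: lie_bracket_def)

text \<open>Membership in the tangent space requires a coordinate vector, namely the one with
  components X(Y^i) - Y(X^i). It represents the bracket because the second-order terms of XYf and
  YXf are equal.\<close>

lemma lie_bracket_tangent:
  assumes X: "smooth_vfield A W X" and Y: "smooth_vfield A W Y" and p: "p \<in> W"
  shows "lie_bracket A X Y p \<in> tangent_space A p"
proof -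
  obtain c where c: "c \<in> A" "p \<in> cdom c" using p vfield_open[OF X] openM_subset pointsE by blast
  \<comment> \<open>Leibniz rule for Yf = Y^i d_i f: a first-order part with coefficients X(Y^i),
    and a second-order part with coefficients Y^i X^j. It is stated for all X and Y since both
    orders are needed.\<close>
  have *: "X p (\<lambda>q. Y q f) = (\<Sum>i\<in>Basis. X p (\<lambda>q. Y q (coord c i)) * coord_vec A c p i f) +
      (\<Sum>i\<in>Basis. \<Sum>j\<in>Basis. Y p (coord c i) * X p (coord c j) * coord_vec A c p j (\<lambda>q. coord_vec A c q i f))"
    if f: "smooth_near A p f" and X: "smooth_vfield A W X" and Y: "smooth_vfield A W Y" for f X Y
  proof -
    note Xp = vfield_tangent[OF X p]
    have o: "openM (W \<inter> cdom c)" using vfield_open[OF X] openM_cdom[OF c(1)] by blast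
    have s: "smooth_near A p (\<lambda>q. Y q (coord c i))" "smooth_near A p (\<lambda>q. coord_vec A c q i f)" for i
      using vfield_comp_smooth[OF Y c(1)] p c smooth_near_coord_vec[OF f c] by auto
    have "X p (\<lambda>q. Y q f) = X p (\<lambda>q. \<Sum>i\<in>Basis. Y q (coord c i) * coord_vec A c q i f)"
      by (rule tangent_cong[OF Xp o]) (use c p vfield_tangent[OF Y] tangent_expand_apply in auto)
    also have "\<dots> = (\<Sum>i\<in>Basis. X p (\<lambda>q. Y q (coord c i) * coord_vec A c q i f))"
      by (rule tangent_sum_fun[OF Xp]) (intro smooth_near_mult s)
    also have "\<dots> = (\<Sum>i\<in>Basis. Y p (coord c i) * X p (\<lambda>q. coord_vec A c q i f) +
        coord_vec A c p i f * X p (\<lambda>q. Y q (coord c i)))"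
      by (simp add: tangent_mult[OF Xp s])
    also have "\<dots> = (\<Sum>i\<in>Basis. X p (\<lambda>q. Y q (coord c i)) * coord_vec A c p i f) +
        (\<Sum>i\<in>Basis. Y p (coord c i) * X p (\<lambda>q. coord_vec A c q i f))"
      by (simp add: sum.distrib mult.commute)
    also have "(\<Sum>i\<in>Basis. Y p (coord c i) * X p (\<lambda>q. coord_vec A c q i f)) =
      (\<Sum>i\<in>Basis. \<Sum>j\<in>Basis. Y p (coord c i) * X p (coord c j) * coord_vec A c p j (\<lambda>q. coord_vec A c q i f))"
      by (subst tangent_expand_apply[OF c Xp]) (simp add: sum_distrib_left mult.assoc)
    finally show ?thesis .
  qed
  have "lie_bracket A X Y p f = coord_vec A c p (\<Sum>i\<in>Basis. (X p (\<lambda>q. Y q (coord c i)) - Y p (\<lambda>q. X q (coord c i))) *\<^sub>R i) f" for f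
  proof (cases "smooth_near A p f")
    case True
    \<comment> \<open>Renaming the indices and commuting the coordinate derivatives identifies the
      second-order parts of the two orders.\<close>
    have "(\<Sum>i\<in>Basis. \<Sum>j\<in>Basis. Y p (coord c i) * X p (coord c j) * coord_vec A c p j (\<lambda>q. coord_vec A c q i f)) =
      (\<Sum>j\<in>Basis. \<Sum>i\<in>Basis. Y p (coord c i) * X p (coord c j) * coord_vec A c p j (\<lambda>q. coord_vec A c q i f))"
      by (rule sum.swap)
    also have "\<dots> = (\<Sum>i\<in>Basis. \<Sum>j\<in>Basis. X p (coord c i) * Y p (coord c j) * coord_vec A c p j (\<lambda>q. coord_vec A c q i f))"
      by (intro sum.cong refl) (simp add: coord_vec_commute[OF True c] mult.commute)
    finally show ?thesis
      unfolding lie_bracket_apply[OF True] *[OF True X Y] *[OF True Y X]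
      by (simp add: linear_sum[OF linear_coord_vec[OF c]] linear_scale[OF linear_coord_vec[OF c]]
          sum_fun_apply left_diff_distrib sum_subtractf)
  next
    case False
    then show ?thesis by (simp add: lie_bracket_def coord_vec_def)
  qed
  then have "lie_bracket A X Y p = coord_vec A c p (\<Sum>i\<in>Basis. (X p (\<lambda>q. Y q (coord c i)) - Y p (\<lambda>q. X q (coord c i))) *\<^sub>R i)"
    by blast
  then show ?thesis using c by auto
qed

lemma vfield_lie_bracket:
  assumes X: "smooth_vfield A W X" and Y: "smooth_vfield A W Y"
  shows "smooth_vfield A W (lie_bracket A X Y)"
proof (rule smooth_vfieldI'[OF vfield_open[OF X] lie_bracket_tangent[OF X Y]])
  fix p f assume p: "p \<in> W" and f: "smooth_near A p f"
  obtain V where V: "openM V" "p \<in> V" "\<forall>q\<in>V. smooth_near A q f" by (rule smooth_near_open[OF f])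
  have "smooth_near A p (\<lambda>q. X q (\<lambda>q. Y q f) - Y q (\<lambda>q. X q f))"
    by (intro smooth_near_diff vfield_smooth_near[OF X p] vfield_smooth_near[OF Y p] f)
  then show "smooth_near A p (\<lambda>q. lie_bracket A X Y q f)"
    by (rule smooth_near_cong[OF V(1,2), rotated]) (simp add: V lie_bracket_apply)
qed

lemma lie_bracket_cong:
  assumes X: "smooth_vfield A W X" and Y: "smooth_vfield A W Y" and p: "p \<in> W"
    and eq: "\<And>q. q \<in> W \<Longrightarrow> X q = X' q" "\<And>q. q \<in> W \<Longrightarrow> Y q = Y' q"
  shows "lie_bracket A X Y p = lie_bracket A X' Y' p"
proof
  fix f
  have "X p (\<lambda>q. Y q f) = X p (\<lambda>q. Y' q f)"
    by (rule tangent_cong[OF vfield_tangent[OF X p] vfield_open[OF X] p]) (simp only: eq(2))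
  moreover have "Y p (\<lambda>q. X q f) = Y p (\<lambda>q. X' q f)"
    by (rule tangent_cong[OF vfield_tangent[OF Y p] vfield_open[OF X] p]) (simp only: eq(1))
  ultimately show "lie_bracket A X Y p f = lie_bracket A X' Y' p f"
    unfolding lie_bracket_def eq(1)[OF p] eq(2)[OF p] by (simp only:)
qed

lemma lie_bracket_anti: "lie_bracket A X Y p = - lie_bracket A Y X p"
  by (rule ext) (simp add: lie_bracket_def)

lemma lie_bracket_add_left:
  assumes X: "smooth_vfield A W X" and X': "smooth_vfield A W X'" and Y: "smooth_vfield A W Y" and p: "p \<in> W"
  shows "lie_bracket A (\<lambda>q. X q + X' q) Y p = lie_bracket A X Y p + lie_bracket A X' Y p"
proof
  fix f
  show "lie_bracket A (\<lambda>q. X q + X' q) Y p f = (lie_bracket A X Y p + lie_bracket A X' Y p) f"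
  proof (cases "smooth_near A p f")
    case True
    then show ?thesis
      by (simp add: lie_bracket_apply tangent_plus[OF vfield_tangent[OF Y p]] vfield_smooth_near[OF X p] vfield_smooth_near[OF X' p])
  qed (simp add: lie_bracket_def)
qed

lemma lie_bracket_scale_left:
  assumes g: "smooth_fun A W g" and X: "smooth_vfield A W X" and Y: "smooth_vfield A W Y" and p: "p \<in> W"
  shows "lie_bracket A (\<lambda>q. g q *\<^sub>R X q) Y p = g p *\<^sub>R lie_bracket A X Y p - Y p g *\<^sub>R X p"
proof
  fix f
  show "lie_bracket A (\<lambda>q. g q *\<^sub>R X q) Y p f = (g p *\<^sub>R lie_bracket A X Y p - Y p g *\<^sub>R X p) f"
  proof (cases "smooth_near A p f")
    case True
    then show ?thesis
      by (simp add: lie_bracket_apply tangent_mult[OF vfield_tangent[OF Y p] smooth_nearI[OF g p]]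
          vfield_smooth_near[OF X p] algebra_simps)
  next
    case False
    then show ?thesis by (simp add: lie_bracket_def tangent_not_smooth[OF vfield_tangent[OF X p]])
  qed
qed

end

section \<open>The Nijenhuis tensor\<close>

locale smooth_tensor11 = smooth_atlas A for A :: "('a, 'e::euclidean_space) chart set" +
  fixes J :: "'a tensor11"
  assumes tensor: "tensor11_field A J"
begin

lemma J_tangent: "v \<in> tangent_space A p \<Longrightarrow> J p v \<in> tangent_space A p"
  using tensor tangent_space_points unfolding tensor11_field_def by blast

lemma J_add: "v \<in> tangent_space A p \<Longrightarrow> w \<in> tangent_space A p \<Longrightarrow> J p (v + w) = J p v + J p w"
  using tensor tangent_space_points unfolding tensor11_field_def linear_on_def by blast

lemma J_scale: "v \<in> tangent_space A p \<Longrightarrow> J p (r *\<^sub>R v) = r *\<^sub>R J p v"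
  using tensor tangent_space_points unfolding tensor11_field_def linear_on_def by blast

lemma J_minus: "v \<in> tangent_space A p \<Longrightarrow> J p (- v) = - J p v"
  using J_scale[of v p "-1"] by simp

lemma J_diff: "v \<in> tangent_space A p \<Longrightarrow> w \<in> tangent_space A p \<Longrightarrow> J p (v - w) = J p v - J p w"
  using J_add[of v p "-w"] J_minus tangent_minus by simp

lemma J_zero: "p \<in> points A \<Longrightarrow> J p 0 = 0"
  using J_scale[of 0 p 0] subspace_0[OF subspace_tangent_space] by simp

lemma J_field: "smooth_vfield A W X \<Longrightarrow> smooth_vfield A W (\<lambda>p. J p (X p))"
  using tensor by (simp add: tensor11_field_def)

lemma nijenhuis_cong:
  assumes X: "smooth_vfield A W X" and Y: "smooth_vfield A W Y" and p: "p \<in> W"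
    and eq: "\<And>q. q \<in> W \<Longrightarrow> X q = X' q" "\<And>q. q \<in> W \<Longrightarrow> Y q = Y' q"
  shows "nijenhuis A J X Y p = nijenhuis A J X' Y' p"
proof -
  note JX = J_field[OF X] and JY = J_field[OF Y]
  show ?thesis
    unfolding nijenhuis_def
    using lie_bracket_cong[OF JX JY p, of "\<lambda>q. J q (X' q)" "\<lambda>q. J q (Y' q)"]
      lie_bracket_cong[OF JX Y p, of "\<lambda>q. J q (X' q)" Y'] lie_bracket_cong[OF X JY p, of X' "\<lambda>q. J q (Y' q)"]
      lie_bracket_cong[OF X Y p, of X' Y'] eq by simp
qed

lemma nijenhuis_anti:
  assumes X: "smooth_vfield A W X" and Y: "smooth_vfield A W Y" and p: "p \<in> W"
  shows "nijenhuis A J Y X p = - nijenhuis A J X Y p"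
proof -
  note t = lie_bracket_tangent[OF _ _ p] J_tangent J_field X Y
  have 1: "J p (lie_bracket A (\<lambda>q. J q (Y q)) X p) = - J p (lie_bracket A X (\<lambda>q. J q (Y q)) p)"
    by (subst lie_bracket_anti) (intro J_minus t)
  have 2: "J p (lie_bracket A Y (\<lambda>q. J q (X q)) p) = - J p (lie_bracket A (\<lambda>q. J q (X q)) Y p)"
    by (subst lie_bracket_anti) (intro J_minus t)
  have 3: "J p (J p (lie_bracket A Y X p)) = - J p (J p (lie_bracket A X Y p))"
    by (subst lie_bracket_anti) (simp add: J_minus t)
  show ?thesis
    unfolding nijenhuis_def 1 2 3 by (subst lie_bracket_anti) simp
qed

lemma nijenhuis_add_left:
  assumes X: "smooth_vfield A W X" and X': "smooth_vfield A W X'" and Y: "smooth_vfield A W Y" and p: "p \<in> W"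
  shows "nijenhuis A J (\<lambda>q. X q + X' q) Y p = nijenhuis A J X Y p + nijenhuis A J X' Y p"
proof -
  note JX = J_field[OF X] and JX' = J_field[OF X'] and JY = J_field[OF Y]
  note t = lie_bracket_tangent[OF _ _ p] J_tangent X X' Y JX JX' JY
  have J: "J q (X q) + J q (X' q) = J q (X q + X' q)" if "q \<in> W" for q
    using that by (simp add: J_add vfield_tangent[OF X] vfield_tangent[OF X'])
  have e: "lie_bracket A (\<lambda>q. J q (X q + X' q)) Z p = lie_bracket A (\<lambda>q. J q (X q)) Z p + lie_bracket A (\<lambda>q. J q (X' q)) Z p"
    if "smooth_vfield A W Z" for Z
    using lie_bracket_cong[OF vfield_add[OF JX JX'] that p, of "\<lambda>q. J q (X q + X' q)" Z]
      lie_bracket_add_left[OF JX JX' that p] J by simp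
  show ?thesis
    unfolding nijenhuis_def e[OF Y] e[OF JY] lie_bracket_add_left[OF X X' Y p] lie_bracket_add_left[OF X X' JY p]
    by (simp add: J_add t)
qed

text \<open>Tensoriality: the four brackets contribute the derivative terms -((JY)g) JX, (Yg) J^2 X,
  ((JY)g) JX and -(Yg) J^2 X, which cancel in pairs.\<close>

lemma nijenhuis_scale_left:
  assumes g: "smooth_fun A W g" and X: "smooth_vfield A W X" and Y: "smooth_vfield A W Y" and p: "p \<in> W"
  shows "nijenhuis A J (\<lambda>q. g q *\<^sub>R X q) Y p = g p *\<^sub>R nijenhuis A J X Y p"
proof -
  note JX = J_field[OF X] and JY = J_field[OF Y]
  note t = lie_bracket_tangent[OF _ _ p] J_tangent tangent_scale tangent_diff vfield_tangent[OF X p] X Y JX JY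
  have J: "g q *\<^sub>R J q (X q) = J q (g q *\<^sub>R X q)" if "q \<in> W" for q
    using that by (simp add: J_scale vfield_tangent[OF X])
  have e: "lie_bracket A (\<lambda>q. J q (g q *\<^sub>R X q)) Z p = g p *\<^sub>R lie_bracket A (\<lambda>q. J q (X q)) Z p - Z p g *\<^sub>R J p (X p)"
    if "smooth_vfield A W Z" for Z
    using lie_bracket_cong[OF vfield_scale[OF g JX] that p, of "\<lambda>q. J q (g q *\<^sub>R X q)" Z]
      lie_bracket_scale_left[OF g JX that p] J by simp
  show ?thesis
    unfolding nijenhuis_def e[OF Y] e[OF JY] lie_bracket_scale_left[OF g X Y p] lie_bracket_scale_left[OF g X JY p]
    by (simp add: J_diff J_scale t algebra_simps)
qed

lemma nijenhuis_sum_left: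
  assumes "\<And>i. i \<in> I \<Longrightarrow> smooth_fun A W (f i)" "\<And>i. i \<in> I \<Longrightarrow> smooth_vfield A W (E i)"
    "smooth_vfield A W Y" "p \<in> W" "\<And>i. i \<in> I \<Longrightarrow> nijenhuis A J (E i) Y p = 0"
  shows "nijenhuis A J (\<lambda>q. \<Sum>i\<in>I. f i q *\<^sub>R E i q) Y p = 0"
proof -
  note Y = assms(3) and p = assms(4) and o = vfield_open[OF assms(3)]
  define P where "P X \<longleftrightarrow> nijenhuis A J X Y p = 0" for X
  have z: "P (\<lambda>q. 0)"
    unfolding P_def using nijenhuis_add_left[OF vfield_zero[OF o] vfield_zero[OF o] Y p] by simp
  have E: "\<And>i. i \<in> I \<Longrightarrow> P (E i)" using assms(5) by (simp only: P_def)
  have "P (\<lambda>q. \<Sum>i\<in>I. f i q *\<^sub>R E i q)"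
    using assms(1,2) E
  proof (induction I rule: infinite_finite_induct)
    case (insert i I)
    have 1: "smooth_vfield A W (\<lambda>q. \<Sum>i\<in>I. f i q *\<^sub>R E i q)"
      using insert.prems by (intro vfield_sum o vfield_scale) auto
    have 2: "smooth_vfield A W (\<lambda>q. f i q *\<^sub>R E i q)"
      using insert.prems by (intro vfield_scale) auto
    have "P (E i)" "P (\<lambda>q. \<Sum>i\<in>I. f i q *\<^sub>R E i q)" using insert by blast+
    moreover have "nijenhuis A J (\<lambda>q. f i q *\<^sub>R E i q) Y p = f i p *\<^sub>R nijenhuis A J (E i) Y p"
      using nijenhuis_scale_left[of W "f i" "E i", OF _ _ Y p] insert.prems by blast
    ultimately show ?case
      unfolding sum.insert[OF insert.hyps] P_def nijenhuis_add_left[OF 2 1 Y p] by simp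
  qed (simp_all add: z)
  then show ?thesis unfolding P_def .
qed

text \<open>Linearity over functions is available in the first argument; antisymmetry carries it to
  the second. It is enough that the tensor vanishes on frame fields at the single point p.\<close>

lemma nijenhuis_frame:
  assumes f: "\<And>i. i \<in> I \<Longrightarrow> smooth_fun A W (f i)" and g: "\<And>i. i \<in> I \<Longrightarrow> smooth_fun A W (g i)"
    and E: "\<And>i. i \<in> I \<Longrightarrow> smooth_vfield A W (E i)"
    and X: "\<And>q. q \<in> W \<Longrightarrow> X q = (\<Sum>i\<in>I. f i q *\<^sub>R E i q)"
    and Y: "\<And>q. q \<in> W \<Longrightarrow> Y q = (\<Sum>i\<in>I. g i q *\<^sub>R E i q)"
    and N: "\<And>i j. i \<in> I \<Longrightarrow> j \<in> I \<Longrightarrow> nijenhuis A J (E i) (E j) p = 0"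
    and W: "openM W" "p \<in> W"
  shows "nijenhuis A J X Y p = 0"
proof -
  have X': "smooth_vfield A W (\<lambda>q. \<Sum>i\<in>I. f i q *\<^sub>R E i q)" and Y': "smooth_vfield A W (\<lambda>q. \<Sum>i\<in>I. g i q *\<^sub>R E i q)"
    by (intro vfield_sum W vfield_scale f g E; assumption)+
  have "nijenhuis A J (E i) (\<lambda>q. \<Sum>i\<in>I. g i q *\<^sub>R E i q) p = 0" if "i \<in> I" for i
    using nijenhuis_anti[OF Y' E[OF that] W(2)] nijenhuis_sum_left[OF g E E[OF that] W(2) N[OF _ that]]
    by simp
  from nijenhuis_sum_left[OF f E Y' W(2) this]
  have "nijenhuis A J (\<lambda>q. \<Sum>i\<in>I. f i q *\<^sub>R E i q) (\<lambda>q. \<Sum>i\<in>I. g i q *\<^sub>R E i q) p = 0" .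
  then show ?thesis
    using nijenhuis_cong[OF X' Y' W(2), of X Y] X Y by simp
qed

text \<open>As s is constant, replacing X by JX turns J(JX) into sX without a derivative term. Both
  sides then expand to -J[JX,JY] + J^2[JX,Y] + s[X,JY] - sJ[X,Y].\<close>

lemma nijenhuis_J_left:
  assumes J2: "\<And>p v. v \<in> tangent_space A p \<Longrightarrow> J p (J p v) = s *\<^sub>R v"
    and X: "smooth_vfield A W X" and Y: "smooth_vfield A W Y" and p: "p \<in> W"
  shows "nijenhuis A J (\<lambda>q. J q (X q)) Y p = - J p (nijenhuis A J X Y p)"
proof -
  note JX = J_field[OF X] and JY = J_field[OF Y] and o = vfield_open[OF X]
  note t = lie_bracket_tangent[OF _ _ p] J_tangent tangent_scale tangent_diff tangent_add X Y JX JY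
  have s: "smooth_fun A W (\<lambda>q. s)"
    unfolding smooth_fun_iff using o openM_subset smooth_near_const by blast
  have e: "lie_bracket A (\<lambda>q. J q (J q (X q))) Z p = s *\<^sub>R lie_bracket A X Z p"
    if "smooth_vfield A W Z" for Z
    using lie_bracket_cong[OF vfield_scale[OF s X] that p, of "\<lambda>q. J q (J q (X q))" Z]
      lie_bracket_scale_left[OF s X that p] J2[OF vfield_tangent[OF X]] tangent_const[OF vfield_tangent[OF that p]]
    by simp
  show ?thesis
    unfolding nijenhuis_def e[OF Y] e[OF JY]
    by (simp add: J_diff J_add J_scale J2 t)
qed

end

section \<open>The cotangent bundle\<close>

lemma sum_Basis_prod:
  fixes f :: "'b::euclidean_space \<times> 'c::euclidean_space \<Rightarrow> 'd::comm_monoid_add"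
  shows "sum f Basis = (\<Sum>i\<in>Basis. f (i, 0)) + (\<Sum>i\<in>Basis. f (0, i))"
proof -
  have "inj_on (\<lambda>u. (u::'b, 0::'c)) Basis" "inj_on (\<lambda>u. (0::'b, u::'c)) Basis"
    by (auto intro!: inj_onI)
  then show ?thesis
    unfolding Basis_prod_def by (subst sum.union_disjoint) (auto simp: sum.reindex)
qed

lemma smooth_on_sum:
  "open S \<Longrightarrow> (\<And>i. i \<in> I \<Longrightarrow> smooth_on S (f i)) \<Longrightarrow> smooth_on S (\<lambda>x. \<Sum>i\<in>I. f i x)"
  by (simp add: smooth_on_def Ck_on_sum)

lemma smooth_on_compose_fst:
  fixes f :: "'d::euclidean_space \<Rightarrow> real"
  assumes "open S" "smooth_on S f"
  shows "smooth_on (S \<times> (UNIV :: 'e::euclidean_space set)) (\<lambda>z. f (fst z))"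
proof -
  have o: "open (S \<times> (UNIV :: 'e set))" using assms by (simp add: open_Times)
  show ?thesis
    by (rule smooth_on_compose[OF o assms(1) _ smooth_on_linear[OF o bounded_linear_fst] assms(2)]) auto
qed

context smooth_atlas
begin

section \<open>Covectors in coordinates\<close>

lemma cotangent_add: "\<alpha> \<in> cotangent_space A p \<Longrightarrow> v \<in> tangent_space A p \<Longrightarrow> w \<in> tangent_space A p \<Longrightarrow>
    \<alpha> (v + w) = \<alpha> v + \<alpha> w"
  by (simp add: cotangent_space_def linear_on_def)

lemma cotangent_scale: "\<alpha> \<in> cotangent_space A p \<Longrightarrow> v \<in> tangent_space A p \<Longrightarrow> \<alpha> (r *\<^sub>R v) = r * \<alpha> v"
  by (simp add: cotangent_space_def linear_on_def)

lemma cotangent_outside: "\<alpha> \<in> cotangent_space A p \<Longrightarrow> v \<notin> tangent_space A p \<Longrightarrow> \<alpha> v = 0"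
  by (simp add: cotangent_space_def)

lemma cotangent_sum:
  assumes "\<alpha> \<in> cotangent_space A p" "p \<in> points A" "\<And>i. i \<in> I \<Longrightarrow> v i \<in> tangent_space A p"
  shows "\<alpha> (\<Sum>i\<in>I. v i) = (\<Sum>i\<in>I. \<alpha> (v i))"
proof -
  have z: "\<alpha> 0 = 0"
    using cotangent_scale[OF assms(1), of 0 0] subspace_0[OF subspace_tangent_space[OF assms(2)]] by simp
  show ?thesis using assms(3)
    by (induction I rule: infinite_finite_induct)
      (auto simp: z cotangent_add[OF assms(1)] tangent_sum[OF assms(2)])
qed

lemma cotangent_expand:
  assumes "\<alpha> \<in> cotangent_space A p" "c \<in> A" "p \<in> cdom c" "v \<in> tangent_space A p"
  shows "\<alpha> v = (\<Sum>i\<in>Basis. v (coord c i) * \<alpha> (coord_vec A c p i))"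
proof -
  have t: "coord_vec A c p i \<in> tangent_space A p" for i using assms by blast
  have "\<alpha> (\<Sum>i\<in>Basis. v (coord c i) *\<^sub>R coord_vec A c p i) = (\<Sum>i\<in>Basis. v (coord c i) * \<alpha> (coord_vec A c p i))"
    by (subst cotangent_sum[OF assms(1) pointsI[OF assms(2,3)]])
      (auto intro: tangent_scale t simp: cotangent_scale[OF assms(1) t])
  then show ?thesis using tangent_expand[OF assms(2-4)] by simp
qed

lemma cotangent_eqI:
  assumes "c \<in> A" "p \<in> cdom c" "\<alpha> \<in> cotangent_space A p" "\<beta> \<in> cotangent_space A p"
    "\<And>i. i \<in> Basis \<Longrightarrow> \<alpha> (coord_vec A c p i) = \<beta> (coord_vec A c p i)"
  shows "\<alpha> = \<beta>"
proof
  fix v show "\<alpha> v = \<beta> v"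
  proof (cases "v \<in> tangent_space A p")
    case True
    show ?thesis
      unfolding cotangent_expand[OF assms(3,1,2) True] cotangent_expand[OF assms(4,1,2) True]
      by (intro sum.cong refl) (simp add: assms(5))
  qed (simp add: cotangent_outside[OF assms(3)] cotangent_outside[OF assms(4)])
qed

text \<open>The covector y_i dx^i at p, that is, the inverse of the fibre coordinates of
  \<open>cotangent_chart\<close>. The value 0 outside of the tangent space is the normalisation of
  \<open>cotangent_space\<close>.\<close>

definition covec_of :: "('a, 'e) chart \<Rightarrow> 'a \<Rightarrow> 'e \<Rightarrow> 'a covec"
  where "covec_of c p y = (\<lambda>v. if v \<in> tangent_space A p then \<Sum>i\<in>Basis. v (coord c i) * (y \<bullet> i) else 0)"

lemma covec_of_cotangent: "p \<in> points A \<Longrightarrow> covec_of c p y \<in> cotangent_space A p"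
  unfolding cotangent_space_def linear_on_def covec_of_def
  by (auto simp: tangent_add tangent_scale algebra_simps sum.distrib sum_distrib_left)

lemma covec_of_coord_vec:
  assumes "c \<in> A" "p \<in> cdom c"
  shows "covec_of c p y (coord_vec A c p u) = u \<bullet> y"
  using assms by (auto simp: covec_of_def coord_vec_coord euclidean_inner[of u y])

lemma subspace_cotangent_space: "subspace (cotangent_space A p)"
  by (rule subspaceI) (auto simp: cotangent_space_def linear_on_def algebra_simps)

section \<open>Induced charts and their transition maps\<close>

lemma cotangent_chart_dom: "a \<in> cdom (cotangent_chart A c) \<longleftrightarrow> fst a \<in> cdom c \<and> snd a \<in> cotangent_space A (fst a)"
  by (auto simp: cotangent_chart_def)

lemma cotangent_chart_map:
  "cmap (cotangent_chart A c) a = (cmap c (fst a), \<Sum>i\<in>Basis. snd a (coord_vec A c (fst a) i) *\<^sub>R i)"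
  by (simp add: cotangent_chart_def split: prod.splits)

lemma cotangent_chart_image:
  assumes "c \<in> A"
  shows "cmap (cotangent_chart A c) ` {a \<in> cdom (cotangent_chart A c). fst a \<in> W} = cmap c ` (cdom c \<inter> W) \<times> UNIV"
proof (intro equalityI subsetI)
  fix z assume "z \<in> cmap c ` (cdom c \<inter> W) \<times> (UNIV :: 'e set)"
  then obtain p y where p: "p \<in> cdom c" "p \<in> W" "z = (cmap c p, y)" by auto
  have "z = cmap (cotangent_chart A c) (p, covec_of c p y)"
    by (simp add: cotangent_chart_map p covec_of_coord_vec[OF assms p(1)] inner_commute[of _ y] euclidean_representation)
  moreover have "(p, covec_of c p y) \<in> {a \<in> cdom (cotangent_chart A c). fst a \<in> W}"
    using p covec_of_cotangent[OF pointsI[OF assms p(1)]] by (simp add: cotangent_chart_dom)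
  ultimately show "z \<in> cmap (cotangent_chart A c) ` {a \<in> cdom (cotangent_chart A c). fst a \<in> W}" by (rule image_eqI)
qed (auto simp: cotangent_chart_dom cotangent_chart_map)

lemma inj_cotangent_chart:
  assumes "c \<in> A"
  shows "inj_on (cmap (cotangent_chart A c)) (cdom (cotangent_chart A c))"
proof (rule inj_onI)
  fix a b assume a: "a \<in> cdom (cotangent_chart A c)" and b: "b \<in> cdom (cotangent_chart A c)"
    and eq: "cmap (cotangent_chart A c) a = cmap (cotangent_chart A c) b"
  have "cmap c (fst a) = cmap c (fst b)"
    and y: "(\<Sum>i\<in>Basis. snd a (coord_vec A c (fst a) i) *\<^sub>R i) = (\<Sum>i\<in>Basis. snd b (coord_vec A c (fst b) i) *\<^sub>R i)"
    using eq by (simp_all add: cotangent_chart_map)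
  then have p: "fst a = fst b"
    using chart_inj[OF assms] a b by (simp add: cotangent_chart_dom inj_on_def)
  have "snd a (coord_vec A c (fst a) i) = snd b (coord_vec A c (fst a) i)" if "i \<in> Basis" for i
    using arg_cong[OF y, of "\<lambda>z. z \<bullet> i"] that p by simp
  then have "snd a = snd b"
    using a b p assms by (intro cotangent_eqI[of c "fst a"]) (auto simp: cotangent_chart_dom)
  then show "a = b" using p by (simp add: prod_eq_iff)
qed

lemma cinv_cotangent_chart:
  assumes "c \<in> A" "p \<in> cdom c"
  shows "cinv (cotangent_chart A c) (cmap c p, y) = (p, covec_of c p y)"
proof -
  have "(cmap c p, y) = cmap (cotangent_chart A c) (p, covec_of c p y)"
    by (simp add: cotangent_chart_map covec_of_coord_vec[OF assms] inner_commute[of _ y] euclidean_representation)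
  moreover have "(p, covec_of c p y) \<in> cdom (cotangent_chart A c)"
    using assms covec_of_cotangent[OF pointsI[OF assms]] by (simp add: cotangent_chart_dom)
  ultimately show ?thesis
    by (simp add: cinv_def inj_cotangent_chart[OF assms(1)])
qed

text \<open>The transition map acts on the base by the transition map of M and on the fibre by y'_j
  = y_i dx^i/dx'^j: linear in y, with coefficients that are smooth in the base point.\<close>

lemma smooth_atlas_cotangent: "smooth_atlas (cotangent_atlas A)"
proof
  fix C assume "C \<in> cotangent_atlas A"
  then obtain c where c: "c \<in> A" "C = cotangent_chart A c" by (auto simp: cotangent_atlas_def)
  show "inj_on (cmap C) (cdom C)" unfolding c(2) by (rule inj_cotangent_chart[OF c(1)])
  have overlap: "cdom C \<inter> cdom (cotangent_chart A d) = {a \<in> cdom C. fst a \<in> cdom d}" for d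
    by (auto simp: c cotangent_chart_dom)
  have im: "cmap C ` (cdom C \<inter> cdom (cotangent_chart A d)) = cmap c ` (cdom c \<inter> cdom d) \<times> UNIV" for d
    unfolding overlap unfolding c(2) by (rule cotangent_chart_image[OF c(1)])
  have "cmap C ` cdom C = cmap c ` cdom c \<times> UNIV"
    using im[of c] by (simp add: c(2))
  then show "open (cmap C ` cdom C)" using chart_image_open[OF c(1)] by (simp add: open_Times)
  fix D assume "D \<in> cotangent_atlas A"
  then obtain d where d: "d \<in> A" "D = cotangent_chart A d" by (auto simp: cotangent_atlas_def)
  let ?S = "cmap c ` (cdom c \<inter> cdom d)"
  have oS: "open ?S" by (rule chart_overlap_open[OF c(1) d(1)])
  then have oSU: "open (?S \<times> (UNIV :: 'e set))" by (simp add: open_Times)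
  then show "open (cmap C ` (cdom C \<inter> cdom D))" unfolding d(2) im .
  have "smooth_on (?S \<times> UNIV) (cmap D \<circ> cinv C)"
  proof (rule smooth_on_componentwise[OF oSU])
    fix b :: "'e \<times> 'e" assume "b \<in> Basis"
    then consider i where "i \<in> Basis" "b = (i, 0)" | j where "j \<in> Basis" "b = (0, j)"
      by (auto simp: Basis_prod_def)
    then show "smooth_on (?S \<times> UNIV) (\<lambda>z. (cmap D \<circ> cinv C) z \<bullet> b)"
    proof cases
      case 1
      have "smooth_on ?S (\<lambda>x. (cmap d \<circ> cinv c) x \<bullet> i)"
        by (rule smooth_on_bounded_linear[OF oS bounded_linear_inner_left transition_smooth[OF c(1) d(1)]])
      from smooth_on_compose_fst[OF oS this] show ?thesis
        by (rule smooth_on_cong[OF oSU, rotated])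
          (auto simp: 1 c d cinv_cotangent_chart cotangent_chart_map)
    next
      case 2
      \<comment> \<open>The coefficient dx^i/dx'^j is the coordinate field of d applied to a
        coordinate of c, hence smooth on the overlap.\<close>
      have "smooth_fun A (cdom c \<inter> cdom d) (\<lambda>q. coord_vec A d q j (coord c i))" for i
        unfolding smooth_fun_iff
        using openM_cdom[OF c(1)] openM_cdom[OF d(1)] c(1) d(1)
        by (auto intro: smooth_near_coord_vec smooth_near_coord)
      then have g: "smooth_on ?S ((\<lambda>q. coord_vec A d q j (coord c i)) \<circ> cinv c)" for i
        using c(1) unfolding smooth_fun_def by (metis Int_left_absorb)
      have "smooth_on (?S \<times> UNIV) (\<lambda>z. (0::'e, i) \<bullet> z)" for i :: 'e
        by (rule smooth_on_linear[OF oSU bounded_linear_inner_right])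
      then have y: "smooth_on (?S \<times> UNIV) (\<lambda>z. i \<bullet> snd z)" for i :: 'e
        by (simp add: inner_prod_def)
      have "smooth_on (?S \<times> UNIV) (\<lambda>z. \<Sum>i\<in>Basis. ((\<lambda>q. coord_vec A d q j (coord c i)) \<circ> cinv c) (fst z) * (i \<bullet> snd z))"
        by (intro smooth_on_sum[OF oSU] smooth_on_mult[OF oSU smooth_on_compose_fst[OF oS g] y])
      then show ?thesis
      proof (rule smooth_on_cong[OF oSU, rotated])
        fix z assume "z \<in> ?S \<times> (UNIV :: 'e set)"
        then obtain p y where z: "z = (cmap c p, y)" and p: "p \<in> cdom c" "p \<in> cdom d" by auto
        have "covec_of c p y (coord_vec A d p j) = (\<Sum>i\<in>Basis. coord_vec A d p j (coord c i) * (y \<bullet> i))"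
          using p d by (auto simp: covec_of_def)
        then show "(\<Sum>i\<in>Basis. ((\<lambda>q. coord_vec A d q j (coord c i)) \<circ> cinv c) (fst z) * (i \<bullet> snd z)) =
           (cmap D \<circ> cinv C) z \<bullet> b"
          using p c(1) d(1) 2(1) unfolding c(2) d(2) 2(2) z
          by (simp add: cinv_cotangent_chart cotangent_chart_map inner_commute[of y])
      qed
    qed
  qed
  then show "smooth_on (cmap C ` (cdom C \<inter> cdom D)) (cmap D \<circ> cinv C)" unfolding d(2) im .
qed

end

section \<open>Tangent vectors of T*M and the functions that determine them\<close>

text \<open>The prefix N will carry the theory of \<open>smooth_atlas\<close> over to T*M. A locale
  of its own keeps this to one step instead of iterating to the cotangent bundle of T*M.\<close>

locale cotangent_bundle = smooth_atlas A for A :: "('a, 'e::euclidean_space) chart set"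

sublocale cotangent_bundle \<subseteq> N: smooth_atlas "cotangent_atlas A"
  by (rule smooth_atlas_cotangent)

context cotangent_bundle
begin

abbreviation "TM \<equiv> tangent_space A"
abbreviation "T'M \<equiv> cotangent_space A"
abbreviation "TN \<equiv> tangent_space (cotangent_atlas A)"
abbreviation "PN \<equiv> points (cotangent_atlas A)"
abbreviation "CC \<equiv> cotangent_chart A"

abbreviation over :: "'a set \<Rightarrow> 'a cotangent set"
  where "over W \<equiv> {a \<in> PN. fst a \<in> W}"

abbreviation pull :: "('a \<Rightarrow> real) \<Rightarrow> 'a cotangent \<Rightarrow> real"
  where "pull f \<equiv> \<lambda>a. f (fst a)"

abbreviation iota :: "'a vfield \<Rightarrow> 'a cotangent \<Rightarrow> real"
  where "iota Y \<equiv> \<lambda>a. snd a (Y (fst a))"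

lemma PN_iff: "a \<in> PN \<longleftrightarrow> fst a \<in> points A \<and> snd a \<in> T'M (fst a)"
  by (auto simp: points_def cotangent_atlas_def cotangent_chart_dom)

lemma CC_atlas [simp]: "c \<in> A \<Longrightarrow> CC c \<in> cotangent_atlas A"
  by (simp add: cotangent_atlas_def)

lemma CC_dom [simp]: "a \<in> PN \<Longrightarrow> fst a \<in> cdom c \<Longrightarrow> a \<in> cdom (CC c)"
  by (simp add: PN_iff cotangent_chart_dom)

lemma PN_chartE:
  assumes "a \<in> PN"
  obtains c where "c \<in> A" "fst a \<in> cdom c"
  using assms unfolding PN_iff by (meson pointsE)

lemma open_over:
  assumes "openM W"
  shows "N.openM (over W)"
  unfolding N.openM_iff
proof (intro conjI ballI)
  fix C assume "C \<in> cotangent_atlas A"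
  then obtain c where c: "c \<in> A" "C = CC c" by (auto simp: cotangent_atlas_def)
  have "cdom C \<inter> over W = {a \<in> cdom C. fst a \<in> W}"
    using c(2) pointsI[OF c(1)] by (auto simp: PN_iff cotangent_chart_dom)
  then have "cmap C ` (cdom C \<inter> over W) = cmap c ` (cdom c \<inter> W) \<times> UNIV"
    using cotangent_chart_image[OF c(1)] c(2) by simp
  then show "open (cmap C ` (cdom C \<inter> over W))"
    using openM_image[OF assms c(1)] by (simp add: open_Times)
qed auto

lemma CC_coord_fst: "N.coord (CC c) (u, 0) = pull (coord c u)"
  by (simp add: cotangent_chart_map)

lemma CC_coord_snd: "i \<in> Basis \<Longrightarrow> N.coord (CC c) (0, i) = iota (\<lambda>p. coord_vec A c p i)"
  by (simp add: cotangent_chart_map)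

lemma pull_chart:
  assumes "c \<in> A" "z \<in> (cmap c ` cdom c) \<times> UNIV"
  shows "(pull f \<circ> cinv (CC c)) z = (f \<circ> cinv c) (fst z)"
  using assms by (auto simp: cinv_cotangent_chart)

lemma smooth_near_pull:
  assumes "smooth_near A (fst a) f" "a \<in> PN"
  shows "smooth_near (cotangent_atlas A) a (pull f)"
proof -
  obtain c where c: "c \<in> A" "fst a \<in> cdom c" using assms(2) by (rule PN_chartE)
  obtain U where U: "open U" "cmap c (fst a) \<in> U" "U \<subseteq> cmap c ` cdom c" "smooth_on U (f \<circ> cinv c)"
    using smooth_near_chartD[OF assms(1) c] .
  have o: "open (U \<times> (UNIV :: 'e set))" using U by (simp add: open_Times)
  show ?thesis
  proof (rule N.smooth_near_chartI[of "CC c"])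
    show "smooth_on (U \<times> UNIV) (pull f \<circ> cinv (CC c))"
      by (rule smooth_on_cong[OF o _ smooth_on_compose_fst[OF U(1,4)]], rule pull_chart[OF c(1), symmetric])
        (use U(3) in auto)
  qed (use c assms(2) U o in \<open>auto simp: cotangent_chart_map\<close>)
qed

text \<open>In an induced chart the function is Y^i(x) y_i, a sum of products of pullbacks and fibre
  coordinates.\<close>

lemma smooth_near_iota:
  assumes Y: "smooth_vfield A W Y" and a: "a \<in> over W"
  shows "smooth_near (cotangent_atlas A) a (iota Y)"
proof -
  obtain c where c: "c \<in> A" "fst a \<in> cdom c" using a PN_chartE by blast
  have o: "N.openM (over (W \<inter> cdom c))" using open_over vfield_open[OF Y] openM_cdom[OF c(1)] by blast
  have "smooth_near (cotangent_atlas A) a (\<lambda>b. \<Sum>i\<in>Basis. pull (\<lambda>q. Y q (coord c i)) b * iota (\<lambda>p. coord_vec A c p i) b)"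
  proof (intro N.smooth_near_sum N.smooth_near_mult)
    fix i :: 'e assume i: "i \<in> Basis"
    show "smooth_near (cotangent_atlas A) a (pull (\<lambda>q. Y q (coord c i)))"
      using a c by (intro smooth_near_pull vfield_comp_smooth[OF Y c(1)]) auto
    show "smooth_near (cotangent_atlas A) a (iota (\<lambda>p. coord_vec A c p i))"
      using N.smooth_near_coord[of "CC c" a "(0, i)"] a c unfolding CC_coord_snd[OF i] by simp
  qed (use a in auto)
  then show ?thesis
  proof (rule N.smooth_near_cong[OF o, rotated 2])
    fix b assume b: "b \<in> over (W \<inter> cdom c)"
    then have "snd b \<in> T'M (fst b)" by (simp add: PN_iff)
    then show "(\<Sum>i\<in>Basis. pull (\<lambda>q. Y q (coord c i)) b * iota (\<lambda>p. coord_vec A c p i) b) = iota Y b"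
      using cotangent_expand[OF _ c(1) _ vfield_tangent[OF Y], of "snd b" "fst b"] b by simp
  qed (use a c in auto)
qed

text \<open>The test functions are exactly the coordinates of the induced chart. Lifts and brackets
  on T*M are compared through them.\<close>

lemma TN_eqI:
  assumes "a \<in> PN" "c \<in> A" "fst a \<in> cdom c" "\<xi> \<in> TN a" "\<eta> \<in> TN a"
    and "\<And>i. i \<in> Basis \<Longrightarrow> \<xi> (pull (coord c i)) = \<eta> (pull (coord c i))"
    and "\<And>i. i \<in> Basis \<Longrightarrow> \<xi> (iota (\<lambda>p. coord_vec A c p i)) = \<eta> (iota (\<lambda>p. coord_vec A c p i))"
  shows "\<xi> = \<eta>"
proof (rule N.tangent_eqI[of "CC c" a, OF _ _ assms(4,5)])
  fix b :: "'e \<times> 'e" assume "b \<in> Basis"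
  then consider i where "i \<in> Basis" "b = (i, 0)" | j where "j \<in> Basis" "b = (0, j)"
    by (auto simp: Basis_prod_def)
  then show "\<xi> (N.coord (CC c) b) = \<eta> (N.coord (CC c) b)"
    by cases (simp_all only: CC_coord_fst CC_coord_snd assms(6,7))
qed (use assms in auto)

lemma coord_vec_pull:
  assumes a: "a \<in> PN" and c: "c \<in> A" "fst a \<in> cdom c" and f: "smooth_near A (fst a) f"
  shows "coord_vec (cotangent_atlas A) (CC c) a (u, w) (pull f) = coord_vec A c (fst a) u f"
proof -
  let ?S = "(cmap c ` cdom c) \<times> (UNIV :: 'e set)"
  have o: "open ?S" using chart_image_open[OF c(1)] by (simp add: open_Times)
  have "((f \<circ> cinv c) has_derivative frechet_derivative (f \<circ> cinv c) (at (cmap c (fst a)))) (at (fst (cmap (CC c) a)))"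
    using chart_has_derivative[OF f c] by (simp add: cotangent_chart_map)
  from has_derivative_compose[OF bounded_linear_imp_has_derivative[OF bounded_linear_fst] this]
  have "((pull f \<circ> cinv (CC c)) has_derivative (\<lambda>v. frechet_derivative (f \<circ> cinv c) (at (cmap c (fst a))) (fst v))) (at (cmap (CC c) a))"
    by (rule has_derivative_transform_within_open[OF _ o])
      (use c pull_chart[OF c(1), symmetric] in \<open>auto simp: cotangent_chart_map\<close>)
  from fun_cong[OF frechet_derivative_at[OF this], of "(u, w)"] show ?thesis
    by (simp add: N.coord_vec_eq smooth_near_pull[OF f a] coord_vec_eq f)
qed

lemma TN_pull:
  assumes a: "a \<in> PN" and c: "c \<in> A" "fst a \<in> cdom c" and f: "smooth_near A (fst a) f" and \<xi>: "\<xi> \<in> TN a"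
  shows "\<xi> (pull f) = (\<Sum>i\<in>Basis. \<xi> (pull (coord c i)) * coord_vec A c (fst a) i f)"
proof -
  have z: "coord_vec A c (fst a) 0 f = 0" using linear_0[OF linear_coord_vec[OF c]] by simp
  show ?thesis
    using N.tangent_expand_apply[of "CC c" a \<xi> "pull f"] a c \<xi>
    by (simp add: sum_Basis_prod coord_vec_pull f z CC_coord_fst)
qed

text \<open>Leibniz rule for Y^i y_i. It expresses the value on an arbitrary fibrewise linear
  function by values on pullbacks and on the fibre coordinates.\<close>

lemma TN_iota:
  assumes a: "a \<in> PN" and c: "c \<in> A" "fst a \<in> cdom c" and Y: "smooth_vfield A W Y" "fst a \<in> W" and \<xi>: "\<xi> \<in> TN a"
  shows "\<xi> (iota Y) = (\<Sum>i\<in>Basis. \<xi> (pull (\<lambda>q. Y q (coord c i))) * snd a (coord_vec A c (fst a) i) +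
      Y (fst a) (coord c i) * \<xi> (iota (\<lambda>p. coord_vec A c p i)))"
proof -
  have o: "N.openM (over (W \<inter> cdom c))" using open_over vfield_open[OF Y(1)] openM_cdom[OF c(1)] by blast
  have 1: "smooth_near (cotangent_atlas A) a (pull (\<lambda>q. Y q (coord c i)))" for i
    using a c Y(2) by (intro smooth_near_pull vfield_comp_smooth[OF Y(1) c(1)]) auto
  have 2: "smooth_near (cotangent_atlas A) a (iota (\<lambda>p. coord_vec A c p i))" for i
    using a c by (intro smooth_near_iota[OF vfield_coord_vec[OF c(1)]]) auto
  have "\<xi> (iota Y) = \<xi> (\<lambda>b. \<Sum>i\<in>Basis. pull (\<lambda>q. Y q (coord c i)) b * iota (\<lambda>p. coord_vec A c p i) b)"
  proof (rule N.tangent_cong[OF \<xi> o])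
    fix b assume b: "b \<in> over (W \<inter> cdom c)"
    then have "snd b \<in> T'M (fst b)" by (simp add: PN_iff)
    then show "iota Y b = (\<Sum>i\<in>Basis. pull (\<lambda>q. Y q (coord c i)) b * iota (\<lambda>p. coord_vec A c p i) b)"
      using cotangent_expand[OF _ c(1) _ vfield_tangent[OF Y(1)], of "snd b" "fst b"] b by simp
  qed (use a c Y in auto)
  also have "\<dots> = (\<Sum>i\<in>Basis. \<xi> (\<lambda>b. pull (\<lambda>q. Y q (coord c i)) b * iota (\<lambda>p. coord_vec A c p i) b))"
    by (rule N.tangent_sum_fun[OF \<xi>]) (intro N.smooth_near_mult 1 2)
  also have "\<dots> = (\<Sum>i\<in>Basis. \<xi> (pull (\<lambda>q. Y q (coord c i))) * snd a (coord_vec A c (fst a) i) +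
      Y (fst a) (coord c i) * \<xi> (iota (\<lambda>p. coord_vec A c p i)))"
    by (intro sum.cong refl) (simp add: N.tangent_mult[OF \<xi> 1 2])
  finally show ?thesis .
qed

section \<open>The topology of T*M\<close>

text \<open>Points over different base points are separated by preimages of open sets of M; points
  of the same fibre lie in one induced chart and are separated in its image.\<close>

lemma Hausdorff_cotangent:
  assumes "Hausdorff_space (manifold_topology A)"
  shows "Hausdorff_space (manifold_topology (cotangent_atlas A))"
  unfolding Hausdorff_space_def N.topspace_manifold
proof (intro allI impI)
  fix a b assume ab: "a \<in> PN \<and> b \<in> PN \<and> a \<noteq> b"
  show "\<exists>U V. N.openM U \<and> N.openM V \<and> a \<in> U \<and> b \<in> V \<and> disjnt U V"
  proof (cases "fst a = fst b")
    case True
    obtain c where c: "c \<in> A" "fst a \<in> cdom c" using ab PN_chartE by blast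
    have ca: "a \<in> cdom (CC c)" and cb: "b \<in> cdom (CC c)" using ab c True by (simp_all add: CC_dom)
    have "cmap (CC c) a \<noteq> cmap (CC c) b"
      using inj_cotangent_chart[OF c(1)] ca cb ab by (meson inj_onD)
    from hausdorff[OF this] obtain U V where U: "open U" "cmap (CC c) a \<in> U"
      and V: "open V" "cmap (CC c) b \<in> V" and UV: "U \<inter> V = {}" by (elim exE conjE)
    let ?P = "\<lambda>U. {q \<in> cdom (CC c). cmap (CC c) q \<in> U}"
    have "N.openM (?P U)" "N.openM (?P V)"
      by (intro N.openM_chart_preimage CC_atlas c(1) U(1) V(1))+
    moreover have "a \<in> ?P U" "b \<in> ?P V" using ca cb U V by blast+
    moreover have "disjnt (?P U) (?P V)" using UV by (auto simp: disjnt_def)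
    ultimately show ?thesis by blast
  next
    case False
    have "fst a \<in> points A" "fst b \<in> points A" using ab by (simp_all add: PN_iff)
    then obtain U V where "openM U" "openM V" "fst a \<in> U" "fst b \<in> V" "disjnt U V"
      using assms False unfolding Hausdorff_space_def topspace_manifold by blast
    moreover have "disjnt (over U) (over V)" using \<open>disjnt U V\<close> by (auto simp: disjnt_def)
    ultimately show ?thesis
      using ab by (intro exI[of _ "over U"] exI[of _ "over V"] conjI open_over) auto
  qed
qed

text \<open>M is a Lindelof space, so countably many charts cover it. The preimages of a countable
  base of the model space under the corresponding induced charts form a countable base of
  T*M.\<close>

lemma second_countable_cotangent:
  assumes "second_countable (manifold_topology A)"
  shows "second_countable (manifold_topology (cotangent_atlas A))"
proof -
  have "\<exists>\<V>. countable \<V> \<and> \<V> \<subseteq> cdom ` A \<and> \<Union>\<V> = points A"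
    using second_countable_imp_Lindelof_space[OF assms] openM_cdom
    unfolding Lindelof_space_def topspace_manifold by (simp add: points_def)
  then obtain A0 where A0: "countable A0" "A0 \<subseteq> A" "\<Union>(cdom ` A0) = points A"
    by (metis countable_subset_image)
  obtain B :: "('e \<times> 'e) set set" where B: "countable B" "\<And>S. S \<in> B \<Longrightarrow> open S"
    and Bu: "\<And>S. open S \<Longrightarrow> \<exists>U. U \<subseteq> B \<and> S = \<Union>U"
    using univ_second_countable by blast
  define pre where "pre = (\<lambda>(c, U). {a \<in> cdom (CC c). cmap (CC c) a \<in> U})"
  show ?thesis unfolding second_countable_def
  proof (intro exI[of _ "pre ` (A0 \<times> B)"] conjI ballI allI impI)
    show "countable (pre ` (A0 \<times> B))" using A0 B by simp
    show "N.openM V" if "V \<in> pre ` (A0 \<times> B)" for V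
    proof -
      obtain c U where V: "V = {a \<in> cdom (CC c). cmap (CC c) a \<in> U}" "c \<in> A0" "U \<in> B"
        using \<open>V \<in> _\<close> by (auto simp: pre_def)
      show ?thesis unfolding V(1) using V A0 B by (intro N.openM_chart_preimage) auto
    qed
    fix W a assume W: "N.openM W \<and> a \<in> W"
    then have a: "a \<in> PN" using N.openM_subset by blast
    then obtain c where c: "c \<in> A0" "fst a \<in> cdom c" using A0(3) unfolding PN_iff by blast
    then have cA: "c \<in> A" using A0 by blast
    have ca: "a \<in> cdom (CC c)" using a c by simp
    have "open (cmap (CC c) ` (cdom (CC c) \<inter> W))" using W cA by (intro N.openM_image) auto
    then obtain U where "U \<subseteq> B" "cmap (CC c) ` (cdom (CC c) \<inter> W) = \<Union>U" using Bu by blast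
    then obtain S where S: "S \<in> B" "cmap (CC c) a \<in> S" "S \<subseteq> cmap (CC c) ` (cdom (CC c) \<inter> W)"
      using ca W by blast
    have "pre (c, S) \<subseteq> W"
      using S(3) inj_cotangent_chart[OF cA] by (auto simp: pre_def inj_on_def)
    then show "\<exists>V\<in>pre ` (A0 \<times> B). a \<in> V \<and> V \<subseteq> W"
      using S c ca by (intro bexI[of _ "pre (c, S)"]) (auto simp: pre_def)
  qed
qed

lemma smooth_manifold_cotangent: "smooth_manifold A \<Longrightarrow> smooth_manifold (cotangent_atlas A)"
  unfolding smooth_manifold_iff
  using smooth_atlas_cotangent Hausdorff_cotangent second_countable_cotangent by blast

end

section \<open>Horizontal and vertical lifts\<close>

text \<open>K may be arbitrary outside of V. It is replaced by the linear map g that agrees with it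
  on a basis of V and hence on V, so that the theory of linear maps applies.\<close>

lemma dim_eq_if_linear_on_bij:
  fixes V :: "'v::real_vector set" and U :: "'w::real_vector set"
  assumes V: "subspace V" and lin: "linear_on V K" and bij: "bij_betw K V U"
  shows "dim V = dim U"
proof -
  obtain B where B: "B \<subseteq> V" "independent B" "V \<subseteq> span B" "card B = dim V"
    using basis_exists[of V] .
  obtain g where g: "linear g" "\<forall>x\<in>B. g x = K x"
    using linear_independent_extend[OF B(2)] by blast
  have sp: "span B = V" using B V by (meson span_minimal subset_antisym)
  have "x \<in> V \<and> g x = K x" if "x \<in> span B" for x
    using that
  proof (induction rule: span_induct_alt)
    case base
    have "K (0 *\<^sub>R 0) = 0 *\<^sub>R K 0" using lin subspace_0[OF V] unfolding linear_on_def by blast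
    then show ?case by (simp add: linear_0[OF g(1)] subspace_0[OF V])
  next
    case (step r x y)
    have x: "x \<in> V" "r *\<^sub>R x \<in> V" "y \<in> V" using step B(1) V by (auto intro: subspace_scale)
    then have "K (r *\<^sub>R x + y) = r *\<^sub>R K x + K y" using lin unfolding linear_on_def by metis
    then show ?case using g(2) step x V by (simp add: linear_add[OF g(1)] linear_scale[OF g(1)] subspace_add)
  qed
  then have gK: "\<And>x. x \<in> span B \<Longrightarrow> g x = K x" by blast
  have U: "U = g ` span B" using bij gK sp unfolding bij_betw_def by (metis image_cong)
  have "inj_on K (span B)" using bij sp by (simp add: bij_betw_def)
  then have inj: "inj_on g (span B)" using gK by (simp add: inj_on_def)
  have "independent (g ` B)" by (rule real_vector.linear_independent_injective_image[OF g(1) B(2) inj])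
  moreover have "span (g ` B) = span U"
    unfolding U real_vector.linear_span_image[OF g(1), symmetric] by (simp add: span_span)
  ultimately have "dim U = card (g ` B)" by (metis dim_eq_card)
  also have "\<dots> = card B" using inj span_superset by (metis card_image inj_on_subset)
  finally show ?thesis using B by simp
qed

lemma sum_mult_inner_Basis:
  fixes f :: "'e::euclidean_space \<Rightarrow> real"
  assumes "k \<in> Basis"
  shows "(\<Sum>i\<in>Basis. f i * (i \<bullet> k)) = f k"
  using assms by (simp add: inner_Basis if_distrib cong: if_cong)

section \<open>Connections in a chart\<close>

locale connection_bundle = cotangent_bundle A for A :: "('a, 'e::euclidean_space) chart set" +
  fixes nabla :: "'a connection"
  assumes connection: "affine_connection A nabla"
begin

abbreviation "HL \<equiv> horizontal_lift A nabla"
abbreviation "VL \<equiv> vertical_lift A"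
abbreviation "PP \<equiv> Phi A nabla"

abbreviation dd :: "('a, 'e) chart \<Rightarrow> 'e \<Rightarrow> 'a vfield"
  where "dd c i \<equiv> \<lambda>q. coord_vec A c q i"

lemma nabla_vfield:
  "smooth_vfield A W X \<Longrightarrow> smooth_vfield A W Y \<Longrightarrow> smooth_vfield A W (nabla X Y)"
  by (rule connection[unfolded affine_connection_def, THEN conjunct1, rule_format, OF conjI])

lemma nabla_add_left:
  assumes "smooth_vfield A W X" "smooth_vfield A W X'" "smooth_vfield A W Y" "p \<in> W"
  shows "nabla (\<lambda>q. X q + X' q) Y p = nabla X Y p + nabla X' Y p"
  by (rule connection[unfolded affine_connection_def, THEN conjunct2, THEN conjunct1, rule_format, of W]) (intro conjI assms; assumption?)+

lemma nabla_scale_left: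
  assumes "smooth_fun A W f" "smooth_vfield A W X" "smooth_vfield A W Y" "p \<in> W"
  shows "nabla (\<lambda>q. f q *\<^sub>R X q) Y p = f p *\<^sub>R nabla X Y p"
  by (rule connection[unfolded affine_connection_def, THEN conjunct2, THEN conjunct2, THEN conjunct1, rule_format, of W]) (intro conjI assms; assumption?)+

lemma nabla_add_right:
  assumes "smooth_vfield A W X" "smooth_vfield A W Y" "smooth_vfield A W Y'" "p \<in> W"
  shows "nabla X (\<lambda>q. Y q + Y' q) p = nabla X Y p + nabla X Y' p"
  by (rule connection[unfolded affine_connection_def, THEN conjunct2, THEN conjunct2, THEN conjunct2, THEN conjunct1, rule_format, of W]) (intro conjI assms; assumption?)+

lemma nabla_scale_right:
  assumes "smooth_fun A W f" "smooth_vfield A W X" "smooth_vfield A W Y" "p \<in> W"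
  shows "nabla X (\<lambda>q. f q *\<^sub>R Y q) p = f p *\<^sub>R nabla X Y p + X p f *\<^sub>R Y p"
  by (rule connection[unfolded affine_connection_def, THEN conjunct2, THEN conjunct2, THEN conjunct2, THEN conjunct2, THEN conjunct1, rule_format, of W]) (intro conjI assms; assumption?)+

lemma nabla_cong:
  assumes "smooth_vfield A W X" "smooth_vfield A W X'" "smooth_vfield A W Y" "smooth_vfield A W Y'" "p \<in> W"
    and "\<And>q. q \<in> W \<Longrightarrow> X q = X' q" "\<And>q. q \<in> W \<Longrightarrow> Y q = Y' q"
  shows "nabla X Y p = nabla X' Y' p"
  by (rule connection[unfolded affine_connection_def, THEN conjunct2, THEN conjunct2, THEN conjunct2, THEN conjunct2, THEN conjunct2, rule_format, of W]) (intro conjI ballI assms; assumption?)+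

lemma nabla_zero_left:
  assumes "smooth_vfield A W Y" "p \<in> W"
  shows "nabla (\<lambda>q. 0) Y p = 0"
  using nabla_add_left[OF vfield_zero vfield_zero assms] vfield_open[OF assms(1)] by simp

lemma nabla_zero_right:
  assumes "smooth_vfield A W X" "p \<in> W"
  shows "nabla X (\<lambda>q. 0) p = 0"
  using nabla_add_right[OF assms(1) vfield_zero vfield_zero assms(2)] vfield_open[OF assms(1)] by simp

lemma nabla_sum_left:
  assumes f: "\<And>i. i \<in> I \<Longrightarrow> smooth_fun A W (f i)" and E: "\<And>i. i \<in> I \<Longrightarrow> smooth_vfield A W (E i)"
    and Y: "smooth_vfield A W Y" and p: "p \<in> W"
  shows "nabla (\<lambda>q. \<Sum>i\<in>I. f i q *\<^sub>R E i q) Y p = (\<Sum>i\<in>I. f i p *\<^sub>R nabla (E i) Y p)"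
proof -
  define P where "P X v \<longleftrightarrow> nabla X Y p = v" for X v
  have "P (\<lambda>q. \<Sum>i\<in>I. f i q *\<^sub>R E i q) (\<Sum>i\<in>I. f i p *\<^sub>R nabla (E i) Y p)"
    using f E
  proof (induction I rule: infinite_finite_induct)
    case (insert i I)
    have 1: "smooth_vfield A W (\<lambda>q. \<Sum>i\<in>I. f i q *\<^sub>R E i q)"
      using insert.prems by (intro vfield_sum vfield_open[OF Y] vfield_scale) auto
    have 2: "smooth_vfield A W (\<lambda>q. f i q *\<^sub>R E i q)"
      using insert.prems by (intro vfield_scale) auto
    have "P (\<lambda>q. \<Sum>i\<in>I. f i q *\<^sub>R E i q) (\<Sum>i\<in>I. f i p *\<^sub>R nabla (E i) Y p)" using insert by blast
    moreover have "nabla (\<lambda>q. f i q *\<^sub>R E i q) Y p = f i p *\<^sub>R nabla (E i) Y p"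
      using nabla_scale_left[of W "f i" "E i", OF _ _ Y p] insert.prems by blast
    ultimately show ?case
      unfolding sum.insert[OF insert.hyps] P_def nabla_add_left[OF 2 1 Y p] by simp
  qed (simp_all add: P_def nabla_zero_left[OF Y p])
  then show ?thesis unfolding P_def .
qed

lemma nabla_sum_right:
  assumes f: "\<And>i. i \<in> I \<Longrightarrow> smooth_fun A W (f i)" and E: "\<And>i. i \<in> I \<Longrightarrow> smooth_vfield A W (E i)"
    and X: "smooth_vfield A W X" and p: "p \<in> W"
  shows "nabla X (\<lambda>q. \<Sum>i\<in>I. f i q *\<^sub>R E i q) p = (\<Sum>i\<in>I. f i p *\<^sub>R nabla X (E i) p + X p (f i) *\<^sub>R E i p)"
proof -
  define P where "P Y v \<longleftrightarrow> nabla X Y p = v" for Y v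
  have "P (\<lambda>q. \<Sum>i\<in>I. f i q *\<^sub>R E i q) (\<Sum>i\<in>I. f i p *\<^sub>R nabla X (E i) p + X p (f i) *\<^sub>R E i p)"
    using f E
  proof (induction I rule: infinite_finite_induct)
    case (insert i I)
    have 1: "smooth_vfield A W (\<lambda>q. \<Sum>i\<in>I. f i q *\<^sub>R E i q)"
      using insert.prems by (intro vfield_sum vfield_open[OF X] vfield_scale) auto
    have 2: "smooth_vfield A W (\<lambda>q. f i q *\<^sub>R E i q)"
      using insert.prems by (intro vfield_scale) auto
    have "P (\<lambda>q. \<Sum>i\<in>I. f i q *\<^sub>R E i q) (\<Sum>i\<in>I. f i p *\<^sub>R nabla X (E i) p + X p (f i) *\<^sub>R E i p)"
      using insert by blast
    moreover have "nabla X (\<lambda>q. f i q *\<^sub>R E i q) p = f i p *\<^sub>R nabla X (E i) p + X p (f i) *\<^sub>R E i p"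
      using nabla_scale_right[of W "f i", OF _ X _ p] insert.prems by blast
    ultimately show ?case
      unfolding sum.insert[OF insert.hyps] P_def nabla_add_right[OF X 2 1 p] by simp
  qed (simp_all add: P_def nabla_zero_right[OF X p])
  then show ?thesis unfolding P_def .
qed

lemma vfield_comp_fun:
  assumes "smooth_vfield A W X" "c \<in> A"
  shows "smooth_fun A (W \<inter> cdom c) (\<lambda>q. X q (coord c i))"
  unfolding smooth_fun_iff
  using vfield_comp_smooth[OF assms] openin_Int[OF vfield_open[OF assms(1)] openM_cdom[OF assms(2)]] by blast

lemma vfield_restrict_chart:
  assumes "smooth_vfield A W X" "c \<in> A"
  shows "smooth_vfield A (W \<inter> cdom c) X"
  by (rule vfield_subset[OF assms(1) openin_Int[OF vfield_open[OF assms(1)] openM_cdom[OF assms(2)]]]) simp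

lemma vfield_dd:
  assumes "smooth_vfield A W X" "c \<in> A"
  shows "smooth_vfield A (W \<inter> cdom c) (dd c i)"
  by (rule vfield_subset[OF vfield_coord_vec[OF assms(2)] openin_Int[OF vfield_open[OF assms(1)] openM_cdom[OF assms(2)]]]) simp

lemma vfield_expansion:
  assumes "smooth_vfield A W X" "c \<in> A"
  shows "smooth_vfield A (W \<inter> cdom c) (\<lambda>q. \<Sum>i\<in>Basis. X q (coord c i) *\<^sub>R dd c i q)"
    and "q \<in> W \<inter> cdom c \<Longrightarrow> X q = (\<Sum>i\<in>Basis. X q (coord c i) *\<^sub>R dd c i q)"
proof -
  show e: "X q = (\<Sum>i\<in>Basis. X q (coord c i) *\<^sub>R dd c i q)" if "q \<in> W \<inter> cdom c" for q
    using that by (intro tangent_expand assms vfield_tangent[OF assms(1)]) auto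
  show "smooth_vfield A (W \<inter> cdom c) (\<lambda>q. \<Sum>i\<in>Basis. X q (coord c i) *\<^sub>R dd c i q)"
    by (rule vfield_cong[OF vfield_restrict_chart[OF assms]]) (rule e)
qed

text \<open>The coordinate expansion of X is an equality of fields only on
  \<open>W \<inter> cdom c\<close>; the locality axiom of a connection permits the replacement
  there, and linearity over functions does the rest. The expansion of the second argument adds the
  Leibniz terms.\<close>

lemma nabla_expand_left:
  assumes X: "smooth_vfield A W X" and Y: "smooth_vfield A W Y" and c: "c \<in> A" and p: "p \<in> W \<inter> cdom c"
  shows "nabla X Y p = (\<Sum>i\<in>Basis. X p (coord c i) *\<^sub>R nabla (dd c i) Y p)"
proof -
  have "nabla X Y p = nabla (\<lambda>q. \<Sum>i\<in>Basis. X q (coord c i) *\<^sub>R dd c i q) Y p"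
    by (rule nabla_cong[OF vfield_restrict_chart[OF X c] vfield_expansion(1)[OF X c]
          vfield_restrict_chart[OF Y c] vfield_restrict_chart[OF Y c] p vfield_expansion(2)[OF X c]]) auto
  also have "\<dots> = (\<Sum>i\<in>Basis. X p (coord c i) *\<^sub>R nabla (dd c i) Y p)"
    by (rule nabla_sum_left[OF vfield_comp_fun[OF X c] vfield_dd[OF X c] vfield_restrict_chart[OF Y c] p])
  finally show ?thesis .
qed

lemma nabla_expand_right:
  assumes X: "smooth_vfield A W X" and Y: "smooth_vfield A W Y" and c: "c \<in> A" and p: "p \<in> W \<inter> cdom c"
  shows "nabla X Y p = (\<Sum>i\<in>Basis. Y p (coord c i) *\<^sub>R nabla X (dd c i) p + X p (\<lambda>q. Y q (coord c i)) *\<^sub>R dd c i p)"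
proof -
  have "nabla X Y p = nabla X (\<lambda>q. \<Sum>i\<in>Basis. Y q (coord c i) *\<^sub>R dd c i q) p"
    by (rule nabla_cong[OF vfield_restrict_chart[OF X c] vfield_restrict_chart[OF X c]
          vfield_restrict_chart[OF Y c] vfield_expansion(1)[OF Y c] p _ vfield_expansion(2)[OF Y c]]) auto
  also have "\<dots> = (\<Sum>i\<in>Basis. Y p (coord c i) *\<^sub>R nabla X (dd c i) p + X p (\<lambda>q. Y q (coord c i)) *\<^sub>R dd c i p)"
    by (rule nabla_sum_right[OF vfield_comp_fun[OF Y c] vfield_dd[OF Y c] vfield_restrict_chart[OF X c] p])
  finally show ?thesis .
qed

lemma nabla_dd_tangent: "c \<in> A \<Longrightarrow> p \<in> cdom c \<Longrightarrow> nabla (dd c i) (dd c j) p \<in> TM p"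
  by (rule vfield_tangent[OF nabla_vfield[OF vfield_coord_vec vfield_coord_vec]])

section \<open>The lifts in a single chart\<close>

text \<open>The expression required of \<open>horizontal_lift\<close> by one chart c. Its
  independence of c makes the definite description there denote something;
  \<open>chart_vertical\<close> plays the same part for \<open>vertical_lift\<close>.\<close>

definition chart_horizontal :: "('a, 'e) chart \<Rightarrow> 'a cotangent \<Rightarrow> 'a tvec \<Rightarrow> 'a cotangent tvec"
  where "chart_horizontal c a v = (\<Sum>i\<in>Basis. v (coord c i) *\<^sub>R
      (d_dx A c a i + (\<Sum>l\<in>Basis. \<Sum>k\<in>Basis.
        (snd a (coord_vec A c (fst a) k) * christoffel A nabla c (fst a) k i l) *\<^sub>R d_dy A c a l)))"

definition chart_vertical :: "('a, 'e) chart \<Rightarrow> 'a cotangent \<Rightarrow> 'a covec \<Rightarrow> 'a cotangent tvec"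
  where "chart_vertical c a \<alpha> = (\<Sum>i\<in>Basis. \<alpha> (coord_vec A c (fst a) i) *\<^sub>R d_dy A c a i)"

context
  fixes a c
  assumes a: "a \<in> PN" and c: "c \<in> A" "fst a \<in> cdom c"
begin

lemma d_dx_TN: "d_dx A c a i \<in> TN a" and d_dy_TN: "d_dy A c a i \<in> TN a"
  unfolding d_dx_def d_dy_def using a c by (auto intro!: N.coord_vec_in_tangent_space)

lemma d_dx_coord: "d_dx A c a i (pull (coord c k)) = i \<bullet> k"
  "k \<in> Basis \<Longrightarrow> d_dx A c a i (iota (dd c k)) = 0"
  using N.coord_vec_coord[of "CC c" a "(i, 0)" "(k, 0)"] N.coord_vec_coord[of "CC c" a "(i, 0)" "(0, k)"] a c
  by (simp_all add: d_dx_def CC_coord_fst CC_coord_snd)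

lemma d_dy_coord: "d_dy A c a i (pull (coord c k)) = 0"
  "k \<in> Basis \<Longrightarrow> d_dy A c a i (iota (dd c k)) = i \<bullet> k"
  using N.coord_vec_coord[of "CC c" a "(0, i)" "(k, 0)"] N.coord_vec_coord[of "CC c" a "(0, i)" "(0, k)"] a c
  by (simp_all add: d_dy_def CC_coord_fst CC_coord_snd)

lemma chart_horizontal_TN: "chart_horizontal c a v \<in> TN a"
  unfolding chart_horizontal_def
  by (intro N.tangent_sum N.tangent_scale N.tangent_add d_dx_TN d_dy_TN a)

lemma chart_vertical_TN: "chart_vertical c a \<alpha> \<in> TN a"
  unfolding chart_vertical_def by (intro N.tangent_sum N.tangent_scale d_dy_TN a)

lemma chart_horizontal_pull_coord: "k \<in> Basis \<Longrightarrow> chart_horizontal c a v (pull (coord c k)) = v (coord c k)"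
  unfolding chart_horizontal_def
  by (simp add: sum_fun_apply d_dx_coord d_dy_coord sum_mult_inner_Basis)

lemma chart_vertical_pull_coord: "chart_vertical c a \<alpha> (pull (coord c k)) = 0"
  unfolding chart_vertical_def by (simp add: sum_fun_apply d_dy_coord)

lemma chart_vertical_iota_dd: "k \<in> Basis \<Longrightarrow> chart_vertical c a \<alpha> (iota (dd c k)) = \<alpha> (dd c k (fst a))"
  unfolding chart_vertical_def
  by (simp add: sum_fun_apply d_dy_coord sum_mult_inner_Basis)

text \<open>The sum y_k Gamma^k_il is the covector applied to the covariant derivative of the l-th
  coordinate field along the i-th one: this is the meaning of the coefficients in the horizontal
  lift.\<close>

lemma chart_horizontal_iota_dd:
  assumes l: "l \<in> Basis"
  shows "chart_horizontal c a v (iota (dd c l)) = (\<Sum>i\<in>Basis. v (coord c i) * snd a (nabla (dd c i) (dd c l) (fst a)))"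
proof -
  have "snd a \<in> T'M (fst a)" using a by (simp add: PN_iff)
  from cotangent_expand[OF this c nabla_dd_tangent[OF c]]
  have *: "snd a (nabla (dd c i) (dd c l) (fst a)) =
      (\<Sum>k\<in>Basis. snd a (dd c k (fst a)) * christoffel A nabla c (fst a) k i l)" for i
    by (simp add: christoffel_def mult.commute)
  have "(\<Sum>m\<in>Basis. \<Sum>k\<in>Basis. snd a (dd c k (fst a)) * christoffel A nabla c (fst a) k i m * (m \<bullet> l)) =
     (\<Sum>k\<in>Basis. snd a (dd c k (fst a)) * christoffel A nabla c (fst a) k i l)" for i
    by (subst sum.swap) (rule sum.cong[OF refl sum_mult_inner_Basis[OF l]])
  then show ?thesis
    unfolding chart_horizontal_def * by (simp add: sum_fun_apply d_dx_coord d_dy_coord l)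
qed

lemma chart_horizontal_pull:
  assumes "v \<in> TM (fst a)" "smooth_near A (fst a) f"
  shows "chart_horizontal c a v (pull f) = v f"
  using TN_pull[OF a c assms(2) chart_horizontal_TN] tangent_expand_apply[OF c assms(1), of f]
  by (simp add: chart_horizontal_pull_coord)

lemma chart_vertical_pull:
  assumes "smooth_near A (fst a) f"
  shows "chart_vertical c a \<alpha> (pull f) = 0"
  using TN_pull[OF a c assms chart_vertical_TN] by (simp add: chart_vertical_pull_coord)

lemma chart_vertical_iota:
  assumes Y: "smooth_vfield A W Y" "fst a \<in> W" and \<alpha>: "\<alpha> \<in> T'M (fst a)"
  shows "chart_vertical c a \<alpha> (iota Y) = \<alpha> (Y (fst a))"
proof -
  have "smooth_near A (fst a) (\<lambda>q. Y q (coord c i))" for i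
    using vfield_comp_smooth[OF Y(1) c(1)] Y(2) c(2) by simp
  note chart_vertical_pull[OF this]
  then show ?thesis
    using TN_iota[OF a c Y chart_vertical_TN] cotangent_expand[OF \<alpha> c vfield_tangent[OF Y]]
    by (simp add: chart_vertical_iota_dd)
qed

text \<open>Leibniz on both sides: X^H(Y^i y_i) = X(Y^i) y_i + Y^i alpha(nabla_X d_i), and this is
  alpha applied to the expansion of nabla_X Y. The result mentions no chart, so it determines the
  lift invariantly.\<close>

lemma chart_horizontal_iota:
  assumes X: "smooth_vfield A W X" and Y: "smooth_vfield A W Y" and p: "fst a \<in> W"
  shows "chart_horizontal c a (X (fst a)) (iota Y) = snd a (nabla X Y (fst a))"
proof -
  let ?p = "fst a"
  have pc: "?p \<in> W \<inter> cdom c" using p c by simp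
  have al: "snd a \<in> T'M ?p" and pp: "?p \<in> points A" using a by (simp_all add: PN_iff)
  note Xp = vfield_tangent[OF X p]
  have s: "smooth_near A ?p (\<lambda>q. Y q (coord c i))" for i
    using vfield_comp_smooth[OF Y c(1)] pc by simp
  have t: "nabla X (dd c i) ?p \<in> TM ?p" for i
    by (rule vfield_tangent[OF nabla_vfield[OF vfield_restrict_chart[OF X c(1)] vfield_dd[OF X c(1)]] pc])
  have hl: "chart_horizontal c a (X ?p) (iota (dd c l)) = snd a (nabla X (dd c l) ?p)" if l: "l \<in> Basis" for l
  proof -
    have "nabla X (dd c l) ?p = (\<Sum>i\<in>Basis. X ?p (coord c i) *\<^sub>R nabla (dd c i) (dd c l) ?p)"
      by (rule nabla_expand_left[OF vfield_restrict_chart[OF X c(1)] vfield_dd[OF X c(1)] c(1)]) (use pc in simp)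
    then have "snd a (nabla X (dd c l) ?p) = (\<Sum>i\<in>Basis. X ?p (coord c i) * snd a (nabla (dd c i) (dd c l) ?p))"
      by (simp add: cotangent_sum[OF al pp] cotangent_scale[OF al] tangent_scale nabla_dd_tangent[OF c])
    then show ?thesis by (simp add: chart_horizontal_iota_dd l)
  qed
  have "chart_horizontal c a (X ?p) (iota Y) = (\<Sum>i\<in>Basis. X ?p (\<lambda>q. Y q (coord c i)) * snd a (dd c i ?p) +
      Y ?p (coord c i) * snd a (nabla X (dd c i) ?p))"
    using TN_iota[OF a c Y p chart_horizontal_TN, of "X ?p"] by (simp add: chart_horizontal_pull[OF Xp s] hl)
  also have "\<dots> = snd a (nabla X Y ?p)"
    unfolding nabla_expand_right[OF X Y c(1) pc]
    using c by (subst cotangent_sum[OF al pp])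
      (auto intro!: tangent_add tangent_scale t sum.cong simp: cotangent_add[OF al] cotangent_scale[OF al] tangent_scale t coord_vec_in_tangent_space)
  finally show ?thesis .
qed

end

section \<open>Independence of the chart\<close>

text \<open>The vector v is extended to the field with constant components u in c, so that
  \<open>chart_horizontal_iota\<close> evaluates the expressions of both charts on the same test
  functions.\<close>

lemma chart_horizontal_indep:
  assumes a: "a \<in> PN" and c: "c \<in> A" "fst a \<in> cdom c" and d: "d \<in> A" "fst a \<in> cdom d" and v: "v \<in> TM (fst a)"
  shows "chart_horizontal c a v = chart_horizontal d a v"
proof -
  obtain u where u: "v = coord_vec A c (fst a) u" using v tangent_space_chart[OF c] by auto
  have X: "smooth_vfield A (cdom c) (dd c u)" by (rule vfield_coord_vec[OF c(1)])
  show ?thesis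
  proof (rule TN_eqI[OF a c chart_horizontal_TN[OF a c] chart_horizontal_TN[OF a d]])
    fix i :: 'e assume "i \<in> Basis"
    show "chart_horizontal c a v (pull (coord c i)) = chart_horizontal d a v (pull (coord c i))"
      by (simp add: chart_horizontal_pull[OF a _ _ v smooth_near_coord] c d)
    show "chart_horizontal c a v (iota (dd c i)) = chart_horizontal d a v (iota (dd c i))"
      unfolding u
      using chart_horizontal_iota[OF a c X vfield_coord_vec[OF c(1)] c(2)]
        chart_horizontal_iota[OF a d X vfield_coord_vec[OF c(1)] c(2)] by simp
  qed
qed

lemma chart_vertical_indep:
  assumes a: "a \<in> PN" and c: "c \<in> A" "fst a \<in> cdom c" and d: "d \<in> A" "fst a \<in> cdom d" and \<alpha>: "\<alpha> \<in> T'M (fst a)"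
  shows "chart_vertical c a \<alpha> = chart_vertical d a \<alpha>"
proof (rule TN_eqI[OF a c chart_vertical_TN[OF a c] chart_vertical_TN[OF a d]])
  fix i :: 'e assume "i \<in> Basis"
  show "chart_vertical c a \<alpha> (pull (coord c i)) = chart_vertical d a \<alpha> (pull (coord c i))"
    by (simp add: chart_vertical_pull[OF a _ _ smooth_near_coord] c d)
  show "chart_vertical c a \<alpha> (iota (dd c i)) = chart_vertical d a \<alpha> (iota (dd c i))"
    by (simp add: chart_vertical_iota[OF a _ _ vfield_coord_vec[OF c(1)] c(2) \<alpha>] c d)
qed

lemma horizontal_lift_chart:
  assumes a: "a \<in> PN" and c: "c \<in> A" "fst a \<in> cdom c" and v: "v \<in> TM (fst a)"
  shows "HL a v = chart_horizontal c a v"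
  unfolding horizontal_lift_def chart_horizontal_def[symmetric]
proof (rule the_equality)
  show "\<forall>d\<in>A. fst a \<in> cdom d \<longrightarrow> chart_horizontal c a v = chart_horizontal d a v"
    using chart_horizontal_indep[OF a c _ _ v] by blast
  show "\<xi> = chart_horizontal c a v" if "\<forall>d\<in>A. fst a \<in> cdom d \<longrightarrow> \<xi> = chart_horizontal d a v" for \<xi>
    using that c by simp
qed

lemma vertical_lift_chart:
  assumes a: "a \<in> PN" and c: "c \<in> A" "fst a \<in> cdom c" and \<alpha>: "\<alpha> \<in> T'M (fst a)"
  shows "VL a \<alpha> = chart_vertical c a \<alpha>"
  unfolding vertical_lift_def chart_vertical_def[symmetric]
proof (rule the_equality)
  show "\<forall>d\<in>A. fst a \<in> cdom d \<longrightarrow> chart_vertical c a \<alpha> = chart_vertical d a \<alpha>"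
    using chart_vertical_indep[OF a c _ _ \<alpha>] by blast
  show "\<xi> = chart_vertical c a \<alpha>" if "\<forall>d\<in>A. fst a \<in> cdom d \<longrightarrow> \<xi> = chart_vertical d a \<alpha>" for \<xi>
    using that c by simp
qed

section \<open>Lifts at a point and the isomorphism Phi\<close>

context
  fixes a assumes a: "a \<in> PN"
begin

lemma HL_TN: "v \<in> TM (fst a) \<Longrightarrow> HL a v \<in> TN a"
  by (rule PN_chartE[OF a]) (simp add: horizontal_lift_chart[OF a] chart_horizontal_TN[OF a])

lemma VL_TN: "\<alpha> \<in> T'M (fst a) \<Longrightarrow> VL a \<alpha> \<in> TN a"
  by (rule PN_chartE[OF a]) (simp add: vertical_lift_chart[OF a] chart_vertical_TN[OF a])

lemma HL_pull: "v \<in> TM (fst a) \<Longrightarrow> smooth_near A (fst a) f \<Longrightarrow> HL a v (pull f) = v f"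
  by (rule PN_chartE[OF a]) (simp add: horizontal_lift_chart[OF a] chart_horizontal_pull[OF a])

lemma VL_pull: "\<alpha> \<in> T'M (fst a) \<Longrightarrow> smooth_near A (fst a) f \<Longrightarrow> VL a \<alpha> (pull f) = 0"
  by (rule PN_chartE[OF a]) (simp add: vertical_lift_chart[OF a] chart_vertical_pull[OF a])

lemma HL_iota:
  "smooth_vfield A W X \<Longrightarrow> smooth_vfield A W Y \<Longrightarrow> fst a \<in> W \<Longrightarrow>
    HL a (X (fst a)) (iota Y) = snd a (nabla X Y (fst a))"
  by (rule PN_chartE[OF a])
    (simp add: horizontal_lift_chart[OF a] chart_horizontal_iota[OF a] vfield_tangent)

lemma VL_iota:
  "smooth_vfield A W Y \<Longrightarrow> fst a \<in> W \<Longrightarrow> \<alpha> \<in> T'M (fst a) \<Longrightarrow> VL a \<alpha> (iota Y) = \<alpha> (Y (fst a))"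
  by (rule PN_chartE[OF a]) (simp add: vertical_lift_chart[OF a] chart_vertical_iota[OF a])

lemma HL_add: "v \<in> TM (fst a) \<Longrightarrow> w \<in> TM (fst a) \<Longrightarrow> HL a (v + w) = HL a v + HL a w"
  by (rule PN_chartE[OF a])
    (simp add: horizontal_lift_chart[OF a] tangent_add chart_horizontal_def scaleR_add_left sum.distrib)

lemma HL_scale: "v \<in> TM (fst a) \<Longrightarrow> HL a (r *\<^sub>R v) = r *\<^sub>R HL a v"
  by (rule PN_chartE[OF a])
    (simp add: horizontal_lift_chart[OF a] tangent_scale chart_horizontal_def scaleR_sum_right)

lemma VL_add: "\<alpha> \<in> T'M (fst a) \<Longrightarrow> \<beta> \<in> T'M (fst a) \<Longrightarrow> VL a (\<alpha> + \<beta>) = VL a \<alpha> + VL a \<beta>"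
  by (rule PN_chartE[OF a])
    (simp add: subspace_add[OF subspace_cotangent_space] vertical_lift_chart[OF a] chart_vertical_def scaleR_add_left sum.distrib)

lemma VL_scale: "\<alpha> \<in> T'M (fst a) \<Longrightarrow> VL a (r *\<^sub>R \<alpha>) = r *\<^sub>R VL a \<alpha>"
  by (rule PN_chartE[OF a])
    (simp add: subspace_scale[OF subspace_cotangent_space] vertical_lift_chart[OF a] chart_vertical_def scaleR_sum_right)

lemma HL_iota_dd:
  assumes "c \<in> A" "fst a \<in> cdom c" "v \<in> TM (fst a)" "l \<in> Basis"
  shows "HL a v (iota (dd c l)) = (\<Sum>i\<in>Basis. v (coord c i) * snd a (nabla (dd c i) (dd c l) (fst a)))"
  using assms by (simp add: horizontal_lift_chart[OF a] chart_horizontal_iota_dd[OF a])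

lemma VL_iota_dd:
  assumes "c \<in> A" "fst a \<in> cdom c" "\<alpha> \<in> T'M (fst a)"
  shows "VL a \<alpha> (iota (dd c l)) = \<alpha> (dd c l (fst a))"
  using VL_iota[OF vfield_coord_vec] assms by blast

lemma Phi_eq: "PP a (v, \<alpha>) = HL a v + VL a \<alpha>"
  by (simp add: Phi_def)

lemma Phi_TN: "v \<in> TM (fst a) \<Longrightarrow> \<alpha> \<in> T'M (fst a) \<Longrightarrow> PP a (v, \<alpha>) \<in> TN a"
  by (simp add: Phi_eq N.tangent_add HL_TN VL_TN)

lemma Phi_pull_coord:
  assumes "c \<in> A" "fst a \<in> cdom c" "v \<in> TM (fst a)" "\<alpha> \<in> T'M (fst a)"
  shows "PP a (v, \<alpha>) (pull (coord c i)) = v (coord c i)"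
  using assms HL_pull[OF assms(3) smooth_near_coord[OF assms(1,2)]]
    VL_pull[OF assms(4) smooth_near_coord[OF assms(1,2)]] by (simp add: Phi_eq)

lemma Phi_iota_dd:
  assumes "c \<in> A" "fst a \<in> cdom c" "v \<in> TM (fst a)" "\<alpha> \<in> T'M (fst a)" "l \<in> Basis"
  shows "PP a (v, \<alpha>) (iota (dd c l)) =
    (\<Sum>i\<in>Basis. v (coord c i) * snd a (nabla (dd c i) (dd c l) (fst a))) + \<alpha> (dd c l (fst a))"
  using assms by (simp add: Phi_eq HL_iota_dd VL_iota_dd)

text \<open>On the coordinates of an induced chart Phi is block triangular: the base coordinates
  give back v, and once v is known the fibre coordinates give back the covector.\<close>

lemma Phi_bij: "bij_betw (PP a) (TM (fst a) \<times> T'M (fst a)) (TN a)"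
  unfolding bij_betw_def
proof (intro conjI equalityI subsetI)
  obtain c where c: "c \<in> A" "fst a \<in> cdom c" by (rule PN_chartE[OF a])
  show "inj_on (PP a) (TM (fst a) \<times> T'M (fst a))"
  proof (rule inj_onI, clarify)
    fix v \<alpha> w \<beta> assume v: "v \<in> TM (fst a)" and \<alpha>: "\<alpha> \<in> T'M (fst a)" and w: "w \<in> TM (fst a)" and \<beta>: "\<beta> \<in> T'M (fst a)"
      and eq: "PP a (v, \<alpha>) = PP a (w, \<beta>)"
    have vw: "v = w"
      by (rule tangent_eqI[OF c v w]) (metis Phi_pull_coord[OF c v \<alpha>] Phi_pull_coord[OF c w \<beta>] eq)
    have "\<alpha> = \<beta>"
    proof (rule cotangent_eqI[OF c \<alpha> \<beta>])
      fix i :: 'e assume i: "i \<in> Basis"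
      show "\<alpha> (coord_vec A c (fst a) i) = \<beta> (coord_vec A c (fst a) i)"
        using Phi_iota_dd[OF c v \<alpha> i] Phi_iota_dd[OF c w \<beta> i] eq vw by simp
    qed
    with vw show "v = w \<and> \<alpha> = \<beta>" by simp
  qed
  show "\<xi> \<in> TN a" if "\<xi> \<in> PP a ` (TM (fst a) \<times> T'M (fst a))" for \<xi>
    using that Phi_TN by auto
  fix \<xi> assume \<xi>: "\<xi> \<in> TN a"
  define v where "v = coord_vec A c (fst a) (\<Sum>i\<in>Basis. \<xi> (pull (coord c i)) *\<^sub>R i)"
  \<comment> \<open>The fibre components of \<xi> that remain after removing the contribution of the
    horizontal lift of v.\<close>
  define \<alpha> where "\<alpha> = covec_of c (fst a) (\<Sum>l\<in>Basis. (\<xi> (iota (dd c l)) - HL a v (iota (dd c l))) *\<^sub>R l)"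
  have v: "v \<in> TM (fst a)" unfolding v_def using c by blast
  have \<alpha>: "\<alpha> \<in> T'M (fst a)" unfolding \<alpha>_def by (rule covec_of_cotangent[OF pointsI[OF c]])
  have "\<xi> = PP a (v, \<alpha>)"
  proof (rule TN_eqI[OF a c \<xi> Phi_TN[OF v \<alpha>]])
    fix i :: 'e assume i: "i \<in> Basis"
    show "\<xi> (pull (coord c i)) = PP a (v, \<alpha>) (pull (coord c i))"
    proof -
      have "v (coord c i) = \<xi> (pull (coord c i))"
        unfolding v_def coord_vec_coord[OF c] using i by simp
      then show ?thesis unfolding Phi_pull_coord[OF c v \<alpha>] by (rule sym)
    qed
    have "\<alpha> (dd c i (fst a)) = \<xi> (iota (dd c i)) - HL a v (iota (dd c i))"
      unfolding \<alpha>_def covec_of_coord_vec[OF c] inner_commute[of i] using i by simp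
    then show "\<xi> (iota (dd c i)) = PP a (v, \<alpha>) (iota (dd c i))"
      by (simp add: Phi_iota_dd[OF c v \<alpha> i] HL_iota_dd[OF c v i])
  qed
  then show "\<xi> \<in> PP a ` (TM (fst a) \<times> T'M (fst a))" using v \<alpha> by blast
qed

lemma Phi_inv_Phi: "v \<in> TM (fst a) \<Longrightarrow> \<alpha> \<in> T'M (fst a) \<Longrightarrow> Phi_inv A nabla a (PP a (v, \<alpha>)) = (v, \<alpha>)"
  unfolding Phi_inv_def using Phi_bij by (intro inv_into_f_f) (auto simp: bij_betw_def)

lemma TN_cases:
  assumes "\<xi> \<in> TN a"
  obtains v \<alpha> where "v \<in> TM (fst a)" "\<alpha> \<in> T'M (fst a)" "\<xi> = PP a (v, \<alpha>)"
  using assms Phi_bij unfolding bij_betw_def by blast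

lemma Phi_add:
  assumes "v \<in> TM (fst a)" "\<alpha> \<in> T'M (fst a)" "w \<in> TM (fst a)" "\<beta> \<in> T'M (fst a)"
  shows "PP a (v, \<alpha>) + PP a (w, \<beta>) = PP a (v + w, \<alpha> + \<beta>)"
  using assms by (simp add: Phi_eq HL_add VL_add)

lemma Phi_scale:
  assumes "v \<in> TM (fst a)" "\<alpha> \<in> T'M (fst a)"
  shows "r *\<^sub>R PP a (v, \<alpha>) = PP a (r *\<^sub>R v, r *\<^sub>R \<alpha>)"
  using assms by (simp add: Phi_eq HL_scale VL_scale scaleR_add_right)

end

section \<open>Smoothness through horizontal and vertical components\<close>

abbreviation hor :: "'a cotangent \<Rightarrow> 'a cotangent tvec \<Rightarrow> 'a tvec"
  where "hor a \<xi> \<equiv> fst (Phi_inv A nabla a \<xi>)"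

abbreviation ver :: "'a cotangent \<Rightarrow> 'a cotangent tvec \<Rightarrow> 'a covec"
  where "ver a \<xi> \<equiv> snd (Phi_inv A nabla a \<xi>)"

lemma hor_ver:
  assumes "a \<in> PN" "\<xi> \<in> TN a"
  shows "hor a \<xi> \<in> TM (fst a)" "ver a \<xi> \<in> T'M (fst a)" "\<xi> = PP a (hor a \<xi>, ver a \<xi>)"
  by (rule TN_cases[OF assms]; simp add: Phi_inv_Phi[OF assms(1)])+

lemma smooth_near_hor:
  assumes \<Xi>: "smooth_vfield (cotangent_atlas A) W \<Xi>" and a: "a \<in> W" and c: "c \<in> A" "fst a \<in> cdom c"
  shows "smooth_near (cotangent_atlas A) a (\<lambda>b. hor b (\<Xi> b) (coord c i))"
proof -
  note t = N.vfield_tangent[OF \<Xi>]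
  have WP: "W \<subseteq> PN" using N.vfield_open[OF \<Xi>] N.openM_subset by blast
  have o: "N.openM (W \<inter> over (cdom c))" using N.vfield_open[OF \<Xi>] open_over[OF openM_cdom[OF c(1)]] by blast
  have "smooth_near (cotangent_atlas A) a (\<lambda>b. \<Xi> b (pull (coord c i)))"
    using WP a c by (intro N.vfield_smooth_near[OF \<Xi> a] smooth_near_pull smooth_near_coord) auto
  then show ?thesis
  proof (rule N.smooth_near_cong[OF o, rotated 2])
    fix b assume b: "b \<in> W \<inter> over (cdom c)"
    then have bP: "b \<in> PN" and bc: "fst b \<in> cdom c" and bW: "b \<in> W" by auto
    show "\<Xi> b (pull (coord c i)) = hor b (\<Xi> b) (coord c i)"
      using Phi_pull_coord[OF bP c(1) bc hor_ver(1,2)[OF bP t[OF bW]]] hor_ver(3)[OF bP t[OF bW]] by metis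
  qed (use WP a c in auto)
qed

lemma smooth_near_connection:
  assumes a: "a \<in> PN" and c: "c \<in> A" "fst a \<in> cdom c"
  shows "smooth_near (cotangent_atlas A) a (iota (nabla (dd c i) (dd c l)))"
  using a c by (intro smooth_near_iota[OF nabla_vfield[OF vfield_coord_vec vfield_coord_vec]]) auto

text \<open>The vertical component is the fibre component of \<Xi> minus that of its horizontal
  part, whose coefficients y_k Gamma^k_il are smooth because \<open>nabla\<close> preserves smooth
  fields.\<close>

lemma smooth_near_ver:
  assumes \<Xi>: "smooth_vfield (cotangent_atlas A) W \<Xi>" and a: "a \<in> W" and c: "c \<in> A" "fst a \<in> cdom c" and l: "l \<in> Basis"
  shows "smooth_near (cotangent_atlas A) a (\<lambda>b. ver b (\<Xi> b) (dd c l (fst b)))"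
proof -
  note t = N.vfield_tangent[OF \<Xi>]
  have WP: "W \<subseteq> PN" using N.vfield_open[OF \<Xi>] N.openM_subset by blast
  then have aP: "a \<in> PN" using a by auto
  have o: "N.openM (W \<inter> over (cdom c))" using N.vfield_open[OF \<Xi>] open_over[OF openM_cdom[OF c(1)]] by blast
  have "smooth_near (cotangent_atlas A) a (\<lambda>b. \<Xi> b (iota (dd c l)))"
    using aP c by (intro N.vfield_smooth_near[OF \<Xi> a] smooth_near_iota[OF vfield_coord_vec[OF c(1)]]) auto
  then have "smooth_near (cotangent_atlas A) a (\<lambda>b. \<Xi> b (iota (dd c l)) -
      (\<Sum>i\<in>Basis. hor b (\<Xi> b) (coord c i) * iota (nabla (dd c i) (dd c l)) b))"
    by (intro N.smooth_near_diff N.smooth_near_sum N.smooth_near_mult smooth_near_hor[OF \<Xi> a c]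
        smooth_near_connection aP c)
  then show ?thesis
  proof (rule N.smooth_near_cong[OF o, rotated 2])
    fix b assume b: "b \<in> W \<inter> over (cdom c)"
    then have bP: "b \<in> PN" and bc: "fst b \<in> cdom c" and bW: "b \<in> W" by auto
    have "\<Xi> b (iota (dd c l)) = (\<Sum>i\<in>Basis. hor b (\<Xi> b) (coord c i) * snd b (nabla (dd c i) (dd c l) (fst b))) +
        ver b (\<Xi> b) (dd c l (fst b))"
      using Phi_iota_dd[OF bP c(1) bc hor_ver(1,2)[OF bP t[OF bW]] l] hor_ver(3)[OF bP t[OF bW]] by metis
    then show "\<Xi> b (iota (dd c l)) - (\<Sum>i\<in>Basis. hor b (\<Xi> b) (coord c i) * iota (nabla (dd c i) (dd c l)) b) =
        ver b (\<Xi> b) (dd c l (fst b))"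
      by simp
  qed (use WP a c in auto)
qed

text \<open>The converse of the two preceding smoothness statements. The pair (v, \<alpha>) may
  depend on the point of T*M and not only on its base point, as it does for the image of a field
  under J.\<close>

lemma vfield_Phi:
  assumes W: "N.openM W"
    and v: "\<And>b. b \<in> W \<Longrightarrow> v b \<in> TM (fst b)" and \<alpha>: "\<And>b. b \<in> W \<Longrightarrow> \<alpha> b \<in> T'M (fst b)"
    and comp: "\<And>b. b \<in> W \<Longrightarrow> \<exists>c\<in>A. fst b \<in> cdom c \<and>
      (\<forall>i\<in>Basis. smooth_near (cotangent_atlas A) b (\<lambda>b. v b (coord c i)) \<and>
        smooth_near (cotangent_atlas A) b (\<lambda>b. \<alpha> b (dd c i (fst b))))"
  shows "smooth_vfield (cotangent_atlas A) W (\<lambda>b. PP b (v b, \<alpha> b))"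
proof -
  have WP: "W \<subseteq> PN" using W N.openM_subset by blast
  show ?thesis
  proof (rule N.smooth_vfieldI[OF W])
    show "PP b (v b, \<alpha> b) \<in> TN b" if "b \<in> W" for b using that WP v \<alpha> by (intro Phi_TN) auto
    fix a assume a: "a \<in> W"
    then have aP: "a \<in> PN" using WP by auto
    obtain c where c: "c \<in> A" "fst a \<in> cdom c"
      and s: "\<And>i. i \<in> Basis \<Longrightarrow> smooth_near (cotangent_atlas A) a (\<lambda>b. v b (coord c i))"
        "\<And>i. i \<in> Basis \<Longrightarrow> smooth_near (cotangent_atlas A) a (\<lambda>b. \<alpha> b (dd c i (fst b)))"
      using comp[OF a] by blast
    have o: "N.openM (W \<inter> over (cdom c))" using W open_over[OF openM_cdom[OF c(1)]] by blast
    have ao: "a \<in> W \<inter> over (cdom c)" using a aP c by simp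
    show "\<exists>C\<in>cotangent_atlas A. a \<in> cdom C \<and>
        (\<forall>i\<in>Basis. smooth_near (cotangent_atlas A) a (\<lambda>b. PP b (v b, \<alpha> b) (N.coord C i)))"
    proof (intro bexI[of _ "CC c"] conjI ballI)
      fix b :: "'e \<times> 'e" assume "b \<in> Basis"
      then consider i where "i \<in> Basis" "b = (i, 0)" | l where "l \<in> Basis" "b = (0, l)"
        by (auto simp: Basis_prod_def)
      then show "smooth_near (cotangent_atlas A) a (\<lambda>z. PP z (v z, \<alpha> z) (N.coord (CC c) b))"
      proof cases
        case 1
        show ?thesis unfolding 1(2) CC_coord_fst
          by (rule N.smooth_near_cong[OF o ao _ s(1)[OF 1(1)]])
            (use WP v \<alpha> c in \<open>auto simp: Phi_pull_coord\<close>)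
      next
        case 2
        have "smooth_near (cotangent_atlas A) a (\<lambda>z. (\<Sum>i\<in>Basis. v z (coord c i) * iota (nabla (dd c i) (dd c l)) z) + \<alpha> z (dd c l (fst z)))"
          by (intro N.smooth_near_add N.smooth_near_sum N.smooth_near_mult s smooth_near_connection aP c 2(1))
        then show ?thesis unfolding 2(2) CC_coord_snd[OF 2(1)]
          by (rule N.smooth_near_cong[OF o ao, rotated])
            (use WP v \<alpha> c 2(1) in \<open>auto simp: Phi_iota_dd\<close>)
      qed
    qed (use aP c in auto)
  qed
qed

end

section \<open>The tensor fields and the Patterson-Walker metric\<close>

locale metric_connection_bundle = connection_bundle A nabla
  for A :: "('a, 'e::euclidean_space) chart set" and nabla :: "'a connection" +
  fixes h :: "'a metric_tensor"
  assumes metric: "pseudo_riemannian_metric A h"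
begin

abbreviation "flt \<equiv> flat_map A h"
abbreviation "shp \<equiv> sharp_map A h"
abbreviation "J \<equiv> J_tilde A h nabla"
abbreviation "PW \<equiv> patterson_walker A nabla"

section \<open>The isomorphism between vectors and covectors\<close>

lemma h_linear: "v \<in> TM p \<Longrightarrow> linear_on (TM p) (h p v)"
  by (rule metric[unfolded pseudo_riemannian_metric_def, THEN conjunct1, rule_format, OF tangent_space_points])

lemma h_sym: "v \<in> TM p \<Longrightarrow> w \<in> TM p \<Longrightarrow> h p v w = h p w v"
  by (rule metric[unfolded pseudo_riemannian_metric_def, THEN conjunct2, THEN conjunct1, rule_format, OF tangent_space_points])

lemma h_nondegenerate: "v \<in> TM p \<Longrightarrow> (\<And>w. w \<in> TM p \<Longrightarrow> h p v w = 0) \<Longrightarrow> v = 0"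
  using metric[unfolded pseudo_riemannian_metric_def, THEN conjunct2, THEN conjunct2, THEN conjunct1,
      rule_format, OF tangent_space_points] by simp

lemma h_smooth: "smooth_vfield A W X \<Longrightarrow> smooth_vfield A W Y \<Longrightarrow> smooth_fun A W (\<lambda>p. h p (X p) (Y p))"
  by (rule metric[unfolded pseudo_riemannian_metric_def, THEN conjunct2, THEN conjunct2, THEN conjunct2,
        rule_format, OF conjI])

lemma flat_apply: "w \<in> TM p \<Longrightarrow> flt p v w = h p v w"
  by (simp add: flat_map_def)

lemma flat_cotangent: "v \<in> TM p \<Longrightarrow> flt p v \<in> T'M p"
  using h_linear[of v p]
  by (auto simp: cotangent_space_def flat_map_def linear_on_def tangent_add tangent_scale)

text \<open>The metric is linear in its second argument by definition; symmetry transfers this to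
  the argument that \<open>flt\<close> takes.\<close>

lemma flat_add: "v \<in> TM p \<Longrightarrow> w \<in> TM p \<Longrightarrow> flt p (v + w) = flt p v + flt p w"
proof
  fix x assume v: "v \<in> TM p" "w \<in> TM p"
  show "flt p (v + w) x = (flt p v + flt p w) x"
  proof (cases "x \<in> TM p")
    case True
    have "h p x (v + w) = h p x v + h p x w" using h_linear[OF True] v by (simp add: linear_on_def)
    then show ?thesis using v True by (simp add: flat_apply h_sym[of _ p x] tangent_add)
  qed (simp add: flat_map_def)
qed

lemma flat_scale: "v \<in> TM p \<Longrightarrow> flt p (r *\<^sub>R v) = r *\<^sub>R flt p v"
proof
  fix x assume v: "v \<in> TM p"
  show "flt p (r *\<^sub>R v) x = (r *\<^sub>R flt p v) x"
  proof (cases "x \<in> TM p")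
    case True
    have "h p x (r *\<^sub>R v) = r * h p x v" using h_linear[OF True] v by (simp add: linear_on_def)
    then show ?thesis using v True by (simp add: flat_apply h_sym[of _ p x] tangent_scale)
  qed (simp add: flat_map_def)
qed

lemma flat_inj:
  assumes v: "v \<in> TM p" and w: "w \<in> TM p" and eq: "flt p v = flt p w"
  shows "v = w"
proof -
  have "flt p (v + (-1) *\<^sub>R w) = flt p v + (-1) *\<^sub>R flt p w"
    by (simp only: flat_add[OF v tangent_scale[OF w]] flat_scale[OF w])
  then have "flt p (v - w) = 0" using eq by simp
  then have "h p (v - w) x = 0" if "x \<in> TM p" for x
    using flat_apply[OF that, of "v - w"] by simp
  then have "v - w = 0" by (rule h_nondegenerate[OF tangent_diff[OF v w]])
  then show ?thesis by simp
qed

text \<open>Both the tangent space and its dual have coordinates in \<open>'e\<close>, so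
  \<open>flt\<close> becomes an injective endomorphism L of a Euclidean space, which is
  surjective.\<close>

lemma flat_surj:
  assumes \<alpha>: "\<alpha> \<in> T'M p" and p: "p \<in> points A"
  obtains v where "v \<in> TM p" "flt p v = \<alpha>"
proof -
  obtain c where c: "c \<in> A" "p \<in> cdom c" using p by (rule pointsE)
  note t = coord_vec_in_tangent_space[OF c] and lin = linear_coord_vec[OF c]
  define L where "L u = (\<Sum>j\<in>Basis. flt p (coord_vec A c p u) (dd c j p) *\<^sub>R j)" for u :: 'e
  have L: "L u \<bullet> j = flt p (coord_vec A c p u) (dd c j p)" if "j \<in> Basis" for u j
    unfolding L_def using that by simp
  have "linear L"
    by (rule linearI) (simp_all add: L_def linear_add[OF lin] linear_scale[OF lin] flat_add[OF t t] flat_scale[OF t]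
        scaleR_add_left sum.distrib scaleR_sum_right)
  moreover have "u = w" if eq: "L u = L w" for u w
  proof -
    have "flt p (coord_vec A c p u) = flt p (coord_vec A c p w)"
      by (rule cotangent_eqI[OF c flat_cotangent[OF t] flat_cotangent[OF t]]) (metis L eq)
    then have "coord_vec A c p u = coord_vec A c p w" by (rule flat_inj[OF t t])
    then have "u \<bullet> k = w \<bullet> k" for k by (metis coord_vec_coord[OF c])
    then show ?thesis by (rule euclidean_eqI)
  qed
  ultimately have "surj L" using linear_injective_imp_surjective by (metis injI)
  then obtain u where u: "L u = (\<Sum>j\<in>Basis. \<alpha> (dd c j p) *\<^sub>R j)" by (metis surjD)
  have "flt p (coord_vec A c p u) = \<alpha>"
  proof (rule cotangent_eqI[OF c flat_cotangent[OF t] \<alpha>])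
    fix j :: 'e assume j: "j \<in> Basis"
    show "flt p (coord_vec A c p u) (coord_vec A c p j) = \<alpha> (coord_vec A c p j)"
      unfolding L[OF j, symmetric] u using j by simp
  qed
  then show thesis using that t by blast
qed

lemma sharp_flat: "v \<in> TM p \<Longrightarrow> shp p (flt p v) = v"
  unfolding sharp_map_def by (rule inv_into_f_f) (auto intro: inj_onI flat_inj)

lemma sharp_tangent: "\<alpha> \<in> T'M p \<Longrightarrow> p \<in> points A \<Longrightarrow> shp p \<alpha> \<in> TM p"
  by (rule flat_surj) (auto simp: sharp_flat)

lemma flat_sharp: "\<alpha> \<in> T'M p \<Longrightarrow> p \<in> points A \<Longrightarrow> flt p (shp p \<alpha>) = \<alpha>"
  by (rule flat_surj) (auto simp: sharp_flat)

lemma sharp_add: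
  assumes "\<alpha> \<in> T'M p" "\<beta> \<in> T'M p" "p \<in> points A"
  shows "shp p (\<alpha> + \<beta>) = shp p \<alpha> + shp p \<beta>"
  using sharp_flat[OF tangent_add[OF sharp_tangent[OF assms(1,3)] sharp_tangent[OF assms(2,3)]]]
  by (simp add: flat_add sharp_tangent flat_sharp assms)

lemma sharp_scale:
  assumes "\<alpha> \<in> T'M p" "p \<in> points A"
  shows "shp p (r *\<^sub>R \<alpha>) = r *\<^sub>R shp p \<alpha>"
  using sharp_flat[OF tangent_scale[OF sharp_tangent[OF assms]], of r]
  by (simp add: flat_scale sharp_tangent flat_sharp assms)

lemma cotangent_add_closed: "\<alpha> \<in> T'M p \<Longrightarrow> \<beta> \<in> T'M p \<Longrightarrow> \<alpha> + \<beta> \<in> T'M p"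
  by (rule subspace_add[OF subspace_cotangent_space])

lemma cotangent_scale_closed: "\<alpha> \<in> T'M p \<Longrightarrow> r *\<^sub>R \<alpha> \<in> T'M p"
  by (rule subspace_scale[OF subspace_cotangent_space])

lemma cotangent_zero: "0 \<in> T'M p"
  by (rule subspace_0[OF subspace_cotangent_space])

lemma PN_point: "a \<in> PN \<Longrightarrow> fst a \<in> points A"
  by (simp add: PN_iff)

lemma tangent_zero: "p \<in> points A \<Longrightarrow> 0 \<in> TM p"
  by (rule subspace_0[OF subspace_tangent_space])

section \<open>Pointwise algebra of J\<close>

lemma J_Phi:
  "a \<in> PN \<Longrightarrow> v \<in> TM (fst a) \<Longrightarrow> \<alpha> \<in> T'M (fst a) \<Longrightarrow>
    J s a (PP a (v, \<alpha>)) = PP a (s *\<^sub>R shp (fst a) \<alpha>, flt (fst a) v)"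
  by (simp add: J_tilde_def Phi_inv_Phi J_hat_def)

lemma PW_Phi:
  "a \<in> PN \<Longrightarrow> v \<in> TM (fst a) \<Longrightarrow> \<alpha> \<in> T'M (fst a) \<Longrightarrow> w \<in> TM (fst a) \<Longrightarrow> \<beta> \<in> T'M (fst a) \<Longrightarrow>
    PW a (PP a (v, \<alpha>)) (PP a (w, \<beta>)) = \<alpha> w + \<beta> v"
  by (simp add: patterson_walker_def Phi_inv_Phi)

lemma J_hor_ver:
  assumes "a \<in> PN" "\<xi> \<in> TN a"
  shows "J s a \<xi> = PP a (s *\<^sub>R shp (fst a) (ver a \<xi>), flt (fst a) (hor a \<xi>))"
  using J_Phi[OF assms(1) hor_ver(1,2)[OF assms]] hor_ver(3)[OF assms] by metis

lemma PW_hor_ver: "PW a \<xi> \<eta> = ver a \<xi> (hor a \<eta>) + ver a \<eta> (hor a \<xi>)"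
  by (simp add: patterson_walker_def split: prod.splits)

lemma J_TN:
  assumes a: "a \<in> PN" and \<xi>: "\<xi> \<in> TN a"
  shows "J s a \<xi> \<in> TN a"
  unfolding J_hor_ver[OF assms]
  using hor_ver[OF assms] PN_point[OF a] by (intro Phi_TN[OF a] tangent_scale sharp_tangent flat_cotangent)

lemma J_squared:
  assumes a: "a \<in> PN" and \<xi>: "\<xi> \<in> TN a"
  shows "J s a (J s a \<xi>) = s *\<^sub>R \<xi>"
proof -
  obtain v \<alpha> where v: "v \<in> TM (fst a)" "\<alpha> \<in> T'M (fst a)" "\<xi> = PP a (v, \<alpha>)" by (rule TN_cases[OF assms])
  show ?thesis
    using v PN_point[OF a]
    by (simp add: J_Phi[OF a] Phi_scale[OF a] tangent_scale sharp_tangent flat_cotangent flat_scale flat_sharp sharp_flat)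
qed

lemma J_linear: "a \<in> PN \<Longrightarrow> linear_on (TN a) (J s a)"
proof -
  assume a: "a \<in> PN"
  note p = PN_point[OF a]
  show ?thesis unfolding linear_on_def
  proof (intro conjI ballI allI)
    fix \<xi> assume "\<xi> \<in> TN a"
    then obtain v \<alpha> where v: "v \<in> TM (fst a)" "\<alpha> \<in> T'M (fst a)" "\<xi> = PP a (v, \<alpha>)" by (rule TN_cases[OF a])
    show "J s a (r *\<^sub>R \<xi>) = r *\<^sub>R J s a \<xi>" for r
      using v p by (simp add: J_Phi[OF a] Phi_scale[OF a] tangent_scale cotangent_scale_closed sharp_tangent
          flat_cotangent flat_scale sharp_scale mult.commute)
    fix \<eta> assume "\<eta> \<in> TN a"
    then obtain w \<beta> where w: "w \<in> TM (fst a)" "\<beta> \<in> T'M (fst a)" "\<eta> = PP a (w, \<beta>)" by (rule TN_cases[OF a])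
    show "J s a (\<xi> + \<eta>) = J s a \<xi> + J s a \<eta>"
      using v w p by (simp add: J_Phi[OF a] Phi_add[OF a] tangent_scale tangent_add cotangent_add_closed sharp_tangent
          flat_cotangent flat_add sharp_add scaleR_add_right)
  qed
qed

section \<open>Smoothness of J\<close>

lemma smooth_near_h:
  assumes a: "a \<in> PN" and c: "c \<in> A" "fst a \<in> cdom c"
  shows "smooth_near (cotangent_atlas A) a (pull (\<lambda>q. h q (dd c i q) (dd c j q)))"
  by (intro smooth_near_pull a smooth_nearI[OF h_smooth[OF vfield_coord_vec vfield_coord_vec]] c)

lemma flat_expand:
  assumes c: "c \<in> A" "p \<in> cdom c" and v: "v \<in> TM p"
  shows "flt p v (dd c i p) = (\<Sum>j\<in>Basis. h p (dd c i p) (dd c j p) * v (coord c j))"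
proof -
  note t = coord_vec_in_tangent_space[OF c]
  have "flt p v (dd c i p) = flt p (dd c i p) v" using v t by (simp add: flat_apply h_sym)
  also have "\<dots> = (\<Sum>j\<in>Basis. v (coord c j) * flt p (dd c i p) (dd c j p))"
    by (rule cotangent_expand[OF flat_cotangent[OF t] c v])
  finally show ?thesis by (simp add: flat_apply t mult.commute)
qed

text \<open>The components v^j of h^{-1}(\<alpha>) solve h_ij v^j = \<alpha>_i, with coefficients
  pulled back from M and a right-hand side that lives on T*M. Smoothness therefore follows from that
  of linear systems on T*M.\<close>

lemma smooth_near_sharp:
  assumes W: "N.openM W" and \<alpha>: "\<And>b. b \<in> W \<Longrightarrow> \<alpha> b \<in> T'M (fst b)" and c: "c \<in> A" "\<And>b. b \<in> W \<Longrightarrow> fst b \<in> cdom c"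
    and s: "\<And>b i. b \<in> W \<Longrightarrow> i \<in> Basis \<Longrightarrow> smooth_near (cotangent_atlas A) b (\<lambda>b. \<alpha> b (dd c i (fst b)))"
    and a: "a \<in> W" and j: "j \<in> Basis"
  shows "smooth_near (cotangent_atlas A) a (\<lambda>b. shp (fst b) (\<alpha> b) (coord c j))"
proof -
  have WP: "b \<in> PN" if "b \<in> W" for b using W N.openM_subset that by blast
  have "smooth_fun (cotangent_atlas A) W (\<lambda>b. shp (fst b) (\<alpha> b) (coord c j))"
  proof (rule N.smooth_fun_linear_system[OF W, of "\<lambda>i j. pull (\<lambda>q. h q (dd c i q) (dd c j q))" "\<lambda>i b. \<alpha> b (dd c i (fst b))"
        "\<lambda>j b. shp (fst b) (\<alpha> b) (coord c j)"])
    show "smooth_fun (cotangent_atlas A) W (pull (\<lambda>q. h q (dd c i q) (dd c j q)))" for i j :: 'e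
      unfolding N.smooth_fun_iff using W WP c by (blast intro: smooth_near_h)
    show "smooth_fun (cotangent_atlas A) W (\<lambda>b. \<alpha> b (dd c i (fst b)))" if "i \<in> Basis" for i
      unfolding N.smooth_fun_iff using W s that by blast
    show "(\<Sum>j\<in>Basis. pull (\<lambda>q. h q (dd c i q) (dd c j q)) b * shp (fst b) (\<alpha> b) (coord c j)) = \<alpha> b (dd c i (fst b))"
      if b: "b \<in> W" and i: "i \<in> Basis" for b i
      using flat_expand[OF c(1) c(2)[OF b] sharp_tangent[OF \<alpha>[OF b] PN_point[OF WP[OF b]]], of i]
      by (simp add: flat_sharp[OF \<alpha>[OF b] PN_point[OF WP[OF b]]])
    fix b and u :: 'e
    assume b: "b \<in> W" and z: "\<And>i. i \<in> Basis \<Longrightarrow> (\<Sum>j\<in>Basis. pull (\<lambda>q. h q (dd c i q) (dd c j q)) b * (u \<bullet> j)) = 0"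
    note cb = c(1) c(2)[OF b]
    note t = coord_vec_in_tangent_space[OF cb]
    \<comment> \<open>A vector in the kernel of the matrix h_ij gives a tangent vector that
      \<open>flt\<close> sends to 0, so nondegeneracy of h makes the system uniquely
      solvable.\<close>
    have "flt (fst b) (coord_vec A c (fst b) u) = flt (fst b) 0"
    proof (rule cotangent_eqI[OF cb flat_cotangent[OF t] flat_cotangent[OF tangent_zero[OF pointsI[OF cb]]]])
      fix i :: 'e assume i: "i \<in> Basis"
      have "flt (fst b) (0 *\<^sub>R 0) = 0 *\<^sub>R flt (fst b) 0" by (rule flat_scale[OF tangent_zero[OF pointsI[OF cb]]])
      then show "flt (fst b) (coord_vec A c (fst b) u) (coord_vec A c (fst b) i) = flt (fst b) 0 (coord_vec A c (fst b) i)"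
        using flat_expand[OF cb t, of u i] z[OF i] by (simp add: coord_vec_coord[OF cb])
    qed
    then have "coord_vec A c (fst b) u = 0" by (rule flat_inj[OF t tangent_zero[OF pointsI[OF cb]]])
    then have "u \<bullet> k = 0" for k using coord_vec_coord[OF cb, of u k] by simp
    then show "u = 0" by (metis inner_eq_zero_iff)
  qed (rule j)
  then show ?thesis using a by (rule N.smooth_nearI)
qed

lemma chart_nbhd:
  assumes "N.openM W" "a \<in> W"
  obtains c where "c \<in> A" "fst a \<in> cdom c" "N.openM (W \<inter> over (cdom c))" "a \<in> W \<inter> over (cdom c)"
proof -
  have a: "a \<in> PN" using assms N.openM_subset by blast
  obtain c where c: "c \<in> A" "fst a \<in> cdom c" by (rule PN_chartE[OF a])
  show thesis
    by (rule that[OF c openin_Int[OF assms(1) open_over[OF openM_cdom[OF c(1)]]]]) (use assms a c in simp)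
qed

lemma smooth_near_sharp_ver:
  assumes \<Xi>: "smooth_vfield (cotangent_atlas A) W \<Xi>" and a: "a \<in> W" and c: "c \<in> A" "fst a \<in> cdom c" and j: "j \<in> Basis"
  shows "smooth_near (cotangent_atlas A) a (\<lambda>b. shp (fst b) (ver b (\<Xi> b)) (coord c j))"
proof (rule smooth_near_sharp[of "W \<inter> over (cdom c)"])
  have "a \<in> PN" using N.vfield_open[OF \<Xi>] N.openM_subset a by blast
  then show "a \<in> W \<inter> over (cdom c)" using a c by simp
  show "N.openM (W \<inter> over (cdom c))"
    by (rule openin_Int[OF N.vfield_open[OF \<Xi>] open_over[OF openM_cdom[OF c(1)]]])
  show "ver b (\<Xi> b) \<in> T'M (fst b)" if "b \<in> W \<inter> over (cdom c)" for b
    by (rule hor_ver(2)) (use that N.vfield_tangent[OF \<Xi>] in auto)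
  show "smooth_near (cotangent_atlas A) b (\<lambda>b. ver b (\<Xi> b) (dd c i (fst b)))"
    if "b \<in> W \<inter> over (cdom c)" "i \<in> Basis" for b i
    by (rule smooth_near_ver[OF \<Xi> _ c(1) _ that(2)]) (use that in auto)
qed (use c j in auto)

lemma J_field:
  assumes \<Xi>: "smooth_vfield (cotangent_atlas A) W \<Xi>"
  shows "smooth_vfield (cotangent_atlas A) W (\<lambda>b. J s b (\<Xi> b))"
proof -
  note t = N.vfield_tangent[OF \<Xi>] and W = N.vfield_open[OF \<Xi>]
  have WP: "b \<in> PN" if "b \<in> W" for b using W N.openM_subset that by blast
  have "smooth_vfield (cotangent_atlas A) W (\<lambda>b. PP b (s *\<^sub>R shp (fst b) (ver b (\<Xi> b)), flt (fst b) (hor b (\<Xi> b))))"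
  proof (rule vfield_Phi[OF W])
    fix a assume a: "a \<in> W"
    note hv = hor_ver[OF WP[OF a] t[OF a]]
    show "s *\<^sub>R shp (fst a) (ver a (\<Xi> a)) \<in> TM (fst a)"
      by (intro tangent_scale sharp_tangent hv PN_point WP a)
    show "flt (fst a) (hor a (\<Xi> a)) \<in> T'M (fst a)" by (intro flat_cotangent hv)
    obtain c where c: "c \<in> A" "fst a \<in> cdom c" and o: "N.openM (W \<inter> over (cdom c))" "a \<in> W \<inter> over (cdom c)"
      by (rule chart_nbhd[OF W a])
    have "smooth_near (cotangent_atlas A) a (\<lambda>b. (s *\<^sub>R shp (fst b) (ver b (\<Xi> b))) (coord c i))" if i: "i \<in> Basis" for i
      using N.smooth_near_mult[OF N.smooth_near_const[OF WP[OF a], of s] smooth_near_sharp_ver[OF \<Xi> a c i]] by simp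
    moreover have "smooth_near (cotangent_atlas A) a (\<lambda>b. flt (fst b) (hor b (\<Xi> b)) (dd c i (fst b)))" for i
    proof -
      have "smooth_near (cotangent_atlas A) a (\<lambda>b. \<Sum>j\<in>Basis. pull (\<lambda>q. h q (dd c i q) (dd c j q)) b * hor b (\<Xi> b) (coord c j))"
        by (intro N.smooth_near_sum N.smooth_near_mult smooth_near_h smooth_near_hor[OF \<Xi> a c] WP a c)
      then show ?thesis
      proof (rule N.smooth_near_cong[OF o, rotated])
        fix b assume b: "b \<in> W \<inter> over (cdom c)"
        then have bW: "b \<in> W" and bc: "fst b \<in> cdom c" by auto
        show "(\<Sum>j\<in>Basis. pull (\<lambda>q. h q (dd c i q) (dd c j q)) b * hor b (\<Xi> b) (coord c j)) =
            flt (fst b) (hor b (\<Xi> b)) (dd c i (fst b))"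
          by (rule flat_expand[OF c(1) bc hor_ver(1)[OF WP[OF bW] t[OF bW]], symmetric])
      qed
    qed
    ultimately show "\<exists>c\<in>A. fst a \<in> cdom c \<and>
      (\<forall>i\<in>Basis. smooth_near (cotangent_atlas A) a (\<lambda>b. (s *\<^sub>R shp (fst b) (ver b (\<Xi> b))) (coord c i)) \<and>
        smooth_near (cotangent_atlas A) a (\<lambda>b. flt (fst b) (hor b (\<Xi> b)) (dd c i (fst b))))"
      using c by (intro bexI[of _ c] conjI ballI) auto
  qed
  then show ?thesis
    by (rule N.vfield_cong) (simp only: J_hor_ver[OF WP t])
qed

lemma tensor11_J: "tensor11_field (cotangent_atlas A) (J s)"
  unfolding tensor11_field_def using J_linear J_field J_TN by blast

section \<open>The Patterson-Walker metric\<close>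

lemma PW_metric: "pseudo_riemannian_metric (cotangent_atlas A) PW"
  unfolding pseudo_riemannian_metric_def
proof (intro conjI ballI allI impI)
  fix a \<xi> assume a: "a \<in> PN" and \<xi>: "\<xi> \<in> TN a"
  note p = PN_point[OF a]
  obtain v \<alpha> where v: "v \<in> TM (fst a)" "\<alpha> \<in> T'M (fst a)" "\<xi> = PP a (v, \<alpha>)" by (rule TN_cases[OF a \<xi>])
  show "linear_on (TN a) (PW a \<xi>)"
    unfolding linear_on_def
  proof (intro conjI ballI allI)
    fix \<eta> assume "\<eta> \<in> TN a"
    then obtain w \<beta> where w: "w \<in> TM (fst a)" "\<beta> \<in> T'M (fst a)" "\<eta> = PP a (w, \<beta>)" by (rule TN_cases[OF a])
    show "PW a \<xi> (r *\<^sub>R \<eta>) = r *\<^sub>R PW a \<xi> \<eta>" for r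
      using v w by (simp add: PW_Phi[OF a] Phi_scale[OF a] tangent_scale cotangent_scale_closed cotangent_scale algebra_simps)
    fix \<eta>' assume "\<eta>' \<in> TN a"
    then obtain w' \<beta>' where w': "w' \<in> TM (fst a)" "\<beta>' \<in> T'M (fst a)" "\<eta>' = PP a (w', \<beta>')" by (rule TN_cases[OF a])
    show "PW a \<xi> (\<eta> + \<eta>') = PW a \<xi> \<eta> + PW a \<xi> \<eta>'"
      using v w w' by (simp add: PW_Phi[OF a] Phi_add[OF a] tangent_add cotangent_add_closed cotangent_add)
  qed
  show "PW a \<xi> \<eta> = PW a \<eta> \<xi>" for \<eta> by (simp add: PW_hor_ver)
  assume z: "\<forall>\<eta>\<in>TN a. PW a \<xi> \<eta> = 0"
  have z': "\<alpha> w + \<beta> v = 0" if "w \<in> TM (fst a)" "\<beta> \<in> T'M (fst a)" for w \<beta>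
    using z Phi_TN[OF a that] PW_Phi[OF a v(1,2) that] v(3) by simp
  \<comment> \<open>Horizontal test vectors annihilate \<alpha> on the tangent space; outside of it
    the normalisation of covectors gives 0.\<close>
  have "\<alpha> w = 0" for w
    using z'[OF _ cotangent_zero, of w] cotangent_outside[OF v(2), of w] by (cases "w \<in> TM (fst a)") auto
  then have \<alpha>: "\<alpha> = 0" by (simp add: fun_eq_iff)
  \<comment> \<open>Vertical test vectors h(w)^V turn the remaining condition into h(w, v) =
    0.\<close>
  have "h (fst a) v w = 0" if w: "w \<in> TM (fst a)" for w
    using z'[OF tangent_zero[OF p] flat_cotangent[OF w]] \<alpha> flat_apply[OF v(1), of w] h_sym[OF v(1) w] by simp
  then have "v = 0" by (rule h_nondegenerate[OF v(1)])
  then show "\<xi> = 0" using Phi_scale[OF a tangent_zero[OF p] cotangent_zero, of 0] v(3) \<alpha> by simp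
next
  fix W \<Xi> H assume "smooth_vfield (cotangent_atlas A) W \<Xi> \<and> smooth_vfield (cotangent_atlas A) W H"
  then have \<Xi>: "smooth_vfield (cotangent_atlas A) W \<Xi>" and H: "smooth_vfield (cotangent_atlas A) W H" by auto
  note W = N.vfield_open[OF \<Xi>]
  have WP: "b \<in> PN" if "b \<in> W" for b using W N.openM_subset that by blast
  show "smooth_fun (cotangent_atlas A) W (\<lambda>a. PW a (\<Xi> a) (H a))"
    unfolding N.smooth_fun_iff
  proof (intro conjI ballI W)
    fix a assume a: "a \<in> W"
    obtain c where c: "c \<in> A" "fst a \<in> cdom c" and o: "N.openM (W \<inter> over (cdom c))" "a \<in> W \<inter> over (cdom c)"
      by (rule chart_nbhd[OF W a])
    have "smooth_near (cotangent_atlas A) a (\<lambda>b. (\<Sum>i\<in>Basis. hor b (H b) (coord c i) * ver b (\<Xi> b) (dd c i (fst b))) +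
       (\<Sum>i\<in>Basis. hor b (\<Xi> b) (coord c i) * ver b (H b) (dd c i (fst b))))"
      by (intro N.smooth_near_add N.smooth_near_sum N.smooth_near_mult smooth_near_hor[OF \<Xi> a c] smooth_near_ver[OF \<Xi> a c]
          smooth_near_hor[OF H a c] smooth_near_ver[OF H a c] WP a)
    then show "smooth_near (cotangent_atlas A) a (\<lambda>a. PW a (\<Xi> a) (H a))"
    proof (rule N.smooth_near_cong[OF o, rotated])
      fix b assume b: "b \<in> W \<inter> over (cdom c)"
      then have bW: "b \<in> W" and bc: "fst b \<in> cdom c" by auto
      note x = hor_ver[OF WP[OF bW] N.vfield_tangent[OF \<Xi> bW]] and y = hor_ver[OF WP[OF bW] N.vfield_tangent[OF H bW]]
      show "(\<Sum>i\<in>Basis. hor b (H b) (coord c i) * ver b (\<Xi> b) (dd c i (fst b))) +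
       (\<Sum>i\<in>Basis. hor b (\<Xi> b) (coord c i) * ver b (H b) (dd c i (fst b))) = PW b (\<Xi> b) (H b)"
        unfolding PW_hor_ver cotangent_expand[OF x(2) c(1) bc y(1)] cotangent_expand[OF y(2) c(1) bc x(1)] ..
    qed
  qed
qed

text \<open>For \<xi> = (v, \<alpha>) and \<eta> = (w, \<beta>) the left-hand side is h(v, w) + s
  \<beta>(h^{-1}\<alpha>), and both terms are symmetric because h is.\<close>

lemma PW_J_symmetric: "metric_symmetric (cotangent_atlas A) (J s) PW"
  unfolding metric_symmetric_def
proof (intro ballI)
  fix a \<xi> \<eta> assume a: "a \<in> PN" and \<xi>: "\<xi> \<in> TN a" and \<eta>: "\<eta> \<in> TN a"
  note p = PN_point[OF a]
  obtain v \<alpha> where v: "v \<in> TM (fst a)" "\<alpha> \<in> T'M (fst a)" "\<xi> = PP a (v, \<alpha>)" by (rule TN_cases[OF a \<xi>])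
  obtain w \<beta> where w: "w \<in> TM (fst a)" "\<beta> \<in> T'M (fst a)" "\<eta> = PP a (w, \<beta>)" by (rule TN_cases[OF a \<eta>])
  have "\<beta> (shp (fst a) \<alpha>) = \<alpha> (shp (fst a) \<beta>)"
    using flat_apply[of "shp (fst a) \<alpha>" "fst a" "shp (fst a) \<beta>"] flat_apply[of "shp (fst a) \<beta>" "fst a" "shp (fst a) \<alpha>"]
      h_sym[of "shp (fst a) \<beta>" "fst a" "shp (fst a) \<alpha>"]
    by (simp add: flat_sharp sharp_tangent v w p)
  then show "PW a (J s a \<xi>) \<eta> = PW a \<xi> (J s a \<eta>)"
    using v w p
    by (simp add: J_Phi[OF a] PW_Phi[OF a] tangent_scale sharp_tangent flat_cotangent cotangent_scale flat_apply h_sym)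
qed

text \<open>The two dimensions are compared through a linear bijection, the sign change v + \<alpha>
  \<mapsto> v - \<alpha> of the vertical part; neither of them is computed.\<close>

lemma eigenspace_dims:
  assumes a: "a \<in> PN"
  shows "dim {\<xi> \<in> TN a. J 1 a \<xi> = \<xi>} = dim {\<xi> \<in> TN a. J 1 a \<xi> = - \<xi>}"
proof (rule dim_eq_if_linear_on_bij)
  note p = PN_point[OF a] and TN = N.subspace_tangent_space[OF a]
  have lin: "J 1 a (\<xi> + \<eta>) = J 1 a \<xi> + J 1 a \<eta>" "J 1 a (r *\<^sub>R \<xi>) = r *\<^sub>R J 1 a \<xi>"
    if "\<xi> \<in> TN a" "\<eta> \<in> TN a" for \<xi> \<eta> r
    using J_linear[OF a, of 1] that unfolding linear_on_def by blast+
  show "subspace {\<xi> \<in> TN a. J 1 a \<xi> = \<xi>}"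
  proof (rule subspaceI)
    have "J 1 a (0 *\<^sub>R 0) = 0 *\<^sub>R J 1 a 0" using lin(2) subspace_0[OF TN] by blast
    then show "0 \<in> {\<xi> \<in> TN a. J 1 a \<xi> = \<xi>}" using subspace_0[OF TN] by simp
  qed (auto simp: lin intro: subspace_add[OF TN] subspace_scale[OF TN])
  text \<open>\<open>K\<close> anticommutes with \<open>J 1 a\<close>, hence exchanges its two eigenspaces.\<close>
  define K where "K \<xi> = PP a (hor a \<xi>, - ver a \<xi>)" for \<xi>
  have K: "K (PP a (v, \<alpha>)) = PP a (v, - \<alpha>)" if "v \<in> TM (fst a)" "\<alpha> \<in> T'M (fst a)" for v \<alpha>
    unfolding K_def Phi_inv_Phi[OF a that] by simp
  have neg: "- \<alpha> \<in> T'M q" if "\<alpha> \<in> T'M q" for \<alpha> q using cotangent_scale_closed[OF that, of "-1"] by simp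
  have KT: "K \<xi> \<in> TN a" and KK: "K (K \<xi>) = \<xi>" and JK: "J 1 a (K \<xi>) = - K (J 1 a \<xi>)" if \<xi>: "\<xi> \<in> TN a" for \<xi>
  proof -
    obtain v \<alpha> where v: "v \<in> TM (fst a)" "\<alpha> \<in> T'M (fst a)" "\<xi> = PP a (v, \<alpha>)" by (rule TN_cases[OF a \<xi>])
    show "K \<xi> \<in> TN a" "K (K \<xi>) = \<xi>" using v by (simp_all add: K neg Phi_TN[OF a])
    have "shp (fst a) (- \<alpha>) = - shp (fst a) \<alpha>" using sharp_scale[OF v(2) p, of "-1"] by simp
    moreover have "- PP a (shp (fst a) \<alpha>, - flt (fst a) v) = PP a (- shp (fst a) \<alpha>, flt (fst a) v)"
      using Phi_scale[OF a sharp_tangent[OF v(2) p] neg[OF flat_cotangent[OF v(1)]], of "-1"] by simp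
    ultimately show "J 1 a (K \<xi>) = - K (J 1 a \<xi>)"
      using v p by (simp add: K neg J_Phi[OF a] sharp_tangent flat_cotangent)
  qed
  have Klin: "K (\<xi> + \<eta>) = K \<xi> + K \<eta>" "K (r *\<^sub>R \<xi>) = r *\<^sub>R K \<xi>" if \<xi>: "\<xi> \<in> TN a" and \<eta>: "\<eta> \<in> TN a" for \<xi> \<eta> r
  proof -
    obtain v \<alpha> where v: "v \<in> TM (fst a)" "\<alpha> \<in> T'M (fst a)" "\<xi> = PP a (v, \<alpha>)" by (rule TN_cases[OF a \<xi>])
    obtain w \<beta> where w: "w \<in> TM (fst a)" "\<beta> \<in> T'M (fst a)" "\<eta> = PP a (w, \<beta>)" by (rule TN_cases[OF a \<eta>])
    show "K (\<xi> + \<eta>) = K \<xi> + K \<eta>"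
      using v w by (simp add: Phi_add[OF a] K neg tangent_add cotangent_add_closed)
    show "K (r *\<^sub>R \<xi>) = r *\<^sub>R K \<xi>"
      using v by (simp add: Phi_scale[OF a] K neg tangent_scale cotangent_scale_closed)
  qed
  then show "linear_on {\<xi> \<in> TN a. J 1 a \<xi> = \<xi>} K" unfolding linear_on_def by blast
  have Kneg: "K (- \<xi>) = - K \<xi>" if "\<xi> \<in> TN a" for \<xi> using Klin(2)[OF that that, of "-1"] by simp
  show "bij_betw K {\<xi> \<in> TN a. J 1 a \<xi> = \<xi>} {\<xi> \<in> TN a. J 1 a \<xi> = - \<xi>}"
    by (rule bij_betw_byWitness[of _ K]) (auto simp: KK KT JK Kneg)
qed

lemma norden_cotangent:
  assumes "smooth_manifold A"
  shows "norden_manifold (cotangent_atlas A) (J (- 1)) PW"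
  unfolding norden_manifold_def almost_complex_manifold_def
  using smooth_manifold_cotangent[OF assms] tensor11_J J_squared[of _ _ "- 1"] PW_metric PW_J_symmetric by simp

lemma almost_para_norden_cotangent:
  assumes "smooth_manifold A"
  shows "almost_para_norden_manifold (cotangent_atlas A) (J 1) PW"
  unfolding almost_para_norden_manifold_def
  using smooth_manifold_cotangent[OF assms] tensor11_J J_squared[of _ _ 1] PW_metric PW_J_symmetric eigenspace_dims by simp

section \<open>Brackets of lifted vector fields\<close>

lemma HL_Phi: "a \<in> PN \<Longrightarrow> v \<in> TM (fst a) \<Longrightarrow> HL a v = PP a (v, 0)"
  using VL_scale[OF _ cotangent_zero, of a 0] by (simp add: Phi_def)

lemma VL_Phi: "a \<in> PN \<Longrightarrow> VL a \<alpha> = PP a (0, \<alpha>)"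
  using HL_scale[OF _ tangent_zero[OF PN_point], of a 0] by (simp add: Phi_def)

text \<open>The right-hand side does not contain s: the brackets of horizontal lifts and of their
  images under J are the same for both structures.\<close>

lemma J_HL: "a \<in> PN \<Longrightarrow> v \<in> TM (fst a) \<Longrightarrow> J s a (HL a v) = VL a (flt (fst a) v)"
  using sharp_scale[OF cotangent_zero PN_point, of a 0]
  by (simp add: HL_Phi VL_Phi J_Phi cotangent_zero)

lemma HL_field:
  assumes X: "smooth_vfield A W X"
  shows "smooth_vfield (cotangent_atlas A) (over W) (\<lambda>b. HL b (X (fst b)))"
proof -
  have o: "N.openM (over W)" by (rule open_over[OF vfield_open[OF X]])
  have "smooth_vfield (cotangent_atlas A) (over W) (\<lambda>b. PP b (X (fst b), 0))"
  proof (rule vfield_Phi[OF o _ cotangent_zero])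
    fix a assume a: "a \<in> over W"
    then show "X (fst a) \<in> TM (fst a)" using vfield_tangent[OF X] by simp
    obtain c where c: "c \<in> A" "fst a \<in> cdom c" using a PN_chartE by blast
    show "\<exists>c\<in>A. fst a \<in> cdom c \<and> (\<forall>i\<in>Basis. smooth_near (cotangent_atlas A) a (\<lambda>b. X (fst b) (coord c i)) \<and>
         smooth_near (cotangent_atlas A) a (\<lambda>b. 0 (dd c i (fst b))))"
    proof (intro bexI[OF _ c(1)] conjI ballI c(2))
      show "smooth_near (cotangent_atlas A) a (\<lambda>b. X (fst b) (coord c i))" for i
        using a c smooth_near_pull[OF vfield_comp_smooth[OF X c(1), of "fst a" i]] by simp
      show "smooth_near (cotangent_atlas A) a (\<lambda>b. 0 (dd c i (fst b)))" for i
        using a N.smooth_near_const[of a 0] by simp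
    qed
  qed
  then show ?thesis
    by (rule N.vfield_cong) (use vfield_tangent[OF X] in \<open>simp add: HL_Phi\<close>)
qed

abbreviation HF :: "'a vfield \<Rightarrow> 'a cotangent vfield"
  where "HF X \<equiv> \<lambda>b. HL b (X (fst b))"

abbreviation VF :: "'a vfield \<Rightarrow> 'a cotangent vfield"
  where "VF X \<equiv> \<lambda>b. VL b (flt (fst b) (X (fst b)))"

abbreviation NB :: "'a cotangent vfield \<Rightarrow> 'a cotangent vfield \<Rightarrow> 'a cotangent vfield"
  where "NB \<equiv> lie_bracket (cotangent_atlas A)"

lemma J_HF:
  assumes X: "smooth_vfield A W X" and b: "b \<in> over W"
  shows "J s b (HF X b) = VF X b"
  using b by (simp add: J_HL vfield_tangent[OF X])

lemma VF_field:
  assumes X: "smooth_vfield A W X"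
  shows "smooth_vfield (cotangent_atlas A) (over W) (VF X)"
  by (rule N.vfield_cong[OF J_field[OF HL_field[OF X], of 1]]) (rule J_HF[OF X])

context
  fixes W X Y a c
  assumes X: "smooth_vfield A W X" and Y: "smooth_vfield A W Y" and a: "a \<in> over W"
    and c: "c \<in> A" "fst a \<in> cdom c"
begin

private abbreviation (input) "V \<equiv> W \<inter> cdom c"

text \<open>Everything is restricted to the part of W inside one chart, where X, Y and the
  coordinate fields are smooth on a common open set. As tangent vectors and \<open>nabla\<close> are
  local, the values at a are not affected.\<close>

lemma bracket_chart_facts:
  "a \<in> PN" "fst a \<in> W" "fst a \<in> V" "a \<in> over V" "N.openM (over V)"
  "smooth_vfield A V X" "smooth_vfield A V Y" "smooth_vfield A V (dd c i)"
  "smooth_near (cotangent_atlas A) a (pull (coord c i))"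
  "smooth_near (cotangent_atlas A) a (iota (dd c i))"
proof -
  show *: "a \<in> PN" "fst a \<in> W" "fst a \<in> V" "a \<in> over V" using a c by auto
  show "smooth_vfield A V X" "smooth_vfield A V Y" "smooth_vfield A V (dd c i)"
    by (rule vfield_restrict_chart[OF X c(1)], rule vfield_restrict_chart[OF Y c(1)], rule vfield_dd[OF X c(1)])
  from open_over[OF vfield_open[OF this(1)]] show "N.openM (over V)" .
  show "smooth_near (cotangent_atlas A) a (pull (coord c i))"
    by (rule smooth_near_pull[OF smooth_near_coord[OF c] *(1)])
  show "smooth_near (cotangent_atlas A) a (iota (dd c i))"
    by (rule smooth_near_iota[OF vfield_dd[OF X c(1)] *(4)])
qed

lemma HF_pull_coord:
  assumes "smooth_vfield A W Z" "b \<in> over V"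
  shows "HF Z b (pull (coord c i)) = pull (\<lambda>q. Z q (coord c i)) b"
  using assms(2) by (intro HL_pull smooth_near_coord c(1) vfield_tangent[OF assms(1)]) auto

lemma VF_pull_coord:
  assumes "smooth_vfield A W Z" "b \<in> over V"
  shows "VF Z b (pull (coord c i)) = 0"
  using assms(2) by (intro VL_pull flat_cotangent smooth_near_coord c(1) vfield_tangent[OF assms(1)]) auto

lemma HF_iota_dd:
  assumes Z: "smooth_vfield A W Z" and b: "b \<in> over V"
  shows "HF Z b (iota (dd c i)) = iota (nabla Z (dd c i)) b"
  by (rule HL_iota[OF _ vfield_restrict_chart[OF Z c(1)] vfield_dd[OF Z c(1)]]) (use b in auto)

lemma VF_iota_dd:
  assumes Z: "smooth_vfield A W Z" and b: "b \<in> over V"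
  shows "VF Z b (iota (dd c i)) = pull (\<lambda>q. h q (Z q) (dd c i q)) b"
proof -
  have 1: "b \<in> PN" "fst b \<in> V" "fst b \<in> W" "fst b \<in> cdom c" using b by auto
  have "VF Z b (iota (dd c i)) = flt (fst b) (Z (fst b)) (dd c i (fst b))"
    by (rule VL_iota[OF 1(1) vfield_dd[OF Z c(1)] 1(2) flat_cotangent[OF vfield_tangent[OF Z 1(3)]]])
  then show ?thesis using 1 c by (simp add: flat_apply coord_vec_in_tangent_space)
qed

text \<open>On a neighbourhood of a the inner lift yields a pullback or a fibrewise linear function,
  so locality lets the outer lift be evaluated by the rules for single lifts.\<close>

lemma HF_HF_second:
  "HF X a (\<lambda>b. HF Y b (pull (coord c i))) = X (fst a) (\<lambda>q. Y q (coord c i))"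
  "HF X a (\<lambda>b. HF Y b (iota (dd c i))) = snd a (nabla X (nabla Y (dd c i)) (fst a))"
proof -
  note f = bracket_chart_facts
  note t = N.vfield_tangent[OF HL_field[OF X] a]
  have "HF X a (\<lambda>b. HF Y b (pull (coord c i))) = HF X a (pull (\<lambda>q. Y q (coord c i)))"
    by (rule N.tangent_cong[OF t f(5,4)]) (rule HF_pull_coord[OF Y])
  also have "\<dots> = X (fst a) (\<lambda>q. Y q (coord c i))"
    by (rule HL_pull[OF f(1) vfield_tangent[OF X f(2)] vfield_comp_smooth[OF Y c(1) f(3)]])
  finally show "HF X a (\<lambda>b. HF Y b (pull (coord c i))) = X (fst a) (\<lambda>q. Y q (coord c i))" .
  have "HF X a (\<lambda>b. HF Y b (iota (dd c i))) = HF X a (iota (nabla Y (dd c i)))"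
    by (rule N.tangent_cong[OF t f(5,4)]) (rule HF_iota_dd[OF Y])
  also have "\<dots> = snd a (nabla X (nabla Y (dd c i)) (fst a))"
    by (rule HL_iota[OF f(1) f(6) nabla_vfield[OF f(7,8)] f(3)])
  finally show "HF X a (\<lambda>b. HF Y b (iota (dd c i))) = snd a (nabla X (nabla Y (dd c i)) (fst a))" .
qed

lemma HF_VF_second:
  "HF X a (\<lambda>b. VF Y b (pull (coord c i))) = 0"
  "HF X a (\<lambda>b. VF Y b (iota (dd c i))) = X (fst a) (\<lambda>q. h q (Y q) (dd c i q))"
proof -
  note f = bracket_chart_facts
  note t = N.vfield_tangent[OF HL_field[OF X] a]
  have "HF X a (\<lambda>b. VF Y b (pull (coord c i))) = HF X a (\<lambda>b. 0)"
    by (rule N.tangent_cong[OF t f(5,4)]) (rule VF_pull_coord[OF Y])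
  then show "HF X a (\<lambda>b. VF Y b (pull (coord c i))) = 0" by (simp add: N.tangent_const[OF t])
  have "HF X a (\<lambda>b. VF Y b (iota (dd c i))) = HF X a (pull (\<lambda>q. h q (Y q) (dd c i q)))"
    by (rule N.tangent_cong[OF t f(5,4)]) (rule VF_iota_dd[OF Y])
  also have "\<dots> = X (fst a) (\<lambda>q. h q (Y q) (dd c i q))"
    by (rule HL_pull[OF f(1) vfield_tangent[OF X f(2)] smooth_nearI[OF h_smooth[OF f(7,8)] f(3)]])
  finally show "HF X a (\<lambda>b. VF Y b (iota (dd c i))) = X (fst a) (\<lambda>q. h q (Y q) (dd c i q))" .
qed

lemma VF_HF_second:
  "VF Y a (\<lambda>b. HF X b (pull (coord c i))) = 0"
  "VF Y a (\<lambda>b. HF X b (iota (dd c i))) = h (fst a) (Y (fst a)) (nabla X (dd c i) (fst a))"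
proof -
  note f = bracket_chart_facts
  note t = N.vfield_tangent[OF VF_field[OF Y] a] and Yt = vfield_tangent[OF Y f(2)]
  have "VF Y a (\<lambda>b. HF X b (pull (coord c i))) = VF Y a (pull (\<lambda>q. X q (coord c i)))"
    by (rule N.tangent_cong[OF t f(5,4)]) (rule HF_pull_coord[OF X])
  also have "\<dots> = 0"
    by (rule VL_pull[OF f(1) flat_cotangent[OF Yt] vfield_comp_smooth[OF X c(1) f(3)]])
  finally show "VF Y a (\<lambda>b. HF X b (pull (coord c i))) = 0" .
  have "VF Y a (\<lambda>b. HF X b (iota (dd c i))) = VF Y a (iota (nabla X (dd c i)))"
    by (rule N.tangent_cong[OF t f(5,4)]) (rule HF_iota_dd[OF X])
  also have "\<dots> = flt (fst a) (Y (fst a)) (nabla X (dd c i) (fst a))"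
    by (rule VL_iota[OF f(1) nabla_vfield[OF f(6,8)] f(3) flat_cotangent[OF Yt]])
  also have "\<dots> = h (fst a) (Y (fst a)) (nabla X (dd c i) (fst a))"
    by (rule flat_apply[OF vfield_tangent[OF nabla_vfield[OF f(6,8)] f(3)]])
  finally show "VF Y a (\<lambda>b. HF X b (iota (dd c i))) = h (fst a) (Y (fst a)) (nabla X (dd c i) (fst a))" .
qed

text \<open>A vertical lift maps a fibrewise linear function to a pullback, and the second vertical
  lift annihilates pullbacks.\<close>

lemma VF_VF_second:
  "VF X a (\<lambda>b. VF Y b (pull (coord c i))) = 0"
  "VF X a (\<lambda>b. VF Y b (iota (dd c i))) = 0"
proof -
  note f = bracket_chart_facts
  note t = N.vfield_tangent[OF VF_field[OF X] a]
  have "VF X a (\<lambda>b. VF Y b (pull (coord c i))) = VF X a (\<lambda>b. 0)"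
    by (rule N.tangent_cong[OF t f(5,4)]) (rule VF_pull_coord[OF Y])
  then show "VF X a (\<lambda>b. VF Y b (pull (coord c i))) = 0" by (simp add: N.tangent_const[OF t])
  have "VF X a (\<lambda>b. VF Y b (iota (dd c i))) = VF X a (pull (\<lambda>q. h q (Y q) (dd c i q)))"
    by (rule N.tangent_cong[OF t f(5,4)]) (rule VF_iota_dd[OF Y])
  also have "\<dots> = 0"
    by (rule VL_pull[OF f(1) flat_cotangent[OF vfield_tangent[OF X f(2)]] smooth_nearI[OF h_smooth[OF f(7,8)] f(3)]])
  finally show "VF X a (\<lambda>b. VF Y b (iota (dd c i))) = 0" .
qed

end

lemma bracket_VF_VF:
  assumes X: "smooth_vfield A W X" and Y: "smooth_vfield A W Y" and a: "a \<in> over W"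
  shows "NB (VF X) (VF Y) a = 0"
proof -
  have aP: "a \<in> PN" using a by simp
  obtain c where c: "c \<in> A" "fst a \<in> cdom c" by (rule PN_chartE[OF aP])
  note f = bracket_chart_facts[OF X Y a c]
  show ?thesis
  proof (rule TN_eqI[OF aP c N.lie_bracket_tangent[OF VF_field[OF X] VF_field[OF Y] a]
        subspace_0[OF N.subspace_tangent_space[OF aP]]])
    show "NB (VF X) (VF Y) a (pull (coord c i)) = 0 (pull (coord c i))" for i
      by (simp add: N.lie_bracket_apply[OF f(9)] VF_VF_second[OF X Y a c] VF_VF_second[OF Y X a c])
    show "NB (VF X) (VF Y) a (iota (dd c i)) = 0 (iota (dd c i))" for i
      by (simp add: N.lie_bracket_apply[OF f(10)] VF_VF_second[OF X Y a c] VF_VF_second[OF Y X a c])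
  qed
qed

text \<open>On pullbacks both sides are [X,Y]. On iota_Z the difference of the two sides is alpha
  applied to the curvature R(X,Y)Z, which flatness removes.\<close>

lemma bracket_HF_HF:
  assumes flat: "flat_connection A nabla"
    and X: "smooth_vfield A W X" and Y: "smooth_vfield A W Y" and a: "a \<in> over W"
  shows "NB (HF X) (HF Y) a = HF (lie_bracket A X Y) a"
proof -
  have aP: "a \<in> PN" using a by simp
  have al: "snd a \<in> T'M (fst a)" using aP by (simp add: PN_iff)
  obtain c where c: "c \<in> A" "fst a \<in> cdom c" by (rule PN_chartE[OF aP])
  note f = bracket_chart_facts[OF X Y a c]
  note B = vfield_lie_bracket[OF X Y]
  show ?thesis
  proof (rule TN_eqI[OF aP c N.lie_bracket_tangent[OF HL_field[OF X] HL_field[OF Y] a]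
        N.vfield_tangent[OF HL_field[OF B] a]])
    fix i :: 'e
    show "NB (HF X) (HF Y) a (pull (coord c i)) = HF (lie_bracket A X Y) a (pull (coord c i))"
      using HF_pull_coord[OF X Y a c B f(4)]
      by (simp add: N.lie_bracket_apply[OF f(9)] HF_HF_second[OF X Y a c] HF_HF_second[OF Y X a c]
          lie_bracket_apply[OF smooth_near_coord[OF c]])
    let ?Z = "dd c i" and ?p = "fst a"
    note nt = vfield_tangent[OF nabla_vfield f(3)]
    have "curvature A nabla X Y ?Z ?p = 0"
      using flat f(3,6,7,8) unfolding flat_connection_def by blast
    then have "nabla X (nabla Y ?Z) ?p = nabla Y (nabla X ?Z) ?p + nabla (lie_bracket A X Y) ?Z ?p"
      unfolding curvature_def by (simp add: algebra_simps)
    then have "snd a (nabla X (nabla Y ?Z) ?p) = snd a (nabla Y (nabla X ?Z) ?p) + snd a (nabla (lie_bracket A X Y) ?Z ?p)"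
      using cotangent_add[OF al nt nt] nabla_vfield[OF f(6,8)] f(6,7,8) vfield_lie_bracket[OF f(6,7)] by metis
    then show "NB (HF X) (HF Y) a (iota ?Z) = HF (lie_bracket A X Y) a (iota ?Z)"
      using HF_iota_dd[OF X Y a c B f(4)]
      by (simp add: N.lie_bracket_apply[OF f(10)] HF_HF_second[OF X Y a c] HF_HF_second[OF Y X a c])
  qed
qed

text \<open>On iota_Z the left-hand side is X h(Y,Z) - h(Y, nabla_X Z) - Y h(X,Z) + h(X, nabla_Y Z),
  that is, (nabla_X h)(Y,Z) - (nabla_Y h)(X,Z) + h(nabla_X Y - nabla_Y X, Z). Replacing the last
  difference by T(X,Y) + [X,Y], the quasi-statistical identity leaves h([X,Y], Z).\<close>

lemma bracket_HF_VF:
  assumes quasi: "quasi_statistical_manifold A h nabla"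
    and X: "smooth_vfield A W X" and Y: "smooth_vfield A W Y" and a: "a \<in> over W"
  shows "NB (VF X) (HF Y) a + NB (HF X) (VF Y) a = VF (lie_bracket A X Y) a"
proof -
  have aP: "a \<in> PN" using a by simp
  obtain c where c: "c \<in> A" "fst a \<in> cdom c" by (rule PN_chartE[OF aP])
  note f = bracket_chart_facts[OF X Y a c]
  note B = vfield_lie_bracket[OF X Y]
  show ?thesis
  proof (rule TN_eqI[OF aP c _ N.vfield_tangent[OF VF_field[OF B] a]])
    show "NB (VF X) (HF Y) a + NB (HF X) (VF Y) a \<in> TN a"
      by (intro N.tangent_add N.lie_bracket_tangent[OF _ _ a] VF_field HL_field X Y)
    fix i :: 'e
    show "(NB (VF X) (HF Y) a + NB (HF X) (VF Y) a) (pull (coord c i)) = VF (lie_bracket A X Y) a (pull (coord c i))"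
      using VF_pull_coord[OF X Y a c B f(4)]
      by (simp add: N.lie_bracket_apply[OF f(9)] HF_VF_second[OF X Y a c] HF_VF_second[OF Y X a c]
          VF_HF_second[OF X Y a c] VF_HF_second[OF Y X a c])
    let ?Z = "dd c i" and ?p = "fst a"
    have Zt: "?Z ?p \<in> TM ?p" by (rule coord_vec_in_tangent_space[OF c])
    have q: "cov_deriv_metric nabla h X Y ?Z ?p - cov_deriv_metric nabla h Y X ?Z ?p + h ?p (torsion A nabla X Y ?p) (?Z ?p) = 0"
      using quasi f(3,6,7,8) unfolding quasi_statistical_manifold_def by blast
    have nt: "nabla X Y ?p \<in> TM ?p" "nabla Y X ?p \<in> TM ?p" "lie_bracket A X Y ?p \<in> TM ?p"
      using nabla_vfield[OF X Y] nabla_vfield[OF Y X] B f(2) vfield_tangent by blast+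
    have Tt: "torsion A nabla X Y ?p \<in> TM ?p"
      unfolding torsion_def by (intro tangent_diff nt)
    \<comment> \<open>The definition of the torsion is solved for nabla_X Y, so that additivity of
      \<open>flt\<close> alone splits h(nabla_X Y, Z).\<close>
    have "nabla X Y ?p = torsion A nabla X Y ?p + (nabla Y X ?p + lie_bracket A X Y ?p)"
      by (simp add: torsion_def)
    then have "flt ?p (nabla X Y ?p) (?Z ?p) = flt ?p (torsion A nabla X Y ?p + (nabla Y X ?p + lie_bracket A X Y ?p)) (?Z ?p)"
      by (rule arg_cong)
    also have "\<dots> = flt ?p (torsion A nabla X Y ?p) (?Z ?p) + (flt ?p (nabla Y X ?p) (?Z ?p) + flt ?p (lie_bracket A X Y ?p) (?Z ?p))"
      by (simp only: flat_add[OF Tt tangent_add[OF nt(2,3)]] flat_add[OF nt(2,3)] plus_fun_apply)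
    finally have "h ?p (nabla X Y ?p) (?Z ?p) =
        h ?p (torsion A nabla X Y ?p) (?Z ?p) + (h ?p (nabla Y X ?p) (?Z ?p) + h ?p (lie_bracket A X Y ?p) (?Z ?p))"
      by (simp only: flat_apply[OF Zt])
    then show "(NB (VF X) (HF Y) a + NB (HF X) (VF Y) a) (iota ?Z) = VF (lie_bracket A X Y) a (iota ?Z)"
      using VF_iota_dd[OF X Y a c B f(4)] q
      by (simp add: cov_deriv_metric_def N.lie_bracket_apply[OF f(10)] HF_VF_second[OF X Y a c] HF_VF_second[OF Y X a c]
          VF_HF_second[OF X Y a c] VF_HF_second[OF Y X a c])
  qed
qed

section \<open>Integrability\<close>

lemma smooth_tensor11_J: "smooth_tensor11 (cotangent_atlas A) (J s)"
  by unfold_locales (rule tensor11_J)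

text \<open>The bracket of the two vertical fields vanishes, which leaves J applied to J[X^H,Y^H]
  minus the sum of the mixed brackets. Flatness gives J[X^H,Y^H] = h([X,Y])^V, and the
  quasi-statistical condition identifies this with that sum. The argument is uniform in s.\<close>

lemma nijenhuis_HF:
  assumes fq: "flat_quasi_statistical_manifold A h nabla"
    and X: "smooth_vfield A W X" and Y: "smooth_vfield A W Y" and a: "a \<in> over W"
  shows "nijenhuis (cotangent_atlas A) (J s) (HF X) (HF Y) a = 0"
proof -
  interpret NJ: smooth_tensor11 "cotangent_atlas A" "J s" by (rule smooth_tensor11_J)
  have flat: "flat_connection A nabla" and quasi: "quasi_statistical_manifold A h nabla"
    using fq by (simp_all add: flat_quasi_statistical_manifold_def)
  have aP: "a \<in> PN" using a by simp
  note VX = VF_field[OF X] and VY = VF_field[OF Y] and HX = HL_field[OF X] and HY = HL_field[OF Y]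
  have 1: "NB (\<lambda>b. J s b (HF X b)) (\<lambda>b. J s b (HF Y b)) a = 0"
    using N.lie_bracket_cong[OF VX VY a, of "\<lambda>b. J s b (HF X b)" "\<lambda>b. J s b (HF Y b)"]
      J_HF[OF X] J_HF[OF Y] bracket_VF_VF[OF X Y a] by simp
  have 2: "NB (\<lambda>b. J s b (HF X b)) (HF Y) a = NB (VF X) (HF Y) a"
    by (rule N.lie_bracket_cong[OF VX HY a, symmetric]) (simp_all only: J_HF[OF X])
  have 3: "NB (HF X) (\<lambda>b. J s b (HF Y b)) a = NB (HF X) (VF Y) a"
    by (rule N.lie_bracket_cong[OF HX VY a, symmetric]) (simp_all only: J_HF[OF Y])
  have t: "NB (VF X) (HF Y) a \<in> TN a" "NB (HF X) (VF Y) a \<in> TN a"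
    by (rule N.lie_bracket_tangent[OF VX HY a], rule N.lie_bracket_tangent[OF HX VY a])
  have "J s a (NB (HF X) (HF Y) a) = VF (lie_bracket A X Y) a"
    unfolding bracket_HF_HF[OF flat X Y a] by (rule J_HF[OF vfield_lie_bracket[OF X Y] a])
  then have "J s a (NB (HF X) (HF Y) a) = NB (VF X) (HF Y) a + NB (HF X) (VF Y) a"
    unfolding bracket_HF_VF[OF quasi X Y a] .
  then show ?thesis
    unfolding nijenhuis_def 1 2 3 by (simp add: NJ.J_add[OF t])
qed

lemma HL_linear: "a \<in> PN \<Longrightarrow> c \<in> A \<Longrightarrow> fst a \<in> cdom c \<Longrightarrow> linear (\<lambda>u. HL a (coord_vec A c (fst a) u))"
  by (rule linearI)
    (simp_all add: linear_add[OF linear_coord_vec] linear_scale[OF linear_coord_vec] HL_add HL_scale coord_vec_in_tangent_space)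

lemma HL_expand:
  assumes a: "a \<in> PN" and c: "c \<in> A" "fst a \<in> cdom c" and v: "v \<in> TM (fst a)"
  shows "HL a v = (\<Sum>i\<in>Basis. v (coord c i) *\<^sub>R HL a (dd c i (fst a)))"
    and "J s a (HL a v) = (\<Sum>i\<in>Basis. v (coord c i) *\<^sub>R J s a (HL a (dd c i (fst a))))"
proof -
  interpret NJ: smooth_tensor11 "cotangent_atlas A" "J s" by (rule smooth_tensor11_J)
  let ?u = "\<Sum>i\<in>Basis. v (coord c i) *\<^sub>R i"
  note l = HL_linear[OF a c] and t = HL_TN[OF a coord_vec_in_tangent_space[OF c]]
  have l': "linear (\<lambda>u. J s a (HL a (coord_vec A c (fst a) u)))"
    by (rule linearI) (simp_all add: linear_add[OF l] linear_scale[OF l] NJ.J_add[OF t t] NJ.J_scale[OF t])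
  have u: "coord_vec A c (fst a) ?u = v" by (rule tangent_eq_coord_vec[OF c v, symmetric])
  show "HL a v = (\<Sum>i\<in>Basis. v (coord c i) *\<^sub>R HL a (dd c i (fst a)))"
    using linear_basis_expansion[OF l, of ?u] unfolding u by simp
  show "J s a (HL a v) = (\<Sum>i\<in>Basis. v (coord c i) *\<^sub>R J s a (HL a (dd c i (fst a))))"
    using linear_basis_expansion[OF l', of ?u] unfolding u by simp
qed

text \<open>A vertical lift is J applied to the horizontal lift of its image under h^{-1}, so the
  coordinate horizontal lifts and their images under J form a frame, with the components of hor and
  of h^{-1}(ver) as coefficients.\<close>

lemma TN_frame:
  assumes a: "a \<in> PN" and c: "c \<in> A" "fst a \<in> cdom c" and \<xi>: "\<xi> \<in> TN a"
  shows "\<xi> = (\<Sum>i\<in>Basis. hor a \<xi> (coord c i) *\<^sub>R HL a (dd c i (fst a))) +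
    (\<Sum>i\<in>Basis. shp (fst a) (ver a \<xi>) (coord c i) *\<^sub>R J s a (HL a (dd c i (fst a))))"
proof -
  note hv = hor_ver[OF a \<xi>] and p = PN_point[OF a]
  have "HL a (hor a \<xi>) + J s a (HL a (shp (fst a) (ver a \<xi>))) = PP a (hor a \<xi>, ver a \<xi>)"
    by (simp add: J_HL[OF a] sharp_tangent flat_sharp hv(1,2) p Phi_def case_prod_unfold)
  then have "HL a (hor a \<xi>) + J s a (HL a (shp (fst a) (ver a \<xi>))) = \<xi>"
    unfolding hv(3)[symmetric] .
  then show ?thesis
    unfolding HL_expand(1)[OF a c hv(1), symmetric] HL_expand(2)[OF a c sharp_tangent[OF hv(2) p], symmetric]
    by (rule sym)
qed

text \<open>Arbitrary fields on T*M are not lifts, but near a they are combinations of the frame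
  with smooth coefficients, and the Nijenhuis tensor is linear over functions.\<close>

lemma integrable_J:
  assumes fq: "flat_quasi_statistical_manifold A h nabla"
  shows "integrable_tensor11 (cotangent_atlas A) (J s)"
  unfolding integrable_tensor11_def
proof (intro allI impI ballI)
  interpret NJ: smooth_tensor11 "cotangent_atlas A" "J s" by (rule smooth_tensor11_J)
  fix W \<Xi> H a
  assume "smooth_vfield (cotangent_atlas A) W \<Xi> \<and> smooth_vfield (cotangent_atlas A) W H" and a: "a \<in> W"
  then have \<Xi>: "smooth_vfield (cotangent_atlas A) W \<Xi>" and H: "smooth_vfield (cotangent_atlas A) W H" by auto
  note W = N.vfield_open[OF \<Xi>]
  obtain c where c: "c \<in> A" "fst a \<in> cdom c" and V: "N.openM (W \<inter> over (cdom c))" "a \<in> W \<inter> over (cdom c)"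
    by (rule chart_nbhd[OF W a])
  let ?V = "W \<inter> over (cdom c)"
  \<comment> \<open>The Boolean index marks the frame fields that are images under J; f gives the
    matching coefficients.\<close>
  define E where "E = (\<lambda>(i, k). if k then (\<lambda>b. J s b (HF (dd c i) b)) else HF (dd c i))"
  define f where "f Z = (\<lambda>(i, k). if k then (\<lambda>b. shp (fst b) (ver b (Z b)) (coord c i)) else (\<lambda>b. hor b (Z b) (coord c i)))"
    for Z :: "'a cotangent vfield"
  let ?I = "(Basis :: 'e set) \<times> (UNIV :: bool set)"
  note dd = vfield_coord_vec[OF c(1)]
  have ao: "a \<in> over (cdom c)" using V by simp
  have HFs: "smooth_vfield (cotangent_atlas A) ?V (HF (dd c i))" for i
    by (rule N.vfield_subset[OF HL_field[OF dd] V(1)]) simp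
  have Es: "smooth_vfield (cotangent_atlas A) ?V (E k)" for k
    using HFs J_field[OF HFs] by (cases k) (simp add: E_def)
  have fs: "smooth_fun (cotangent_atlas A) ?V (f Z k)" if Z: "smooth_vfield (cotangent_atlas A) W Z" and k: "k \<in> ?I" for Z k
    unfolding N.smooth_fun_iff
  proof (intro conjI ballI V(1))
    fix b assume "b \<in> ?V"
    then have b: "b \<in> W" "fst b \<in> cdom c" by auto
    obtain i l where kil: "k = (i, l)" "i \<in> Basis" using k by auto
    show "smooth_near (cotangent_atlas A) b (f Z k)"
      using smooth_near_hor[OF Z b(1) c(1) b(2)] smooth_near_sharp_ver[OF Z b(1) c(1) b(2) kil(2)]
      by (cases l) (simp_all add: f_def kil)
  qed
  have frame: "Z b = (\<Sum>k\<in>?I. f Z k b *\<^sub>R E k b)" if Z: "smooth_vfield (cotangent_atlas A) W Z" and "b \<in> ?V" for Z b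
  proof -
    have b: "b \<in> W" "fst b \<in> cdom c" "b \<in> PN" using that by auto
    have "(\<Sum>k\<in>?I. f Z k b *\<^sub>R E k b) = (\<Sum>i\<in>Basis. \<Sum>l\<in>UNIV. f Z (i, l) b *\<^sub>R E (i, l) b)"
      by (simp add: sum.cartesian_product)
    also have "\<dots> = Z b"
      unfolding UNIV_bool using TN_frame[OF b(3) c(1) b(2) N.vfield_tangent[OF Z b(1)], of s]
      by (simp add: f_def E_def sum.distrib)
    finally show ?thesis ..
  qed
  have J2: "J s b (J s b v) = s *\<^sub>R v" if "v \<in> TN b" for b v
    by (rule J_squared[OF N.tangent_space_points[OF that] that])
  have N0: "nijenhuis (cotangent_atlas A) (J s) (HF (dd c i)) (HF (dd c j)) a = 0" for i j
    by (rule nijenhuis_HF[OF fq dd dd ao])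
  have aP: "a \<in> PN" using ao by simp
  \<comment> \<open>J is moved into the first argument by \<open>nijenhuis_J_left\<close> and into
    the second by antisymmetry; each time the value is J or minus applied to a vanishing
    vector.\<close>
  have N1: "nijenhuis (cotangent_atlas A) (J s) (\<lambda>b. J s b (HF (dd c i) b)) (HF (dd c j)) a = 0" for i j
    by (rule trans[OF NJ.nijenhuis_J_left[OF J2 HFs HFs V(2)]]) (simp_all only: N0 NJ.J_zero[OF aP] minus_zero)
  have N2: "nijenhuis (cotangent_atlas A) (J s) (HF (dd c i)) (\<lambda>b. J s b (HF (dd c j) b)) a = 0" for i j
    by (rule trans[OF NJ.nijenhuis_anti[OF J_field[OF HFs] HFs V(2)]]) (simp_all only: N1 minus_zero)
  have N3: "nijenhuis (cotangent_atlas A) (J s) (\<lambda>b. J s b (HF (dd c i) b)) (\<lambda>b. J s b (HF (dd c j) b)) a = 0" for i j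
    by (rule trans[OF NJ.nijenhuis_J_left[OF J2 HFs J_field[OF HFs] V(2)]]) (simp_all only: N2 NJ.J_zero[OF aP] minus_zero)
  have NE: "nijenhuis (cotangent_atlas A) (J s) (E k) (E l) a = 0" for k l
    using N0 N1 N2 N3 by (cases k; cases l) (simp add: E_def)
  show "nijenhuis (cotangent_atlas A) (J s) \<Xi> H a = 0"
    by (rule NJ.nijenhuis_frame[OF fs[OF \<Xi>] fs[OF H] Es frame[OF \<Xi>] frame[OF H] NE V])
qed

end

theorem proposition5p3:
  fixes A :: "('a, 'e::euclidean_space) chart set"
    and h :: "'a metric_tensor"
    and nabla :: "'a connection"
  assumes "pseudo_riemannian_manifold A h"
    and "affine_connection A nabla"
  shows "norden_manifold (cotangent_atlas A) (J_minus A h nabla) (patterson_walker A nabla) \<and>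
    almost_para_norden_manifold (cotangent_atlas A) (J_plus A h nabla)
      (patterson_walker A nabla) \<and>
    (flat_quasi_statistical_manifold A h nabla \<longrightarrow>
       complex_norden_manifold (cotangent_atlas A) (J_minus A h nabla)
         (patterson_walker A nabla) \<and>
       para_norden_manifold (cotangent_atlas A) (J_plus A h nabla)
         (patterson_walker A nabla))"
proof -
  have M: "smooth_manifold A" and "pseudo_riemannian_metric A h"
    using assms(1) by (simp_all add: pseudo_riemannian_manifold_def)
  moreover have "smooth_atlas A" using M by (simp add: smooth_manifold_iff)
  ultimately interpret metric_connection_bundle A nabla h
    using assms(2)
    by (intro metric_connection_bundle.intro connection_bundle.intro cotangent_bundle.intro
        connection_bundle_axioms.intro metric_connection_bundle_axioms.intro)
  show ?thesis
    unfolding complex_norden_manifold_def para_norden_manifold_def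
    using norden_cotangent[OF M] almost_para_norden_cotangent[OF M] integrable_J by blast
qed

end
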